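(* Let $\theta\in\mathbb{R}$, $A_\theta:=(\theta-\tfrac{\pi}{2},\theta+\tfrac{\pi}{2})$, let $X\subset\mathbb{C}_x$ be a domain and $S\subset\mathbb{C}_\hbar$ a sectorial domain at the origin with opening $A_\theta$. Consider the Riccati equation $$\hbar\,\partial_xf=af^2+bf+c$$ whose coefficients $a,b,c$ are holomorphic functions of $(x,\hbar)\in X\times S$ admitting locally uniform asymptotic expansions $\hat a=\sum a_k\hbar^k$, $\hat b=\sum b_k\hbar^k$, $\hat c=\sum c_k\hbar^k$ with coefficients holomorphic on $X$, as $\hbar\to0$ along $A_\theta$. Assume that the leading-order discriminant $D_0=b_0^2-4a_0c_0$ is not identically zero. Fix a point $x_0\in X$ with $D_0(x_0)\ne0$, a square-root branch $\sqrt{D_0}$ near $x_0$, and a sign $\alpha\in\{+,-\}$. Assume: (1) there is a WKB $(\theta,\alpha)$-halfstrip domain $W\subset X$ containing $x_0$; if $\alpha=-$, assume in addition that $a_0$ is nonvanishing on $W$; (if $\alpha=+$, the branch $\sqrt{D_0}$ is the one for which the leading-order solution $f_0^+$ is holomorphic on $W$, see the context); (2) the asymptotic expansions of $a,b,c$ are valid with Gevrey bounds as $\hbar\to0$ along the closed arc $\bar A_\theta=[\theta-\tfrac{\pi}{2},\theta+\tfrac{\pi}{2}]$, with respect to the asymptotic scale $\sqrt{D_0}$, uniformly for all $x\in W$. Then the Riccati equation has a canonical local exact solution $f_\alpha^\theta$ near $x_0$ which is asymptotic to the formal solution $\hat f_\alpha$ as $\hbar\to0$ in the direction $\theta$. Namely,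 for any compactly contained domain $U_0\Subset W$, there is a sectorial domain $S_0\subset S$ with the same opening $A_\theta$ such that the Riccati equation has a unique holomorphic solution $f_\alpha^\theta$ on $U_0\times S_0$ which is Gevrey asymptotic to $\hat f_\alpha$ as $\hbar\to0$ along the closed arc $\bar A_\theta$, uniformly for all $x\in U_0$.
   Context: Sectorial domains. Let $[\mathbb{C}_\hbar:0]=[0,\infty)\times(\mathbb{R}/2\pi\mathbb{Z})$ be the real-oriented blowup of $\mathbb{C}_\hbar$ at $0$. A sectorial domain with opening $A$ is a simply connected domain $S\subset\mathbb{C}_\hbar\setminus\{0\}$ whose closure in $[\mathbb{C}_\hbar:0]$ meets the circle $\{0\}\times\mathbb{R}/2\pi\mathbb{Z}$ in the closed arc $\bar A$, of nonzero length. Locally uniform asymptotics along $A$. $g\sim\hat g=\sum g_k\hbar^k$ means: every point of $X$ has a neighbourhood $V$ such that for every $n\ge0$ and every subarc $A_0$ compactly contained in $A$ there are a sectorial domain $S'\subset S$ with opening $A_0$ and a constant $C>0$ with $|g-\sum_{k<n}g_k\hbar^k|\le C|\hbar|^n$ on $V\times S'$. Gevrey asymptotics along $\bar A$. $g\simeq\hat g$ along $\bar A$ with respect to a scale $\chi(x)$, uniformly for $x\in W$, means: there are $C,M>0$ such that $|g(x,\hbar)-\sum_{k=0}^{n-1}g_k(x)\hbar^k|\le|\chi(x)|\,CM^nn!\,|\hbar|^n$ for all $n\ge0$, all $x\in W$, and all sufficiently small $\hbar$ in the sectorial domain (with opening $A$) where $g$ is defined. If no scale is mentioned, $\chi=1$.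 WKB halfstrips. Put $\Phi(x)=\int_{x_0}^x\sqrt{D_0(t)}\,dt$. A WKB $(\theta,\pm)$-halfstrip domain containing $x_0$ is a domain $W=\Psi(H)\subset X$, where $H=\{z:\operatorname{dist}(z,z_1+e^{i\theta}\mathbb{R}_\pm)<r\}$ for some $z_1\in\mathbb{C}$, $r>0$ with $0\in H$ (here $\mathbb{R}_+=[0,\infty)$, $\mathbb{R}_-=(-\infty,0]$), and $\Psi:H\to X$ is a holomorphic map which is the analytic continuation to $H$ of the local inverse of $\Phi$ at $0=\Phi(x_0)$, $\Psi(0)=x_0$. Then $\Psi$ is a local biholomorphism, $D_0$ has no zeros on $W$, and $\sqrt{D_0}$ extends to a univalued function on $W$. Leading-order and formal solutions. If $a_0\not\equiv0$, $f_0^\pm:=\frac{-b_0\pm\sqrt{D_0}}{2a_0}$; if $a_0\equiv0$, then $\sqrt{D_0}:=b_0$ and $f_0^+:=-c_0/b_0$ (only the sign $+$ is considered). Convention: the branch $\sqrt{D_0}$ is labelled so that $f_0^+$ is holomorphic (this is automatic where $a_0$ is nonvanishing). The formal solution $\hat f_\alpha=\sum_{k\ge0}f_k^\alpha(x)\hbar^k$ is the unique formal power series with holomorphic coefficients on $W$ solving $\hbar\partial_x\hat f=\hat a\hat f^2+\hat b\hat f+\hat c$ with leading term $f_0^\alpha$.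
   Formalization: The sectorial domain S is additionally assumed to contain a Borel disc {Re(e^{iθ}/ħ) > R} for some R > 0; with only the closure condition at the boundary circle, uniqueness can fail, already for ħ∂ₓf = f. *)

theory Defs
  imports "HOL-Complex_Analysis.Complex_Analysis"
    "HOL-Computational_Algebra.Formal_Power_Series"
begin

definition complex_domain :: "complex set \<Rightarrow> bool" where
  "complex_domain U \<longleftrightarrow> open U \<and> connected U \<and> U \<noteq> {}"

definition compactly_contained :: "complex set \<Rightarrow> complex set \<Rightarrow> bool" where
  "compactly_contained U W \<longleftrightarrow> compact (closure U) \<and> closure U \<subseteq> W"

text \<open>Joint holomorphy in two complex variables: the total derivative exists and is
  complex linear.\<close>

definition holomorphic2_on ::
    "(complex \<Rightarrow> complex \<Rightarrow> complex) \<Rightarrow> complex set \<Rightarrow> complex set \<Rightarrow> bool" where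
  "holomorphic2_on g U S \<longleftrightarrow>
     (\<forall>x\<in>U. \<forall>h\<in>S. \<exists>p q.
        ((\<lambda>(y, k). g y k) has_derivative (\<lambda>(u, v). p * u + q * v)) (at (x, h)))"

text \<open>The real-oriented blowup of the plane at 0 is realised as the closed subset
  \<open>[0,\<infinity>) \<times> sphere 0 1\<close> of \<^typ>\<open>real \<times> complex\<close>, the circle \<open>\<real>/2\<pi>\<int>\<close> being
  identified with the unit circle by \<^const>\<open>cis\<close>. A nonzero \<open>h\<close> corresponds to
  \<open>(norm h, sgn h)\<close>.\<close>

definition blowup_boundary :: "complex set \<Rightarrow> complex set" where
  "blowup_boundary S = {w. (0, w) \<in> closure ((\<lambda>h. (norm h, sgn h)) ` S)}"

definition sectorial_domain :: "real \<Rightarrow> real \<Rightarrow> complex set \<Rightarrow> bool" where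
  "sectorial_domain l u S \<longleftrightarrow>
     complex_domain S \<and> simply_connected S \<and> 0 \<notin> S \<and>
     l < u \<and> blowup_boundary S = cis ` {l..u}"

text \<open>For positive \<open>R\<close>, a disc tangent at 0 to the line of directions \<open>\<theta> \<plusminus> \<pi>/2\<close>; it is a
  sectorial domain with opening \<open>(\<theta> - \<pi>/2, \<theta> + \<pi>/2)\<close>. The trace of \<open>S\<close> on the
  boundary circle does not control how \<open>S\<close> approaches the two end directions, and on a
  sectorial domain of this opening that contains no such disc Watson's lemma can fail:
  for \<open>\<theta> = 0\<close> and \<open>z = 1/h\<close>, the function \<open>exp (- z Ln z)\<close> is smaller than every
  \<open>exp (- L \<bar>z\<bar>)\<close> on the domain given by \<open>Re z > 0\<close>, \<open>\<bar>z\<bar> > exp 5\<close> and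
  \<open>cos (Arg z) sqrt (ln \<bar>z\<bar>) > 2\<close>. Uniqueness of Gevrey asymptotic solutions then fails
  already for \<open>h f' = f\<close>. The domain on which the coefficients are given is therefore taken
  to contain a Borel disc.\<close>

definition borel_disc :: "real \<Rightarrow> real \<Rightarrow> complex set" where
  "borel_disc \<theta> R = {h. h \<noteq> 0 \<and> Re (cis \<theta> / h) > R}"

definition locally_uniform_asymp ::
    "complex set \<Rightarrow> complex set \<Rightarrow> real \<Rightarrow> real \<Rightarrow>
     (complex \<Rightarrow> complex \<Rightarrow> complex) \<Rightarrow> (nat \<Rightarrow> complex \<Rightarrow> complex) \<Rightarrow> bool" where
  "locally_uniform_asymp X S l u g gs \<longleftrightarrow>
     (\<forall>x\<in>X. \<exists>V. open V \<and> x \<in> V \<and> V \<subseteq> X \<and>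
        (\<forall>n l' u'. l < l' \<and> l' < u' \<and> u' < u \<longrightarrow>
           (\<exists>S' C. S' \<subseteq> S \<and> sectorial_domain l' u' S' \<and> C > 0 \<and>
              (\<forall>y\<in>V. \<forall>h\<in>S'. norm (g y h - (\<Sum>k<n. gs k y * h ^ k)) \<le> C * norm h ^ n))))"

definition gevrey_asymp ::
    "(complex \<Rightarrow> complex) \<Rightarrow> complex set \<Rightarrow> complex set \<Rightarrow>
     (complex \<Rightarrow> complex \<Rightarrow> complex) \<Rightarrow> (nat \<Rightarrow> complex \<Rightarrow> complex) \<Rightarrow> bool" where
  "gevrey_asymp \<kappa> W S g gs \<longleftrightarrow>
     (\<exists>C>0. \<exists>M>0. \<exists>\<epsilon>>0. \<forall>n. \<forall>x\<in>W. \<forall>h\<in>S. norm h < \<epsilon> \<longrightarrow>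
        norm (g x h - (\<Sum>k<n. gs k x * h ^ k)) \<le>
          norm (\<kappa> x) * C * M ^ n * fact n * norm h ^ n)"

definition discriminant0 ::
    "(complex \<Rightarrow> complex) \<Rightarrow> (complex \<Rightarrow> complex) \<Rightarrow> (complex \<Rightarrow> complex) \<Rightarrow> complex \<Rightarrow> complex" where
  "discriminant0 a0 b0 c0 x = (b0 x)\<^sup>2 - 4 * a0 x * c0 x"

definition halfstrip :: "real \<Rightarrow> real \<Rightarrow> complex \<Rightarrow> real \<Rightarrow> complex set" where
  "halfstrip \<theta> \<alpha> z1 r =
     {z. infdist z ((\<lambda>t. z1 + cis \<theta> * complex_of_real (\<alpha> * t)) ` {0..}) < r}"

text \<open>Here \<open>\<alpha>\<close> is 1 or -1, and \<open>s\<close> is a branch of the square root of the discriminant near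
  \<open>x0\<close>. The last conjunct together with \<open>\<Psi> 0 = x0\<close> says that near 0 the map \<open>\<Psi>\<close> is the
  local inverse of \<open>\<Phi>(x) = \<integral> s\<close> (integral from \<open>x0\<close> to \<open>x\<close>).\<close>

definition WKB_halfstrip ::
    "complex set \<Rightarrow> (complex \<Rightarrow> complex) \<Rightarrow> complex \<Rightarrow> real \<Rightarrow> real \<Rightarrow> complex set \<Rightarrow> bool" where
  "WKB_halfstrip X s x0 \<theta> \<alpha> W \<longleftrightarrow>
     (\<exists>z1 r \<Psi>. r > 0 \<and> 0 \<in> halfstrip \<theta> \<alpha> z1 r \<and>
        \<Psi> holomorphic_on halfstrip \<theta> \<alpha> z1 r \<and>
        \<Psi> ` halfstrip \<theta> \<alpha> z1 r \<subseteq> X \<and>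
        W = \<Psi> ` halfstrip \<theta> \<alpha> z1 r \<and>
        \<Psi> 0 = x0 \<and>
        (\<forall>\<^sub>F z in nhds 0. contour_integral (linepath x0 (\<Psi> z)) s = z))"

text \<open>If \<open>a0\<close> is not identically zero, its zeros are removable singularities of the
  quotient, because \<open>f0\<close> is required to be holomorphic on all of \<open>W\<close>.\<close>

definition leading_solution ::
    "complex set \<Rightarrow> complex set \<Rightarrow> (complex \<Rightarrow> complex) \<Rightarrow> (complex \<Rightarrow> complex) \<Rightarrow>
     (complex \<Rightarrow> complex) \<Rightarrow> (complex \<Rightarrow> complex) \<Rightarrow> real \<Rightarrow> (complex \<Rightarrow> complex) \<Rightarrow> bool" where
  "leading_solution X W a0 b0 c0 q \<alpha> f0 \<longleftrightarrow>
     f0 holomorphic_on W \<and>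
     (if \<forall>x\<in>X. a0 x = 0 then \<alpha> = 1 \<and> (\<forall>x\<in>W. f0 x = - c0 x / b0 x)
      else (\<forall>x\<in>W. a0 x \<noteq> 0 \<longrightarrow>
              f0 x = (- b0 x + complex_of_real \<alpha> * q x) / (2 * a0 x)))"

definition formal_riccati_solution ::
    "complex set \<Rightarrow> (nat \<Rightarrow> complex \<Rightarrow> complex) \<Rightarrow> (nat \<Rightarrow> complex \<Rightarrow> complex) \<Rightarrow>
     (nat \<Rightarrow> complex \<Rightarrow> complex) \<Rightarrow> (nat \<Rightarrow> complex \<Rightarrow> complex) \<Rightarrow> bool" where
  "formal_riccati_solution W as bs cs fs \<longleftrightarrow>
     (\<forall>k. fs k holomorphic_on W) \<and>
     (\<forall>x\<in>W. fps_X * Abs_fps (\<lambda>k. deriv (fs k) x) =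
        Abs_fps (\<lambda>k. as k x) * (Abs_fps (\<lambda>k. fs k x))\<^sup>2
        + Abs_fps (\<lambda>k. bs k x) * Abs_fps (\<lambda>k. fs k x)
        + Abs_fps (\<lambda>k. cs k x))"

definition riccati_solution ::
    "complex set \<Rightarrow> complex set \<Rightarrow> (complex \<Rightarrow> complex \<Rightarrow> complex) \<Rightarrow>
     (complex \<Rightarrow> complex \<Rightarrow> complex) \<Rightarrow> (complex \<Rightarrow> complex \<Rightarrow> complex) \<Rightarrow>
     (complex \<Rightarrow> complex \<Rightarrow> complex) \<Rightarrow> bool" where
  "riccati_solution U S a b c f \<longleftrightarrow>
     holomorphic2_on f U S \<and>
     (\<forall>x\<in>U. \<forall>h\<in>S.
        h * deriv (\<lambda>y. f y h) x = a x h * (f x h)\<^sup>2 + b x h * f x h + c x h)"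

end

theory Submission
  imports Defs
begin

text \<open>
  Along \<open>W\<close> put \<open>\<kappa> = cis \<theta> / h\<close> and use the flat coordinate \<open>\<zeta>\<close> given by
  \<open>\<Psi>\<close> with its argument rotated by \<open>\<alpha> cis \<theta>\<close>. Division by \<open>\<surd>D\<^sub>0\<close> turns the equation into
  \<open>F' = \<kappa> (A F\<^sup>2 + B F + C)\<close> on a halfstrip that is invariant under \<open>\<zeta> \<mapsto> \<zeta> + s\<close>, \<open>s \<ge> 0\<close>,
  with bounded coefficients, \<open>2 A\<^sub>0 F\<^sub>0 + B\<^sub>0 = 1\<close>, and \<open>\<kappa>\<close> in a right half-plane: a Borel disc
  in \<open>h\<close> is exactly a half-plane \<open>Re \<kappa> > R\<close>. The linearisation at the leading-order root is
  \<open>v' = \<kappa> v\<close>, whose solutions all grow along the strip, so bounded perturbations of the root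
  are found by integrating from infinity against \<open>exp (- \<kappa> s)\<close>. Because the equation can be
  written with a right-hand side that does not carry the factor \<open>\<kappa>\<close>, this operator has norm
  of order \<open>1 / R\<close> and Picard iteration converges for all \<open>Re \<kappa> > R\<close> at once, without any Borel
  transform (\<open>weighted_Picard_solution\<close>).

  The root \<open>F\<^sub>0\<close> may be unbounded on the halfstrip, where only the projective line it spans is
  controlled. The remedy (\<open>Riccati_solution_near_root\<close>) is the chart
  \<open>F = F\<^sub>0 + g / (1 - A\<^sub>0 g)\<close> in which \<open>g = \<infinity>\<close> is the second root, together with a zero-free
  factor \<open>g = \<sigma>\<^sup>2 y\<close> chosen such that \<open>\<sigma> (1 - A\<^sub>0 F\<^sub>0, A\<^sub>0)\<close>, up to a sign the eigenvector of
  the associated linear system that belongs to the second root, satisfies a linear differential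
  equation with bounded coefficients. Its squared length is then a weight that decreases at most
  exponentially along the strip, which \<open>exp (- \<kappa> s)\<close> compensates for large \<open>R\<close>, and the equation for \<open>y\<close> has coefficients bounded in this weight.

  The Gevrey estimates are local and need no further integration (\<open>Gevrey_expansion_of_Riccati_solution\<close>).
  Let \<open>y\<^sub>n = \<kappa>\<^sup>n (F - (\<Sum>k<n. F\<^sub>k / \<kappa>\<^sup>k))\<close>. Comparing the equation with its formal version
  expresses \<open>y\<^sub>n\<close> through the derivative of its predecessor and products of remainders of lower
  order; a Cauchy estimate on a disc of radius \<open>\<delta> / n\<close> costs one factor \<open>n\<close> per step, which is the
  growth \<open>n!\<close>.

  Uniqueness is Watson's lemma (\<open>Watson_lemma_halfplane\<close>): a function with Gevrey expansion
  zero on a half-plane decays exponentially there, hence vanishes by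
  Phragmen--Lindelof. The same argument shows that the solution found on the halfstrip takes
  equal values at points with the same image under \<open>\<Psi>\<close>, so that it descends to \<open>W\<close>
  although \<open>\<Psi>\<close> need not be injective.
\<close>

section \<open>Watson's lemma on a half-plane\<close>

text \<open>For \<open>n\<close> near \<open>norm w / (e M)\<close> the estimate \<open>n! \<le> n\<^sup>n\<close> makes the bound comparable to
  \<open>exp (- n)\<close>.\<close>

lemma exponentially_small_of_Gevrey_bounds:
  assumes "M > 0" "C \<ge> 0"
  obtains c D where "c > 0" "D \<ge> 0"
    "\<And>(w::complex) (v::complex). w \<noteq> 0 \<Longrightarrow> (\<And>n. norm v \<le> C * M ^ n * fact n / norm w ^ n) \<Longrightarrow> norm v \<le> D * exp (- c * norm w)"
proof
  define c where "c = 1 / (exp 1 * M)"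
  show "c > 0" using assms by (simp add: c_def)
  show "C * exp 1 \<ge> 0" using assms by simp
  fix w v :: complex
  assume w: "w \<noteq> 0" and b: "\<And>n. norm v \<le> C * M ^ n * fact n / norm w ^ n"
  define n where "n = nat \<lfloor>c * norm w\<rfloor>"
  have cw: "0 \<le> c * norm w" using \<open>c > 0\<close> by simp
  then have n1: "real n \<le> c * norm w" and n2: "c * norm w \<le> real n + 1"
    unfolding n_def by linarith+
  have "norm v \<le> C * (M ^ n * fact n / norm w ^ n)" using b[of n] by (simp add: mult.assoc)
  also have "\<dots> \<le> C * (M ^ n * real n ^ n / norm w ^ n)"
  proof -
    have "(fact n :: real) \<le> real (n ^ n)" by (metis fact_le_power order_refl of_nat_fact)
    then have "(fact n :: real) \<le> real n ^ n" by simp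
    then show ?thesis
      using assms by (intro mult_left_mono divide_right_mono) auto
  qed
  also have "\<dots> = C * (M * real n / norm w) ^ n"
    by (simp add: power_mult_distrib power_divide)
  also have "\<dots> \<le> C * (exp (-1)) ^ n"
  proof -
    have "M * real n / norm w \<le> M * (c * norm w) / norm w"
      using n1 assms by (intro divide_right_mono mult_left_mono) auto
    also have "\<dots> = exp (-1)" using w assms by (simp add: c_def exp_minus field_simps)
    finally show ?thesis using assms
      by (intro mult_left_mono power_mono) auto
  qed
  also have "\<dots> = C * exp (- real n)" by (simp add: exp_of_nat_mult[symmetric])
  also have "\<dots> \<le> C * exp (1 - c * norm w)"
    using n2 assms by (intro mult_left_mono) auto
  also have "\<dots> = C * exp 1 * exp (- c * norm w)" by (simp add: exp_diff exp_minus field_simps)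
  finally show "norm v \<le> C * exp 1 * exp (- c * norm w)" .
qed

text \<open>Where \<open>c norm w \<ge> N Re w\<close> the claim is the hypothesis. The remaining set is a sector of
  half-angle \<open>\<beta> < \<pi> / 2\<close> with \<open>cos \<beta> = c / N\<close>; on its two sides \<open>exp (N w) \<psi> w\<close> is bounded by
  \<open>C\<close>, inside it has order 1, and the opening is less than \<open>\<pi>\<close>, so the maximum principle
  applies after damping with \<open>exp (- \<eta> (w + 1)\<^sup>\<rho>)\<close> for some \<open>\<rho>\<close> between 1 and \<open>\<pi> / (2 \<beta>)\<close>.\<close>

lemma Phragmen_Lindelof_halfplane_decay:
  fixes \<psi> :: "complex \<Rightarrow> complex"
  assumes hol: "\<psi> holomorphic_on {w. Re w > - d}" and d: "d > 0"
    and c: "0 < c" "c < N" and C: "C \<ge> 0"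
    and bnd: "\<And>w. Re w \<ge> 0 \<Longrightarrow> norm (\<psi> w) \<le> C * exp (- c * norm w)"
    and z: "Re z > 0"
  shows "norm (\<psi> z) \<le> C * exp (- N * Re z)"
proof (cases "N * Re z \<le> c * norm z")
  case True
  have "norm (\<psi> z) \<le> C * exp (- c * norm z)" using bnd z by simp
  also have "\<dots> \<le> C * exp (- N * Re z)" using True C by (intro mult_left_mono) auto
  finally show ?thesis .
next
  case False
  define \<beta> where "\<beta> = arccos (c / N)"
  have cN: "0 < c / N" "c / N < 1" using c by auto
  have \<beta>: "0 < \<beta>" "\<beta> < pi / 2" "cos \<beta> = c / N"
  proof -
    show "cos \<beta> = c / N" using cN by (simp add: \<beta>_def)
    show "0 < \<beta>" unfolding \<beta>_def using cN arccos_lt_bounded[of "c/N"] by auto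
    show "\<beta> < pi / 2" unfolding \<beta>_def
      using cN arccos_less_mono[of "c/N" 0] arccos_0 by auto
  qed
  define \<rho> where "\<rho> = (1 + pi / (2 * \<beta>)) / 2"
  have "1 < pi / (2 * \<beta>)" using \<beta> by (simp add: field_simps)
  then have \<rho>: "1 < \<rho>" "\<rho> < pi / (2 * \<beta>)" by (auto simp: \<rho>_def)
  have \<rho>\<beta>: "\<rho> * \<beta> < pi / 2" using \<rho> \<beta> by (simp add: field_simps)
  define k where "k = cos (\<rho> * \<beta>)"
  have k: "k > 0" unfolding k_def using \<rho>\<beta> \<rho> \<beta> by (intro cos_gt_zero_pi) (auto intro: order.strict_trans2[of _ 0])
  define P where "P = (\<lambda>w::complex. (w + 1) powr of_real \<rho>)"
  have reP: "Re (P w) \<ge> k * norm (w + 1) powr \<rho>" if w: "c * norm w \<le> N * Re w" "0 \<le> Re w" for w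
  proof -
    have nz: "w + 1 \<noteq> 0" using w(2) by (auto simp: complex_eq_iff)
    define a where "a = Im (Ln (w + 1))"
    have "c * norm (w + 1) \<le> c * (norm w + 1)" using c norm_triangle_ineq[of w 1]
      by (intro mult_left_mono) auto
    also have "\<dots> \<le> N * Re w + N" using w(1) c by (simp add: algebra_simps)
    finally have "c * norm (w + 1) \<le> N * Re (w + 1)" by (simp add: algebra_simps)
    then have "c / N \<le> Re (w + 1) / norm (w + 1)" using c nz
      by (simp add: field_simps)
    also have "\<dots> = cos a" unfolding a_def
      using nz by (metis Arg_eq_Im_Ln cos_Arg)
    finally have "cos \<beta> \<le> cos \<bar>a\<bar>" using \<beta> by simp
    moreover have "\<bar>a\<bar> \<le> pi" unfolding a_def
      using Im_Ln_le_pi[OF nz] mpi_less_Im_Ln[OF nz] by simp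
    ultimately have "\<bar>a\<bar> \<le> \<beta>" using cos_mono_le_eq[of \<beta> "\<bar>a\<bar>"] \<beta> by auto
    then have "\<rho> * \<bar>a\<bar> \<le> \<rho> * \<beta>" using \<rho> by simp
    then have "cos (\<rho> * \<beta>) \<le> cos (\<rho> * \<bar>a\<bar>)"
      using \<rho> \<rho>\<beta> \<beta> pi_gt_zero by (intro cos_monotone_0_pi_le) auto
    then have ka: "k \<le> cos (\<rho> * a)" unfolding k_def by (simp add: abs_if split: if_splits)
    have "P w = exp (of_real \<rho> * Ln (w + 1))" using nz by (simp add: P_def powr_def)
    then have "Re (P w) = exp (\<rho> * Re (Ln (w + 1))) * cos (\<rho> * a)"
      by (simp add: Re_exp a_def)
    also have "exp (\<rho> * Re (Ln (w + 1))) = norm (w + 1) powr \<rho>"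
      using nz by (simp add: powr_def)
    finally show ?thesis using ka by (simp add: mult.commute mult_right_mono)
  qed
  define G where "G = (\<lambda>\<eta>::real. \<lambda>w. \<psi> w * exp (of_real N * w) * exp (- of_real \<eta> * P w))"
  have main: "norm (G \<eta> z) \<le> C" if \<eta>: "\<eta> > 0" for \<eta>
  proof -
    define T where "T = max (norm z + 1) ((N / (\<eta> * k)) powr (1 / (\<rho> - 1)))"
    have T: "norm z < T" "T > 0" by (auto simp: T_def intro!: less_max_iff_disj[THEN iffD2] add_nonneg_pos)
    have T2: "N * T \<le> \<eta> * k * T powr \<rho>"
    proof -
      have "N / (\<eta> * k) = ((N / (\<eta> * k)) powr (1 / (\<rho> - 1))) powr (\<rho> - 1)"
        using \<rho> \<eta> k c by (simp add: powr_powr)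
      also have "\<dots> \<le> T powr (\<rho> - 1)" using \<rho> by (intro powr_mono2) (auto simp: T_def)
      finally have "N \<le> \<eta> * k * T powr (\<rho> - 1)" using \<eta> k by (simp add: field_simps)
      then have "N * T \<le> \<eta> * k * T powr (\<rho> - 1) * T" using T by (intro mult_right_mono) auto
      also have "\<dots> = \<eta> * k * T powr \<rho>" using T
        by (simp add: powr_diff)
      finally show ?thesis .
    qed
    define S where "S = {w. c * norm w < N * Re w} \<inter> ball 0 T"
    define S' where "S' = {w. c * norm w \<le> N * Re w} \<inter> cball 0 T"
    have oS: "open S" unfolding S_def
      by (intro open_Int open_Collect_less continuous_intros) auto
    have "closed S'" unfolding S'_def
      by (intro closed_Int closed_Collect_le continuous_intros) auto
    moreover have "S \<subseteq> S'" by (auto simp: S_def S'_def)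
    ultimately have clS: "closure S \<subseteq> S'" by (rule closure_minimal[rotated])
    have S're: "Re w \<ge> 0" if "w \<in> S'" for w
    proof -
      have "0 \<le> c * norm w" using c by simp
      also have "\<dots> \<le> N * Re w" using that by (simp add: S'_def)
      finally show ?thesis using c by (simp add: zero_le_mult_iff)
    qed
    have holG: "G \<eta> holomorphic_on {w. Re w > - min d 1}"
      unfolding G_def P_def
    proof (intro holomorphic_intros)
      show "\<psi> holomorphic_on {w. - min d 1 < Re w}"
        by (rule holomorphic_on_subset[OF hol]) auto
      fix w assume "w \<in> {w. - min d 1 < Re w}"
      then show "w + 1 \<notin> \<real>\<^sub>\<le>\<^sub>0" by (auto simp: complex_nonpos_Reals_iff)
    qed
    have sub: "S' \<subseteq> {w. Re w > - min d 1}" using S're d by fastforce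
    show ?thesis
    proof (rule maximum_modulus_frontier[of "G \<eta>" S])
      show "G \<eta> holomorphic_on interior S"
        using holG sub clS closure_subset interior_subset by (meson holomorphic_on_subset order_trans)
      show "continuous_on (closure S) (G \<eta>)"
        using holG sub clS by (meson holomorphic_on_imp_continuous_on holomorphic_on_subset order_trans)
      show "bounded S" unfolding S_def by auto
      show "z \<in> S" using False T by (auto simp: S_def)
      fix w assume "w \<in> frontier S"
      then have w: "w \<in> S'" "w \<notin> S" using clS oS by (auto simp: frontier_def interior_open)
      have re: "Re w \<ge> 0" using S're w by auto
      have cond: "c * norm w \<le> N * Re w" using w by (simp add: S'_def)
      have nG: "norm (G \<eta> w) \<le> C * exp (- c * norm w) * exp (N * Re w) * exp (- \<eta> * (k * norm (w + 1) powr \<rho>))"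
      proof -
        have "norm (G \<eta> w) = norm (\<psi> w) * exp (N * Re w) * exp (- \<eta> * Re (P w))"
          by (simp add: G_def norm_mult)
        also have "\<dots> \<le> C * exp (- c * norm w) * exp (N * Re w) * exp (- \<eta> * (k * norm (w + 1) powr \<rho>))"
          using bnd[OF re] reP[OF cond re] \<eta> C
          by (intro mult_mono) auto
        finally show ?thesis .
      qed
      from w have "c * norm w = N * Re w \<or> norm w = T" by (auto simp: S_def S'_def)
      then have le0: "- c * norm w + N * Re w + - \<eta> * (k * norm (w + 1) powr \<rho>) \<le> 0"
      proof
        assume "c * norm w = N * Re w"
        then show ?thesis using \<eta> k by simp
      next
        assume wT: "norm w = T"
        have "norm w \<le> norm (w + 1)" using re
          by (simp add: norm_complex_def power2_eq_square algebra_simps)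
        then have "T powr \<rho> \<le> norm (w + 1) powr \<rho>" using \<rho> wT T by (intro powr_mono2) auto
        then have "\<eta> * k * T powr \<rho> \<le> \<eta> * k * norm (w + 1) powr \<rho>" using \<eta> k by (intro mult_left_mono) auto
        moreover have "N * Re w \<le> N * T" using complex_Re_le_cmod[of w] wT c by (intro mult_left_mono) auto
        moreover have "0 \<le> c * norm w" using c by simp
        ultimately show ?thesis using T2 by (simp add: mult.assoc) 
      qed
      have "norm (G \<eta> w) \<le> C * exp (- c * norm w + N * Re w + - \<eta> * (k * norm (w + 1) powr \<rho>))"
        using nG by (simp only: exp_add mult.assoc)
      also have "\<dots> \<le> C * 1" using le0 C by (intro mult_left_mono) auto
      finally show "norm (G \<eta> w) \<le> C" by simp
    qed
  qed
  have "((\<lambda>\<eta>. norm (G \<eta> z)) \<longlongrightarrow> norm (G 0 z)) (at_right 0)"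
    unfolding G_def by (intro tendsto_intros)
  then have "norm (G 0 z) \<le> C"
    by (rule tendsto_upperbound) (auto simp: eventually_at_right_less intro!: eventually_at_rightI[of 0 1] main)
  then have "norm (\<psi> z) * exp (N * Re z) \<le> C" by (simp add: G_def norm_mult)
  then show ?thesis by (simp add: exp_minus field_simps)
qed

text \<open>The previous bound holds with the same \<open>C\<close> for every \<open>N\<close>; let \<open>N\<close> tend to infinity.\<close>

lemma exponentially_small_on_halfplane_imp_zero:
  fixes \<phi> :: "complex \<Rightarrow> complex"
  assumes hol: "\<phi> holomorphic_on {w. Re w > R}" and R: "R \<ge> 0" and c: "c > 0" and C: "C \<ge> 0"
    and bnd: "\<And>w. Re w > R \<Longrightarrow> norm (\<phi> w) \<le> C * exp (- c * norm w)"
    and z: "Re z > R"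
  shows "\<phi> z = 0"
proof -
  define R' where "R' = (R + Re z) / 2"
  have R': "R < R'" "R' < Re z" "R' \<ge> 0" using z R by (auto simp: R'_def)
  define \<psi> where "\<psi> = (\<lambda>w. \<phi> (w + of_real R'))"
  define v where "v = z - of_real R'"
  have le: "norm (\<psi> v) \<le> C * exp (- N * Re v)" if N: "N > c" for N
  proof (rule Phragmen_Lindelof_halfplane_decay[of \<psi> "R' - R" c N C v])
    show "\<psi> holomorphic_on {w. - (R' - R) < Re w}"
      unfolding \<psi>_def
      by (rule holomorphic_on_compose_gen[OF _ hol, unfolded o_def]) (auto intro!: holomorphic_intros)
    fix w assume w: "0 \<le> Re w"
    have "norm w \<le> norm (w + of_real R')" 
      using w R' by (simp add: norm_complex_def)
    then have "exp (- c * norm (w + of_real R')) \<le> exp (- c * norm w)" using c by simp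
    moreover have "norm (\<psi> w) \<le> C * exp (- c * norm (w + of_real R'))"
      unfolding \<psi>_def using w R' by (intro bnd) auto
    ultimately show "norm (\<psi> w) \<le> C * exp (- c * norm w)"
      using C by (meson mult_left_mono order_trans)
  qed (use R' c C N in \<open>auto simp: v_def\<close>)
  have rv: "Re v > 0" using R' by (simp add: v_def)
  have "((\<lambda>N. C * exp (- N * Re v)) \<longlongrightarrow> C * 0) at_top"
  proof (intro tendsto_intros filterlim_compose[OF exp_at_bot])
    have "LIM N at_top. N * Re v :> at_top"
      using filterlim_tendsto_pos_mult_at_top[OF tendsto_const rv filterlim_ident]
      by (simp add: mult.commute)
    then show "LIM N at_top. - N * Re v :> at_bot"
      by (simp add: filterlim_uminus_at_bot)
  qed
  then have "norm (\<psi> v) \<le> C * 0"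
    by (rule tendsto_lowerbound) (use eventually_mono[OF eventually_gt_at_top[of c] le] in auto)
  then show ?thesis by (simp add: \<psi>_def v_def)
qed

lemma Watson_lemma_halfplane:
  fixes \<phi> :: "complex \<Rightarrow> complex"
  assumes hol: "\<phi> holomorphic_on {w. Re w > R}" and R: "R \<ge> 0" and M: "M > 0" and C: "C \<ge> 0"
    and bnd: "\<And>w n. Re w > R \<Longrightarrow> norm (\<phi> w) \<le> C * M ^ n * fact n / norm w ^ n"
    and z: "Re z > R"
  shows "\<phi> z = 0"
proof -
  obtain c D where c: "c > 0" "D \<ge> 0" 
    and est: "\<And>(w::complex) (v::complex). w \<noteq> 0 \<Longrightarrow> (\<And>n. norm v \<le> C * M ^ n * fact n / norm w ^ n) \<Longrightarrow> norm v \<le> D * exp (- c * norm w)"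
    using exponentially_small_of_Gevrey_bounds[OF M C] by metis
  show ?thesis
  proof (rule exponentially_small_on_halfplane_imp_zero[OF hol R c _ z])
    fix w assume w: "Re w > R"
    then have "w \<noteq> 0" using R by auto
    then show "norm (\<phi> w) \<le> D * exp (- c * norm w)" by (rule est) (rule bnd[OF w])
  qed
qed

section \<open>Functions holomorphic in each of two variables\<close>

text \<open>Continuity is included to avoid Hartogs' theorem; it makes the class stable under integration
  with respect to a parameter.\<close>

definition sep_holo :: "(complex \<Rightarrow> complex \<Rightarrow> complex) \<Rightarrow> complex set \<Rightarrow> complex set \<Rightarrow> bool" where
  "sep_holo g U V \<longleftrightarrow> continuous_on (U \<times> V) (\<lambda>(x, h). g x h) \<and>
     (\<forall>h\<in>V. (\<lambda>x. g x h) holomorphic_on U) \<and> (\<forall>x\<in>U. g x holomorphic_on V)"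

lemma norm_deriv_le_Cauchy:
  assumes hol: "f holomorphic_on S" and sub: "cball z r \<subseteq> S" and S: "open S" and r: "r > 0"
    and B: "\<And>w. w \<in> cball z r \<Longrightarrow> norm (f w) \<le> B"
  shows "norm (deriv f z) \<le> B / r"
proof -
  have "norm ((deriv ^^ 1) f z) \<le> fact 1 * B / r ^ 1"
  proof (rule Cauchy_inequality)
    show "f holomorphic_on ball z r" using hol sub ball_subset_cball by (meson holomorphic_on_subset order_trans)
    show "continuous_on (cball z r) f" using hol sub holomorphic_on_imp_continuous_on holomorphic_on_subset by blast
  qed (use r B in \<open>auto simp: dist_norm\<close>)
  then show ?thesis by simp
qed

text \<open>By the Cauchy estimate the derivative at \<open>t\<close> is close to the derivative at \<open>t0\<close> as soon as
  \<open>g\<close> is uniformly close on a disc. The parameter space is kept general: it is used for a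
  complex variable and for a real variable of integration.\<close>

lemma continuous_on_deriv_param:
  fixes g :: "complex \<Rightarrow> 'b::metric_space \<Rightarrow> complex"
  assumes U: "open U" and cont: "continuous_on (U \<times> V) (\<lambda>(x, t). g x t)"
    and hol: "\<And>t. t \<in> V \<Longrightarrow> (\<lambda>x. g x t) holomorphic_on U"
  shows "continuous_on (U \<times> V) (\<lambda>(x, t). deriv (\<lambda>x. g x t) x)"
proof -
  have "\<exists>d>0. \<forall>x\<in>U. \<forall>t\<in>V. dist (x, t) (x0, t0) < d \<longrightarrow>
          dist (deriv (\<lambda>x. g x t) x) (deriv (\<lambda>x. g x t0) x0) < e"
    if x0: "x0 \<in> U" and t0: "t0 \<in> V" and e: "e > 0" for x0 t0 e
  proof -
    obtain r where r: "r > 0" "cball x0 (2 * r) \<subseteq> U"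
    proof -
      obtain r where "r > 0" "cball x0 r \<subseteq> U" using U x0 open_contains_cball by blast
      then show ?thesis by (intro that[of "r / 2"]) auto
    qed
    have c2: "continuous_on (V \<times> cball x0 (2 * r)) (\<lambda>(t, x). g x t)"
    proof -
      have "continuous_on (V \<times> cball x0 (2 * r)) ((\<lambda>(x, t). g x t) \<circ> prod.swap)"
        using r by (intro continuous_on_compose continuous_on_subset[OF cont] continuous_on_swap) auto
      then show ?thesis by (simp add: o_def case_prod_unfold)
    qed
    obtain X0 where X0: "t0 \<in> X0" "open X0"
      "\<forall>t\<in>X0 \<inter> V. \<forall>x\<in>cball x0 (2 * r). dist (g x t) (g x t0) \<le> e * r / 4"
      using continuous_on_prod_compactE[OF c2 _ t0, of "e * r / 4"] e r by auto
    obtain d1 where d1: "d1 > 0" "ball t0 d1 \<subseteq> X0" using X0 open_contains_ball by blast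
    have "continuous_on U (deriv (\<lambda>x. g x t0))"
      using hol[OF t0] U holomorphic_deriv holomorphic_on_imp_continuous_on by blast
    then obtain d2 where d2: "d2 > 0" "\<And>x. x \<in> U \<Longrightarrow> dist x x0 < d2 \<Longrightarrow>
         dist (deriv (\<lambda>x. g x t0) x) (deriv (\<lambda>x. g x t0) x0) < e / 2"
      using x0 e unfolding continuous_on_iff by (metis half_gt_zero)
    show ?thesis
    proof (intro exI[of _ "min r (min d1 d2)"] conjI ballI impI)
      show "0 < min r (min d1 d2)" using r d1 d2 by simp
      fix x t assume x: "x \<in> U" and t: "t \<in> V" and d: "dist (x, t) (x0, t0) < min r (min d1 d2)"
      have dx: "dist x x0 < min r d2" using d dist_fst_le[of "(x,t)" "(x0,t0)"] by simp
      have dt: "dist t t0 < d1" using d dist_snd_le[of "(x,t)" "(x0,t0)"] by simp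
      have sub: "cball x r \<subseteq> cball x0 (2 * r)"
      proof
        fix w assume "w \<in> cball x r"
        then show "w \<in> cball x0 (2 * r)" using dx dist_triangle[of x0 w x] by (simp add: dist_commute)
      qed
      have tX: "t \<in> X0 \<inter> V" using dt d1 t by (auto simp: dist_commute subset_iff)
      have hol1: "(\<lambda>x. g x t - g x t0) holomorphic_on U"
        using hol t t0 by (intro holomorphic_intros)
      have "norm (deriv (\<lambda>x. g x t - g x t0) x) \<le> (e * r / 4) / r"
      proof (rule norm_deriv_le_Cauchy[OF hol1 _ U \<open>r > 0\<close>])
        show "cball x r \<subseteq> U" using sub r by blast
        show "norm (g w t - g w t0) \<le> e * r / 4" if "w \<in> cball x r" for w
          using X0(3) tX sub that by (auto simp: dist_norm)
      qed
      also have "(e * r / 4) / r = e / 4" using r by simp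
      also have "deriv (\<lambda>x. g x t - g x t0) x = deriv (\<lambda>x. g x t) x - deriv (\<lambda>x. g x t0) x"
        using hol t t0 x U holomorphic_on_imp_differentiable_at by (intro deriv_diff) blast+
      finally have "dist (deriv (\<lambda>x. g x t) x) (deriv (\<lambda>x. g x t0) x) \<le> e / 4" by (simp add: dist_norm)
      moreover have "dist (deriv (\<lambda>x. g x t0) x) (deriv (\<lambda>x. g x t0) x0) < e / 2"
        using d2 x dx by simp
      ultimately show "dist (deriv (\<lambda>x. g x t) x) (deriv (\<lambda>x. g x t0) x0) < e"
        using dist_triangle[of "deriv (\<lambda>x. g x t) x" "deriv (\<lambda>x. g x t0) x0" "deriv (\<lambda>x. g x t0) x"] e
        by linarith
    qed
  qed
  then show ?thesis unfolding continuous_on_iff by (auto simp: split_beta)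
qed

text \<open>Osgood's lemma: continuity of one of the partial derivatives suffices for total
  differentiability.\<close>

lemma sep_holo_has_derivative:
  assumes g: "sep_holo g U V" and U: "open U" and V: "open V" and x: "x \<in> U" and h: "h \<in> V"
  shows "\<exists>p q. ((\<lambda>(y, k). g y k) has_derivative (\<lambda>(u, v). p * u + q * v)) (at (x, h))"
proof -
  obtain r where r: "r > 0" "ball h r \<subseteq> V" using V h open_contains_ball by blast
  define B where "B = ball h r"
  have hB: "h \<in> B" and Bo: "open B" and BV: "B \<subseteq> V" using r by (auto simp: B_def)
  define G2 where "G2 = (\<lambda>x h. deriv (g x) h)"
  have cont: "continuous_on (V \<times> U) (\<lambda>(h, x). g x h)"
  proof -
    have "continuous_on (V \<times> U) ((\<lambda>(x, t). g x t) \<circ> prod.swap)"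
      using g by (intro continuous_on_compose continuous_on_swap) (auto simp: sep_holo_def product_swap)
    then show ?thesis by (simp add: o_def case_prod_unfold)
  qed
  have "continuous_on (V \<times> U) (\<lambda>(h, x). deriv (\<lambda>h. g x h) h)"
    by (rule continuous_on_deriv_param[OF V cont]) (use g in \<open>auto simp: sep_holo_def\<close>)
  then have "continuous_on (U \<times> V) ((\<lambda>(h, x). deriv (\<lambda>h. g x h) h) \<circ> prod.swap)"
    by (intro continuous_on_compose continuous_on_swap) (auto simp: product_swap)
  then have cG2: "continuous_on (U \<times> V) (\<lambda>(x, h). G2 x h)"
    by (simp add: o_def case_prod_unfold G2_def)
  have "continuous (at (x, h)) (\<lambda>(x, h). G2 x h)"
    using cG2 x h U V by (simp add: continuous_on_eq_continuous_at open_Times)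
  then have c: "continuous (at (x, h) within U \<times> B) (\<lambda>(x, h). blinfun_mult_right (G2 x h))"
    unfolding continuous_within case_prod_unfold continuous_at
    by (intro bounded_linear.tendsto[OF bounded_linear_blinfun_mult_right])
       (auto intro: tendsto_within_subset)
  have d1: "((\<lambda>x. g x h) has_derivative (*) (deriv (\<lambda>x. g x h) x)) (at x within U)"
    using g h x U holomorphic_derivI[of "\<lambda>x. g x h" U x]
    by (auto simp: sep_holo_def has_field_derivative_def intro: has_derivative_at_withinI)
  have d2: "(g y has_derivative blinfun_mult_right (G2 y k)) (at k within B)" if "y \<in> U" "k \<in> B" for y k
    using g BV that V holomorphic_derivI[of "g y" V k]
    by (auto simp: sep_holo_def has_field_derivative_def G2_def subset_iff intro!: has_derivative_at_withinI)
  have "((\<lambda>(x, y). g x y) has_derivative (\<lambda>(tx, ty). deriv (\<lambda>x. g x h) x * tx + blinfun_mult_right (G2 x h) ty))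
          (at (x, h) within U \<times> B)"
    using has_derivative_partialsI[OF d1 d2 c hB] B_def by simp
  then have "((\<lambda>(x, y). g x y) has_derivative (\<lambda>(tx, ty). deriv (\<lambda>x. g x h) x * tx + G2 x h * ty)) (at (x, h))"
    using x hB U Bo by (subst (asm) at_within_open) (auto simp: open_Times)
  then show ?thesis by blast
qed

lemma sep_holo_of_has_derivative:
  assumes "\<And>x h. x \<in> U \<Longrightarrow> h \<in> V \<Longrightarrow>
     \<exists>p q. ((\<lambda>(y, k). g y k) has_derivative (\<lambda>(u, v). p * u + q * v)) (at (x, h))"
  shows "sep_holo g U V"
  unfolding sep_holo_def
proof (intro conjI ballI)
  show "continuous_on (U \<times> V) (\<lambda>(x, h). g x h)"
  proof (intro continuous_at_imp_continuous_on ballI)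
    fix z assume "z \<in> U \<times> V"
    then show "isCont (\<lambda>(x, h). g x h) z"
      using assms has_derivative_continuous by (cases z) blast
  qed
next
  fix h assume h: "h \<in> V"
  show "(\<lambda>x. g x h) holomorphic_on U"
  proof (rule holomorphic_onI, rule field_differentiable_at_within)
    fix x assume x: "x \<in> U"
    obtain p q where pq: "((\<lambda>(y, k). g y k) has_derivative (\<lambda>(u, v). p * u + q * v)) (at (x, h))"
      using assms x h by blast
    have "((\<lambda>y. (y, h)) has_derivative (\<lambda>u. (u, 0))) (at x)" by (auto intro!: derivative_eq_intros)
    from has_derivative_compose[OF this pq] have "((\<lambda>y. g y h) has_derivative (*) p) (at x)" by simp
    then show "(\<lambda>x. g x h) field_differentiable at x"
      by (auto simp: field_differentiable_def has_field_derivative_def)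
  qed
next
  fix x assume x: "x \<in> U"
  show "g x holomorphic_on V"
  proof (rule holomorphic_onI, rule field_differentiable_at_within)
    fix h assume h: "h \<in> V"
    obtain p q where pq: "((\<lambda>(y, k). g y k) has_derivative (\<lambda>(u, v). p * u + q * v)) (at (x, h))"
      using assms x h by blast
    have "((\<lambda>k. (x, k)) has_derivative (\<lambda>v. (0, v))) (at h)" by (auto intro!: derivative_eq_intros)
    from has_derivative_compose[OF this pq] have "(g x has_derivative (*) q) (at h)" by simp
    then show "g x field_differentiable at h"
      by (auto simp: field_differentiable_def has_field_derivative_def)
  qed
qed

lemma sep_holo_const_fst: "f holomorphic_on U \<Longrightarrow> sep_holo (\<lambda>x h. f x) U V"
  unfolding sep_holo_def
  by (auto simp: case_prod_unfold intro!: continuous_on_compose2[of U f] continuous_intros holomorphic_on_imp_continuous_on)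

lemma sep_holo_const_snd: "f holomorphic_on V \<Longrightarrow> sep_holo (\<lambda>x h. f h) U V"
  unfolding sep_holo_def
  by (auto simp: case_prod_unfold eta_contract_eq intro!: continuous_on_compose2[of V f] continuous_intros holomorphic_on_imp_continuous_on)

lemma sep_holo_add: "sep_holo f U V \<Longrightarrow> sep_holo g U V \<Longrightarrow> sep_holo (\<lambda>x h. f x h + g x h) U V"
  unfolding sep_holo_def by (auto simp: case_prod_unfold intro!: continuous_intros holomorphic_intros)

lemma sep_holo_diff: "sep_holo f U V \<Longrightarrow> sep_holo g U V \<Longrightarrow> sep_holo (\<lambda>x h. f x h - g x h) U V"
  unfolding sep_holo_def by (auto simp: case_prod_unfold intro!: continuous_intros holomorphic_intros)

lemma sep_holo_mult: "sep_holo f U V \<Longrightarrow> sep_holo g U V \<Longrightarrow> sep_holo (\<lambda>x h. f x h * g x h) U V"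
  unfolding sep_holo_def by (auto simp: case_prod_unfold intro!: continuous_intros holomorphic_intros)

lemma sep_holo_power: "sep_holo f U V \<Longrightarrow> sep_holo (\<lambda>x h. f x h ^ n) U V"
  unfolding sep_holo_def by (auto simp: case_prod_unfold intro!: continuous_intros holomorphic_intros)

lemma sep_holo_divide: "sep_holo f U V \<Longrightarrow> sep_holo g U V \<Longrightarrow> (\<And>x h. x \<in> U \<Longrightarrow> h \<in> V \<Longrightarrow> g x h \<noteq> 0)
    \<Longrightarrow> sep_holo (\<lambda>x h. f x h / g x h) U V"
  unfolding sep_holo_def by (auto simp: case_prod_unfold intro!: continuous_intros holomorphic_intros)

lemma sep_holo_subset: "sep_holo f U V \<Longrightarrow> U' \<subseteq> U \<Longrightarrow> V' \<subseteq> V \<Longrightarrow> sep_holo f U' V'"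
  unfolding sep_holo_def by (blast intro: continuous_on_subset holomorphic_on_subset)

lemma sep_holo_compose:
  assumes g: "sep_holo g U V" and \<phi>: "\<phi> holomorphic_on U'" "\<phi> ` U' \<subseteq> U" and \<tau>: "\<tau> holomorphic_on V'" "\<tau> ` V' \<subseteq> V"
  shows "sep_holo (\<lambda>x h. g (\<phi> x) (\<tau> h)) U' V'"
  unfolding sep_holo_def
proof (intro conjI ballI)
  have c: "continuous_on U' \<phi>" "continuous_on V' \<tau>" using \<phi> \<tau> holomorphic_on_imp_continuous_on by auto
  have "continuous_on (U' \<times> V') (\<lambda>z. (\<phi> (fst z), \<tau> (snd z)))"
    by (intro continuous_intros continuous_on_compose2[OF c(1)] continuous_on_compose2[OF c(2)]) auto
  from continuous_on_compose2[of "U \<times> V" "\<lambda>(x, h). g x h", OF _ this]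
  show "continuous_on (U' \<times> V') (\<lambda>(x, h). g (\<phi> x) (\<tau> h))"
    using g \<phi>(2) \<tau>(2) by (fastforce simp: sep_holo_def case_prod_unfold)
next
  fix h assume "h \<in> V'"
  then have "\<tau> h \<in> V" using \<tau> by auto
  then have "(\<lambda>x. g x (\<tau> h)) holomorphic_on U" using g by (simp add: sep_holo_def)
  from holomorphic_on_compose_gen[OF \<phi>(1) this] \<phi>(2)
  show "(\<lambda>x. g (\<phi> x) (\<tau> h)) holomorphic_on U'" by (auto simp: o_def)
next
  fix x assume "x \<in> U'"
  then have "\<phi> x \<in> U" using \<phi> by auto
  then have "g (\<phi> x) holomorphic_on V" using g by (simp add: sep_holo_def)
  from holomorphic_on_compose_gen[OF \<tau>(1) this] \<tau>(2)
  show "(\<lambda>h. g (\<phi> x) (\<tau> h)) holomorphic_on V'" by (auto simp: o_def)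
qed

lemma holomorphic_on_integral_param:
  fixes k :: "complex \<Rightarrow> real \<Rightarrow> complex"
  assumes U: "open U" and cont: "continuous_on (U \<times> {0..T}) (\<lambda>(w, s). k w s)"
    and hol: "\<And>s. s \<in> {0..T} \<Longrightarrow> (\<lambda>w. k w s) holomorphic_on U" and w: "w \<in> U"
  shows "((\<lambda>w. integral {0..T} (k w)) has_field_derivative integral {0..T} (\<lambda>s. deriv (\<lambda>w. k w s) w)) (at w)"
proof -
  obtain r where r: "r > 0" "ball w r \<subseteq> U" using U w open_contains_ball by blast
  have "continuous_on (U \<times> {0..T}) (\<lambda>(w, s). deriv (\<lambda>w. k w s) w)"
    by (rule continuous_on_deriv_param[OF U cont hol])
  then have c: "continuous_on (ball w r \<times> {0..T}) (\<lambda>(w, s). deriv (\<lambda>w. k w s) w)"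
    by (rule continuous_on_subset) (use r in auto)
  have "((\<lambda>w. integral (cbox 0 T) (k w)) has_field_derivative integral (cbox 0 T) (\<lambda>s. deriv (\<lambda>w. k w s) w)) (at w within ball w r)"
  proof (rule leibniz_rule_field_derivative)
    fix x t assume x: "x \<in> ball w r" and t: "t \<in> cbox 0 T"
    show "((\<lambda>w. k w t) has_field_derivative deriv (\<lambda>w. k w t) x) (at x within ball w r)"
      by (rule has_field_derivative_at_within, rule holomorphic_derivI[of _ U]) (use hol[of t] t x r U in auto)
  next
    fix x assume x: "x \<in> ball w r"
    then have "continuous_on {0..T} (\<lambda>s. k x s)"
      using r by (intro continuous_on_compose2[OF cont, of _ "\<lambda>s. (x, s)", simplified] continuous_intros) auto
    then show "k x integrable_on cbox 0 T" by (auto intro: integrable_continuous_interval)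
  qed (use c r in auto)
  then show ?thesis using r by (subst (asm) at_within_open) auto
qed

section \<open>Picard iteration along a direction\<close>

lemma sep_holo_uniform_limit:
  assumes U: "open U" and f: "\<And>n::nat. sep_holo (f n) U V" and V: "open V"
    and lim: "\<And>x. x \<in> U \<Longrightarrow> \<exists>d>0. cball x d \<subseteq> U \<and>
       uniform_limit (cball x d \<times> V) (\<lambda>n (x, h). f n x h) (\<lambda>(x, h). g x h) sequentially"
  shows "sep_holo g U V"
    and "\<And>x h. x \<in> U \<Longrightarrow> h \<in> V \<Longrightarrow> (\<lambda>n. deriv (\<lambda>x. f n x h) x) \<longlonglongrightarrow> deriv (\<lambda>x. g x h) x"
proof -
  have lim1: "\<exists>d>0. cball x d \<subseteq> U \<and> uniform_limit (cball x d) (\<lambda>n x. f n x h) (\<lambda>x. g x h) sequentially"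
    if x: "x \<in> U" and h: "h \<in> V" for x h
  proof -
    obtain d where d: "d > 0" "cball x d \<subseteq> U"
      and u: "uniform_limit (cball x d \<times> V) (\<lambda>n (x, h). f n x h) (\<lambda>(x, h). g x h) sequentially"
      using lim[OF x] by blast
    have "uniform_limit (cball x d) (\<lambda>n x. f n x h) (\<lambda>x. g x h) sequentially"
    proof (rule uniform_limitI)
      fix e :: real assume "e > 0"
      from uniform_limitD[OF u this]
      show "\<forall>\<^sub>F n in sequentially. \<forall>y\<in>cball x d. dist (f n y h) (g y h) < e"
        by eventually_elim (use h in auto)
    qed
    then show ?thesis using d by blast
  qed
  show "sep_holo g U V"
    unfolding sep_holo_def
  proof (intro conjI ballI)
    fix h assume h: "h \<in> V"
    show "(\<lambda>x. g x h) holomorphic_on U"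
      by (rule holomorphic_uniform_sequence[OF U, where f = "\<lambda>n x. f n x h"])
         (use f h lim1 in \<open>auto simp: sep_holo_def\<close>)
  next
    fix x assume x: "x \<in> U"
    obtain d where d: "d > 0"
      and u: "uniform_limit (cball x d \<times> V) (\<lambda>n (x, h). f n x h) (\<lambda>(x, h). g x h) sequentially"
      using lim[OF x] by blast
    have u': "uniform_limit V (\<lambda>n h. f n x h) (\<lambda>h. g x h) sequentially"
    proof (rule uniform_limitI)
      fix e :: real assume "e > 0"
      from uniform_limitD[OF u this]
      show "\<forall>\<^sub>F n in sequentially. \<forall>h\<in>V. dist (f n x h) (g x h) < e"
        by eventually_elim (use d in auto)
    qed
    show "g x holomorphic_on V"
    proof (rule holomorphic_uniform_sequence[OF V, where f = "\<lambda>n h. f n x h"])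
      fix h assume "h \<in> V"
      then obtain d where "d > 0" "cball h d \<subseteq> V" using V open_contains_cball by blast
      then show "\<exists>d>0. cball h d \<subseteq> V \<and> uniform_limit (cball h d) (\<lambda>n h. f n x h) (g x) sequentially"
        using uniform_limit_on_subset[OF u'] by blast
    qed (use f x in \<open>auto simp: sep_holo_def\<close>)
  next
    show "continuous_on (U \<times> V) (\<lambda>(x, h). g x h)"
    proof (intro continuous_at_imp_continuous_on ballI)
      fix p assume "p \<in> U \<times> V"
      then obtain x h where p: "p = (x, h)" "x \<in> U" "h \<in> V" by auto
      obtain d where d: "d > 0" "cball x d \<subseteq> U"
        and u: "uniform_limit (cball x d \<times> V) (\<lambda>n (x, h). f n x h) (\<lambda>(x, h). g x h) sequentially"
        using lim[OF p(2)] by blast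
      have "continuous_on (cball x d \<times> V) (\<lambda>(x, h). g x h)"
      proof (rule uniform_limit_theorem[OF _ u])
        have "continuous_on (cball x d \<times> V) (\<lambda>(x, h). f n x h)" for n
          using f[of n] d(2) unfolding sep_holo_def by (meson Sigma_mono continuous_on_subset order_refl)
        then show "\<forall>\<^sub>F n in sequentially. continuous_on (cball x d \<times> V) (\<lambda>(x, h). f n x h)"
          by (rule always_eventually[OF allI])
      qed simp
      then have "continuous_on (ball x d \<times> V) (\<lambda>(x, h). g x h)"
        by (rule continuous_on_subset) auto
      then show "isCont (\<lambda>(x, h). g x h) p"
        using d V p by (auto simp: continuous_on_eq_continuous_at open_Times)
    qed
  qed
  fix x h assume x: "x \<in> U" and h: "h \<in> V"
  have "\<exists>g'. \<forall>x\<in>U. ((\<lambda>x. g x h) has_field_derivative g' x) (at x) \<and> (\<lambda>n. deriv (\<lambda>x. f n x h) x) \<longlonglongrightarrow> g' x"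
  proof (rule has_complex_derivative_uniform_sequence[OF U])
    fix n x assume "x \<in> U"
    then show "((\<lambda>x. f n x h) has_field_derivative deriv (\<lambda>x. f n x h) x) (at x)"
      using f[of n] h U by (intro holomorphic_derivI[of _ U]) (auto simp: sep_holo_def)
  qed (use lim1 h in blast)
  then show "(\<lambda>n. deriv (\<lambda>x. f n x h) x) \<longlonglongrightarrow> deriv (\<lambda>x. g x h) x"
    using x DERIV_imp_deriv by metis
qed

text \<open>Truncated at \<open>t\<close>, the integral from infinity solves \<open>I' = \<kappa> I - r\<close> up to the boundary
  term at \<open>z + t\<close>: integrate by parts in \<open>s\<close>.\<close>

lemma sep_holo_shifted_exponential_integral:
  fixes r :: "complex \<Rightarrow> complex \<Rightarrow> complex"
  assumes G: "open G" and H: "open H" and r: "sep_holo r G H"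
    and shift: "\<And>z s. z \<in> G \<Longrightarrow> s \<ge> 0 \<Longrightarrow> z + of_real s \<in> G" and t: "t \<ge> 0"
  defines "I \<equiv> \<lambda>z \<kappa>. integral {0..t} (\<lambda>s. exp (- \<kappa> * of_real s) * r (z + of_real s) \<kappa>)"
  shows "sep_holo I G H"
    and "\<And>z \<kappa>. z \<in> G \<Longrightarrow> \<kappa> \<in> H \<Longrightarrow>
      deriv (\<lambda>z. I z \<kappa>) z = \<kappa> * I z \<kappa> + exp (- \<kappa> * of_real t) * r (z + of_real t) \<kappa> - r z \<kappa>"
    and "\<And>z \<kappa>. z \<in> G \<Longrightarrow> \<kappa> \<in> H \<Longrightarrow>
      continuous_on {0..} (\<lambda>s. exp (- \<kappa> * of_real s) * r (z + of_real s) \<kappa>)"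
proof -
  have rc: "continuous_on (G \<times> H) (\<lambda>(x, h). r x h)" using r by (simp add: sep_holo_def)
  have c3: "continuous_on ((G \<times> H) \<times> {0..}) (\<lambda>q. exp (- snd (fst q) * of_real (snd q)) * r (fst (fst q) + of_real (snd q)) (snd (fst q)))"
  proof (intro continuous_intros)
    have "continuous_on ((G \<times> H) \<times> {0..}) (\<lambda>q::(complex\<times>complex)\<times>real. (fst (fst q) + of_real (snd q), snd (fst q)))"
      by (intro continuous_intros)
    from continuous_on_compose2[OF rc this]
    show "continuous_on ((G \<times> H) \<times> {0..}) (\<lambda>q::(complex\<times>complex)\<times>real. r (fst (fst q) + of_real (snd q)) (snd (fst q)))"
      using shift by (fastforce simp: case_prod_unfold)
  qed
  have cz: "continuous_on (G \<times> {0..t}) (\<lambda>(w, s). exp (- \<kappa> * of_real s) * r (w + of_real s) \<kappa>)" if "\<kappa> \<in> H" for \<kappa>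
  proof -
    have "continuous_on (G \<times> {0..t}) (\<lambda>q::complex\<times>real. ((fst q, \<kappa>), snd q))" by (intro continuous_intros)
    from continuous_on_compose2[OF c3 this] that show ?thesis by (fastforce simp: case_prod_unfold)
  qed
  have ck: "continuous_on (H \<times> {0..t}) (\<lambda>(w, s). exp (- w * of_real s) * r (z + of_real s) w)" if "z \<in> G" for z
  proof -
    have "continuous_on (H \<times> {0..t}) (\<lambda>q::complex\<times>real. ((z, fst q), snd q))" by (intro continuous_intros)
    from continuous_on_compose2[OF c3 this] that show ?thesis by (fastforce simp: case_prod_unfold)
  qed
  show cs: "continuous_on {0..} (\<lambda>s. exp (- \<kappa> * of_real s) * r (z + of_real s) \<kappa>)" if "z \<in> G" "\<kappa> \<in> H" for z \<kappa>
  proof -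
    have "continuous_on {0..} (\<lambda>s::real. ((z, \<kappa>), s))" by (intro continuous_intros)
    from continuous_on_compose2[OF c3 this] that show ?thesis by fastforce
  qed
  have rz: "(\<lambda>w. r (w + of_real s) \<kappa>) holomorphic_on G" if "\<kappa> \<in> H" "s \<in> {0..t}" for \<kappa> s
  proof -
    have "(\<lambda>w. r w \<kappa>) holomorphic_on G" using r that by (simp add: sep_holo_def)
    then show ?thesis using shift that
      by (intro holomorphic_on_compose_gen[of "\<lambda>w. w + of_real s" G "\<lambda>w. r w \<kappa>" G, unfolded o_def])
         (auto intro!: holomorphic_intros)
  qed
  have hz: "(\<lambda>w. exp (- \<kappa> * of_real s) * r (w + of_real s) \<kappa>) holomorphic_on G"
    if "\<kappa> \<in> H" "s \<in> {0..t}" for \<kappa> s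
    using rz[OF that] by (intro holomorphic_intros)
  have hk: "(\<lambda>\<kappa>. exp (- \<kappa> * of_real s) * r (z + of_real s) \<kappa>) holomorphic_on H"
    if "z \<in> G" "s \<in> {0..t}" for z s
  proof -
    have "r (z + of_real s) holomorphic_on H" using r that shift by (simp add: sep_holo_def)
    then show ?thesis by (intro holomorphic_intros)
  qed
  have dI: "((\<lambda>z. I z \<kappa>) has_field_derivative integral {0..t} (\<lambda>s. deriv (\<lambda>w. exp (- \<kappa> * of_real s) * r (w + of_real s) \<kappa>) z)) (at z)"
    if "z \<in> G" "\<kappa> \<in> H" for z \<kappa>
    unfolding I_def by (rule holomorphic_on_integral_param[OF G cz hz]) (use that in auto)
  show "sep_holo I G H"
    unfolding sep_holo_def
  proof (intro conjI ballI)
    have "continuous_on ((G \<times> H) \<times> cbox 0 t) (\<lambda>(q, s). exp (- snd q * of_real s) * r (fst q + of_real s) (snd q))"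
      unfolding case_prod_unfold by (rule continuous_on_subset[OF c3]) auto
    from integral_continuous_on_param[OF this]
    show "continuous_on (G \<times> H) (\<lambda>(x, h). I x h)" by (simp add: I_def case_prod_unfold)
  next
    fix \<kappa> assume "\<kappa> \<in> H"
    then show "(\<lambda>x. I x \<kappa>) holomorphic_on G" using dI G by (subst holomorphic_on_open) auto
  next
    fix z assume z: "z \<in> G"
    have "(I z has_field_derivative integral {0..t} (\<lambda>s. deriv (\<lambda>\<kappa>. exp (- \<kappa> * of_real s) * r (z + of_real s) \<kappa>) \<kappa>)) (at \<kappa>)" if "\<kappa> \<in> H" for \<kappa>
      unfolding I_def by (rule holomorphic_on_integral_param[OF H ck hk]) (use that z in auto)
    then show "I z holomorphic_on H" using H by (subst holomorphic_on_open) auto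
  qed
  fix z \<kappa> assume z: "z \<in> G" and \<kappa>: "\<kappa> \<in> H"
  define r' where "r' = deriv (\<lambda>w. r w \<kappa>)"
  have r': "((\<lambda>w. r w \<kappa>) has_field_derivative r' w) (at w)" if "w \<in> G" for w
    using r \<kappa> G that unfolding r'_def by (intro holomorphic_derivI[of _ G]) (auto simp: sep_holo_def)
  have d1: "deriv (\<lambda>w. exp (- \<kappa> * of_real s) * r (w + of_real s) \<kappa>) z = exp (- \<kappa> * of_real s) * r' (z + of_real s)"
    if "s \<in> {0..t}" for s
  proof (rule DERIV_imp_deriv)
    have "((\<lambda>w. w + of_real s) has_field_derivative 1) (at z)" by (auto intro!: derivative_eq_intros)
    from DERIV_chain2[OF r' this] 
    have "((\<lambda>w. r (w + of_real s) \<kappa>) has_field_derivative r' (z + of_real s)) (at z)"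
      using shift z that by simp
    then show "((\<lambda>w. exp (- \<kappa> * of_real s) * r (w + of_real s) \<kappa>) has_field_derivative
       exp (- \<kappa> * of_real s) * r' (z + of_real s)) (at z)"
      by (rule DERIV_cmult)
  qed
  have F: "((\<lambda>s. exp (- \<kappa> * of_real s) * r' (z + of_real s) - \<kappa> * (exp (- \<kappa> * of_real s) * r (z + of_real s) \<kappa>))
     has_integral exp (- \<kappa> * of_real t) * r (z + of_real t) \<kappa> - exp (- \<kappa> * of_real 0) * r (z + of_real 0) \<kappa>) {0..t}"
  proof (rule fundamental_theorem_of_calculus[OF t])
    fix s assume s: "s \<in> {0..t}"
    have "((\<lambda>w. exp (- \<kappa> * w) * r (z + w) \<kappa>) has_field_derivative
        exp (- \<kappa> * of_real s) * r' (z + of_real s) - \<kappa> * (exp (- \<kappa> * of_real s) * r (z + of_real s) \<kappa>)) (at (of_real s))"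
    proof -
      have a: "((\<lambda>w. z + w) has_field_derivative 1) (at (of_real s :: complex))" by (auto intro!: derivative_eq_intros)
      have "((\<lambda>w. r (z + w) \<kappa>) has_field_derivative r' (z + of_real s) * 1) (at (of_real s))"
        by (rule DERIV_chain2[OF r' a]) (use shift z s in auto)
      then show ?thesis by (auto intro!: derivative_eq_intros simp: algebra_simps)
    qed
    from has_vector_derivative_real_field[OF this]
    show "((\<lambda>s. exp (- \<kappa> * of_real s) * r (z + of_real s) \<kappa>) has_vector_derivative
        exp (- \<kappa> * of_real s) * r' (z + of_real s) - \<kappa> * (exp (- \<kappa> * of_real s) * r (z + of_real s) \<kappa>)) (at s within {0..t})"
      by (simp add: o_def)
  qed
  have int: "(\<lambda>s. exp (- \<kappa> * of_real s) * r (z + of_real s) \<kappa>) integrable_on {0..t}"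
    by (rule integrable_continuous_interval, rule continuous_on_subset[OF cs[OF z \<kappa>]]) auto
  have "((\<lambda>s. \<kappa> * (exp (- \<kappa> * of_real s) * r (z + of_real s) \<kappa>)) has_integral \<kappa> * I z \<kappa>) {0..t}"
    using integrable_integral[OF int] unfolding I_def by (intro has_integral_mult_right)
  from has_integral_add[OF F this]
  have "((\<lambda>s. exp (- \<kappa> * of_real s) * r' (z + of_real s)) has_integral
     (exp (- \<kappa> * of_real t) * r (z + of_real t) \<kappa> - r z \<kappa> + \<kappa> * I z \<kappa>)) {0..t}" by simp
  then have "((\<lambda>s. deriv (\<lambda>w. exp (- \<kappa> * of_real s) * r (w + of_real s) \<kappa>) z) has_integral
     (exp (- \<kappa> * of_real t) * r (z + of_real t) \<kappa> - r z \<kappa> + \<kappa> * I z \<kappa>)) {0..t}"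
    by (rule has_integral_eq[rotated]) (use d1 in auto)
  then have "integral {0..t} (\<lambda>s. deriv (\<lambda>w. exp (- \<kappa> * of_real s) * r (w + of_real s) \<kappa>) z)
     = exp (- \<kappa> * of_real t) * r (z + of_real t) \<kappa> - r z \<kappa> + \<kappa> * I z \<kappa>"
    by (rule integral_unique)
  with DERIV_imp_deriv[OF dI[OF z \<kappa>]]
  show "deriv (\<lambda>z. I z \<kappa>) z = \<kappa> * I z \<kappa> + exp (- \<kappa> * of_real t) * r (z + of_real t) \<kappa> - r z \<kappa>"
    by simp
qed

lemma norm_exponential_integral_le:
  fixes u :: "real \<Rightarrow> complex"
  assumes cont: "continuous_on {a..b} (\<lambda>s. exp (- \<kappa> * of_real s) * u s)" and ab: "0 \<le> a" "a \<le> b"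
    and u: "\<And>s. s \<in> {a..b} \<Longrightarrow> norm (u s) \<le> D * exp (K * s)" and D: "D \<ge> 0" and m: "0 < m" "m \<le> Re \<kappa> - K"
  shows "norm (integral {a..b} (\<lambda>s. exp (- \<kappa> * of_real s) * u s)) \<le> D * exp (- m * a) / m"
proof -
  have ie: "((\<lambda>s. D * exp (- m * s)) has_integral (- D * exp (- m * b) / m - - D * exp (- m * a) / m)) {a..b}"
  proof (rule fundamental_theorem_of_calculus[OF ab(2)])
    fix x
    show "((\<lambda>s. - D * exp (- m * s) / m) has_vector_derivative D * exp (- m * x)) (at x within {a..b})"
      using m by (auto intro!: derivative_eq_intros simp: has_real_derivative_iff_has_vector_derivative[symmetric] field_simps)
  qed
  have "norm (integral {a..b} (\<lambda>s. exp (- \<kappa> * of_real s) * u s)) \<le> integral {a..b} (\<lambda>s. D * exp (- m * s))"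
  proof (rule integral_norm_bound_integral)
    show "(\<lambda>s. exp (- \<kappa> * of_real s) * u s) integrable_on {a..b}"
      using cont by (rule integrable_continuous_interval)
    show "(\<lambda>s. D * exp (- m * s)) integrable_on {a..b}" using ie by blast
    fix s assume s: "s \<in> {a..b}"
    have "norm (exp (- \<kappa> * of_real s) * u s) = exp (- Re \<kappa> * s) * norm (u s)"
      by (simp add: norm_mult)
    also have "\<dots> \<le> exp (- Re \<kappa> * s) * (D * exp (K * s))" using u[OF s] by (intro mult_left_mono) auto
    also have "\<dots> = D * exp (- (Re \<kappa> - K) * s)" by (simp add: algebra_simps exp_diff exp_add exp_minus field_simps)
    also have "\<dots> \<le> D * exp (- m * s)"
    proof -
      have "m * s \<le> (Re \<kappa> - K) * s" using m s ab by (intro mult_right_mono) auto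
      then have "- (Re \<kappa> - K) * s \<le> - m * s" by linarith
      then show ?thesis using D by (intro mult_left_mono exp_le_cancel_iff[THEN iffD2])
    qed
    finally show "norm (exp (- \<kappa> * of_real s) * u s) \<le> D * exp (- m * s)" .
  qed
  also have "\<dots> = - D * exp (- m * b) / m - - D * exp (- m * a) / m" using ie by (rule integral_unique)
  also have "\<dots> \<le> D * exp (- m * a) / m" using D m by simp
  finally show ?thesis .
qed

text \<open>The fixed point equation is \<open>y z = - \<integral> exp (- \<kappa> s) (c0 + c1 y + c2 y\<^sup>2) (z + s) ds\<close> over
  \<open>s \<ge> 0\<close>. In the norm \<open>sup (norm y * W)\<close> the bracket is bounded by \<open>3 K\<close> on the unit ball, and
  the growth condition on \<open>W\<close> turns the kernel into \<open>exp (- (R - K) s)\<close>; so the operator maps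
  the unit ball into the ball of radius \<open>3 K / (R - K)\<close> and is a contraction there. The
  \<open>n\<close>-th iterate integrates only up to \<open>n\<close>: every iterate is a proper integral, and the
  truncation error \<open>exp (- (R - K) n)\<close>, at most \<open>1 / 2\<^sup>n\<close> since \<open>R - K \<ge> 1\<close>, does not spoil the
  geometric convergence.\<close>

lemma weighted_Picard_solution:
  fixes c0 c1 c2 :: "complex \<Rightarrow> complex \<Rightarrow> complex" and W :: "complex \<Rightarrow> real" and K R :: real
  assumes G: "open G" and shift: "\<And>z s. z \<in> G \<Longrightarrow> s \<ge> 0 \<Longrightarrow> z + of_real s \<in> G"
    and Wc: "continuous_on G W" and Wp: "\<And>z. z \<in> G \<Longrightarrow> W z > 0"
    and Wg: "\<And>z s. z \<in> G \<Longrightarrow> s \<ge> 0 \<Longrightarrow> W z \<le> exp (K * s) * W (z + of_real s)"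
    and K: "K > 0" and R: "R \<ge> 13 * K + 1"
    and c: "sep_holo c0 G {\<kappa>. Re \<kappa> > R}" "sep_holo c1 G {\<kappa>. Re \<kappa> > R}" "sep_holo c2 G {\<kappa>. Re \<kappa> > R}"
    and c0: "\<And>z \<kappa>. z \<in> G \<Longrightarrow> Re \<kappa> > R \<Longrightarrow> norm (c0 z \<kappa>) * W z \<le> K"
    and c1: "\<And>z \<kappa>. z \<in> G \<Longrightarrow> Re \<kappa> > R \<Longrightarrow> norm (c1 z \<kappa>) \<le> K"
    and c2: "\<And>z \<kappa>. z \<in> G \<Longrightarrow> Re \<kappa> > R \<Longrightarrow> norm (c2 z \<kappa>) \<le> K * W z"
  obtains y where "sep_holo y G {\<kappa>. Re \<kappa> > R}"
    "\<And>z \<kappa>. z \<in> G \<Longrightarrow> Re \<kappa> > R \<Longrightarrow> norm (y z \<kappa>) * W z \<le> 3 * K / (R - K)"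
    "\<And>z \<kappa>. z \<in> G \<Longrightarrow> Re \<kappa> > R \<Longrightarrow> ((\<lambda>z. y z \<kappa>) has_field_derivative
        \<kappa> * y z \<kappa> + (c0 z \<kappa> + c1 z \<kappa> * y z \<kappa> + c2 z \<kappa> * (y z \<kappa>)\<^sup>2)) (at z)"
proof -
  define H where "H = {\<kappa>::complex. Re \<kappa> > R}"
  have oH: "open H" unfolding H_def by (simp add: open_halfspace_Re_gt)
  define m where "m = R - K"
  have m: "m \<ge> 12 * K" "m \<ge> 1" "m > 0" using R K by (auto simp: m_def)
  define \<rho> where "\<rho> = 3 * K / m"
  have \<rho>: "0 \<le> \<rho>" "\<rho> \<le> 1/4" using m K by (auto simp: \<rho>_def field_simps)
  define F where "F = (\<lambda>(Y::complex\<Rightarrow>complex\<Rightarrow>complex) z \<kappa>. c0 z \<kappa> + c1 z \<kappa> * Y z \<kappa> + c2 z \<kappa> * (Y z \<kappa>)\<^sup>2)"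
  define I where "I = (\<lambda>t (r::complex\<Rightarrow>complex\<Rightarrow>complex) z \<kappa>. integral {0..t} (\<lambda>s. exp (- \<kappa> * of_real s) * r (z + of_real s) \<kappa>) :: complex)"
  define y where "y = rec_nat (\<lambda>z \<kappa>. 0) (\<lambda>n Y z \<kappa>. - I (real (Suc n)) (F Y) z \<kappa>)"
  have y0: "y 0 = (\<lambda>z \<kappa>. 0)" and yS: "y (Suc n) = (\<lambda>z \<kappa>. - I (real (Suc n)) (F (y n)) z \<kappa>)" for n
    by (simp_all add: y_def)
  have Fholo: "sep_holo (F Y) G H" if "sep_holo Y G H" for Y
    unfolding F_def H_def
    by (intro sep_holo_add sep_holo_mult sep_holo_power c that[unfolded H_def])
  have Fbd: "norm (F Y z \<kappa>) * W z \<le> 3 * K" if z: "z \<in> G" "\<kappa> \<in> H" and Y: "norm (Y z \<kappa>) * W z \<le> 1" for Y z \<kappa>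
  proof -
    have \<kappa>: "Re \<kappa> > R" using z by (simp add: H_def)
    have "norm (F Y z \<kappa>) \<le> norm (c0 z \<kappa>) + norm (c1 z \<kappa>) * norm (Y z \<kappa>) + norm (c2 z \<kappa>) * (norm (Y z \<kappa>))\<^sup>2"
      unfolding F_def by (intro order.trans[OF norm_triangle_ineq] add_mono) (auto simp: norm_mult norm_power)
    then have "norm (F Y z \<kappa>) * W z \<le> (norm (c0 z \<kappa>) + norm (c1 z \<kappa>) * norm (Y z \<kappa>) + norm (c2 z \<kappa>) * (norm (Y z \<kappa>))\<^sup>2) * W z"
      using Wp z by (intro mult_right_mono) (auto simp: less_imp_le)
    also have "\<dots> = norm (c0 z \<kappa>) * W z + norm (c1 z \<kappa>) * (norm (Y z \<kappa>) * W z) + norm (c2 z \<kappa>) * ((norm (Y z \<kappa>))\<^sup>2 * W z)"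
      by (simp add: algebra_simps)
    also have "\<dots> \<le> K + K * 1 + K"
    proof (intro add_mono)
      show "norm (c0 z \<kappa>) * W z \<le> K" using c0 z \<kappa> by simp
      show "norm (c1 z \<kappa>) * (norm (Y z \<kappa>) * W z) \<le> K * 1"
        using c1[OF z(1) \<kappa>] Y K Wp[OF z(1)] by (intro mult_mono) auto
      have "norm (c2 z \<kappa>) * ((norm (Y z \<kappa>))\<^sup>2 * W z) \<le> K * W z * ((norm (Y z \<kappa>))\<^sup>2 * W z)"
        using c2[OF z(1) \<kappa>] Wp[OF z(1)] by (intro mult_right_mono) auto
      also have "\<dots> = K * (norm (Y z \<kappa>) * W z)\<^sup>2" by (simp add: power2_eq_square)
      also have "\<dots> \<le> K * 1" using Y K Wp[OF z(1)] by (intro mult_left_mono power_le_one) auto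
      finally show "norm (c2 z \<kappa>) * ((norm (Y z \<kappa>))\<^sup>2 * W z) \<le> K" by simp
    qed
    finally show ?thesis by simp
  qed
  have Flip: "norm (F Y z \<kappa> - F Z z \<kappa>) \<le> 3 * K * norm (Y z \<kappa> - Z z \<kappa>)"
    if z: "z \<in> G" "\<kappa> \<in> H" and Y: "norm (Y z \<kappa>) * W z \<le> 1" "norm (Z z \<kappa>) * W z \<le> 1" for Y Z z \<kappa>
  proof -
    have \<kappa>: "Re \<kappa> > R" using z by (simp add: H_def)
    have "F Y z \<kappa> - F Z z \<kappa> = (c1 z \<kappa> + c2 z \<kappa> * (Y z \<kappa> + Z z \<kappa>)) * (Y z \<kappa> - Z z \<kappa>)"
      by (simp add: F_def power2_eq_square algebra_simps)
    then have "norm (F Y z \<kappa> - F Z z \<kappa>) = norm (c1 z \<kappa> + c2 z \<kappa> * (Y z \<kappa> + Z z \<kappa>)) * norm (Y z \<kappa> - Z z \<kappa>)"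
      by (simp add: norm_mult)
    also have "norm (c1 z \<kappa> + c2 z \<kappa> * (Y z \<kappa> + Z z \<kappa>)) \<le> K + K * W z * (norm (Y z \<kappa>) + norm (Z z \<kappa>))"
      using c1[OF z(1) \<kappa>] c2[OF z(1) \<kappa>] Wp[OF z(1)] K
      by (intro order.trans[OF norm_triangle_ineq] add_mono) (auto simp: norm_mult intro!: mult_mono norm_triangle_ineq)
    also have "\<dots> = K + K * (norm (Y z \<kappa>) * W z + norm (Z z \<kappa>) * W z)" by (simp add: algebra_simps)
    also have "\<dots> \<le> K + K * 2" using Y K by (intro add_left_mono mult_left_mono) auto
    finally show ?thesis by (simp add: mult_right_mono)
  qed
  have Ibd: "norm (integral {a..b} (\<lambda>s. exp (- \<kappa> * of_real s) * r (z + of_real s) \<kappa>)) * W z \<le> D * exp (- m * a) / m"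
    if r: "sep_holo r G H" and z: "z \<in> G" "\<kappa> \<in> H" and ab: "0 \<le> a" "a \<le> b" and D: "D \<ge> 0"
      and bd: "\<And>w. w \<in> G \<Longrightarrow> norm (r w \<kappa>) * W w \<le> D" for r z \<kappa> a b D
  proof -
    have "norm (integral {a..b} (\<lambda>s. exp (- \<kappa> * of_real s) * r (z + of_real s) \<kappa>)) \<le> (D / W z) * exp (- m * a) / m"
    proof (rule norm_exponential_integral_le[OF _ ab, where K = K])
      show "continuous_on {a..b} (\<lambda>s. exp (- \<kappa> * of_real s) * r (z + of_real s) \<kappa>)"
        by (rule continuous_on_subset[OF sep_holo_shifted_exponential_integral(3)[OF G oH r shift order_refl z]])
           (use ab in auto)
      fix s assume s: "s \<in> {a..b}"
      then have zs: "z + of_real s \<in> G" and s0: "s \<ge> 0" using shift z ab by auto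
      have "norm (r (z + of_real s) \<kappa>) * W z \<le> norm (r (z + of_real s) \<kappa>) * (exp (K * s) * W (z + of_real s))"
        using Wg[OF z(1) s0] by (intro mult_left_mono) auto
      also have "\<dots> = norm (r (z + of_real s) \<kappa>) * W (z + of_real s) * exp (K * s)" by simp
      also have "\<dots> \<le> D * exp (K * s)" using bd[OF zs] by (intro mult_right_mono) auto
      finally show "norm (r (z + of_real s) \<kappa>) \<le> D / W z * exp (K * s)"
        using Wp[OF z(1)] by (simp add: field_simps)
    qed (use D Wp[OF z(1)] m z in \<open>auto simp: m_def H_def\<close>)
    then show ?thesis using Wp[OF z(1)] m by (simp add: field_simps)
  qed
  have inv: "sep_holo (y n) G H \<and> (\<forall>z\<in>G. \<forall>\<kappa>\<in>H. norm (y n z \<kappa>) * W z \<le> \<rho>)" for n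
  proof (induction n)
    case 0
    show ?case using \<rho> by (auto simp: y0 intro!: sep_holo_const_fst)
  next
    case (Suc n)
    have Fy: "sep_holo (F (y n)) G H" using Suc Fholo by blast
    have "sep_holo (I (real (Suc n)) (F (y n))) G H"
      unfolding I_def by (rule sep_holo_shifted_exponential_integral(1)[OF G oH Fy shift]) auto
    then have "sep_holo (y (Suc n)) G H"
      using sep_holo_diff[OF sep_holo_const_fst[OF holomorphic_on_const[of 0]]] by (simp add: yS)
    moreover have "norm (y (Suc n) z \<kappa>) * W z \<le> \<rho>" if z: "z \<in> G" "\<kappa> \<in> H" for z \<kappa>
    proof -
      have "norm (I (real (Suc n)) (F (y n)) z \<kappa>) * W z \<le> (3 * K) * exp (- m * 0) / m"
        unfolding I_def
      proof (rule Ibd[OF Fy z])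
        fix w assume w: "w \<in> G"
        have "norm (y n w \<kappa>) * W w \<le> \<rho>" using Suc w z by blast
        then have "norm (y n w \<kappa>) * W w \<le> 1" using \<rho> by linarith
        then show "norm (F (y n) w \<kappa>) * W w \<le> 3 * K" using Fbd w z by blast
      qed (use K in auto)
      then show ?thesis by (simp add: yS \<rho>_def)
    qed
    ultimately show ?case by blast
  qed
  have yh: "sep_holo (y n) G H" for n using inv by blast
  have yb: "norm (y n z \<kappa>) * W z \<le> \<rho>" if "z \<in> G" "\<kappa> \<in> H" for n z \<kappa> using inv that by blast
  have yb1: "norm (y n z \<kappa>) * W z \<le> 1" if "z \<in> G" "\<kappa> \<in> H" for n z \<kappa> using yb[OF that, of n] \<rho> by linarith
  \<comment> \<open>The first iterate is at most 1; the step needs \<open>C / 4 + 3 K / 2 \<le> C / 2\<close>.\<close>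
  define C where "C = 1 + 6 * K"
  have diff: "\<forall>z\<in>G. \<forall>\<kappa>\<in>H. norm (y (Suc n) z \<kappa> - y n z \<kappa>) * W z \<le> C / 2 ^ n" for n
  proof (induction n)
    case 0
    show ?case
    proof (intro ballI)
      fix z \<kappa> assume z: "z \<in> G" "\<kappa> \<in> H"
      show "norm (y (Suc 0) z \<kappa> - y 0 z \<kappa>) * W z \<le> C / 2 ^ 0"
        using yb1[OF z, of "Suc 0"] K by (simp add: y0 C_def)
    qed
  next
    case (Suc n)
    show ?case
    proof (intro ballI)
      fix z \<kappa> assume z: "z \<in> G" "\<kappa> \<in> H"
      have F1: "sep_holo (F (y (Suc n))) G H" and F2: "sep_holo (F (y n)) G H" using Fholo yh by auto
      define t where "t = real (Suc n)"
      define u where "u = (\<lambda>Y s. exp (- \<kappa> * of_real s) * F Y (z + of_real s) \<kappa>)"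
      have cu: "continuous_on {0..} (u (y k))" for k
        unfolding u_def by (rule sep_holo_shifted_exponential_integral(3)[OF G oH Fholo[OF yh] shift order_refl z])
      have iu: "u (y k) integrable_on {a..b}" if "0 \<le> a" for k a b
        by (rule integrable_continuous_interval, rule continuous_on_subset[OF cu]) (use that in auto)
      have e1: "y (Suc (Suc n)) z \<kappa> - y (Suc n) z \<kappa> = - (integral {0..t} (u (y (Suc n))) - integral {0..t} (u (y n))) - integral {t..t+1} (u (y (Suc n)))"
      proof -
        have "integral {0..t} (u (y (Suc n))) + integral {t..t + 1} (u (y (Suc n))) = integral {0..t+1} (u (y (Suc n)))"
          by (rule Henstock_Kurzweil_Integration.integral_combine) (use iu in \<open>auto simp: t_def\<close>)
        moreover have "y (Suc (Suc n)) z \<kappa> = - integral {0..t+1} (u (y (Suc n)))"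
          by (simp add: yS I_def u_def t_def add_ac)
        moreover have "y (Suc n) z \<kappa> = - integral {0..t} (u (y n))"
          by (simp add: yS I_def u_def t_def)
        ultimately show ?thesis by (simp add: algebra_simps)
      qed
      have e2: "integral {0..t} (u (y (Suc n))) - integral {0..t} (u (y n)) =
         integral {0..t} (\<lambda>s. exp (- \<kappa> * of_real s) * (\<lambda>z \<kappa>. F (y (Suc n)) z \<kappa> - F (y n) z \<kappa>) (z + of_real s) \<kappa>)"
        by (subst Henstock_Kurzweil_Integration.integral_diff[symmetric, OF iu iu]) (auto simp: u_def algebra_simps)
      have b1: "norm (integral {0..t} (\<lambda>s. exp (- \<kappa> * of_real s) * (\<lambda>z \<kappa>. F (y (Suc n)) z \<kappa> - F (y n) z \<kappa>) (z + of_real s) \<kappa>)) * W z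
          \<le> (3 * K * (C / 2 ^ n)) * exp (- m * 0) / m"
      proof (rule Ibd[OF sep_holo_diff[OF F1 F2] z])
        fix w assume w: "w \<in> G"
        have "norm (F (y (Suc n)) w \<kappa> - F (y n) w \<kappa>) * W w \<le> 3 * K * norm (y (Suc n) w \<kappa> - y n w \<kappa>) * W w"
          using Flip[of w \<kappa> "y (Suc n)" "y n", OF w z(2) yb1[OF w z(2)] yb1[OF w z(2)]] Wp[OF w] by (intro mult_right_mono) auto
        also have "\<dots> = 3 * K * (norm (y (Suc n) w \<kappa> - y n w \<kappa>) * W w)" by simp
        also have "\<dots> \<le> 3 * K * (C / 2 ^ n)" using Suc w z K by (intro mult_left_mono) auto
        finally show "norm (F (y (Suc n)) w \<kappa> - F (y n) w \<kappa>) * W w \<le> 3 * K * (C / 2 ^ n)" .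
      qed (use K in \<open>auto simp: t_def C_def\<close>)
      have b2: "norm (integral {t..t+1} (u (y (Suc n)))) * W z \<le> (3 * K) * exp (- m * t) / m"
        unfolding u_def by (rule Ibd[OF F1 z]) (use K Fbd yb1 z in \<open>auto simp: t_def\<close>)
      have "1 * t \<le> m * t" using m by (intro mult_right_mono) (auto simp: t_def)
      then have "exp (- m * t) \<le> exp (- 1 * t)" by simp
      also have "\<dots> = (exp (- 1)) ^ Suc n" by (subst exp_of_nat_mult[symmetric]) (simp add: t_def)
      also have "\<dots> \<le> (1 / 2) ^ Suc n"
      proof (rule power_mono)
        have "(2::real) \<le> exp 1" using exp_ge_add_one_self[of 1] by simp
        then show "exp (- 1) \<le> (1 / 2 :: real)" by (simp add: exp_minus field_simps)
      qed simp
      finally have ex: "exp (- m * t) \<le> (1 / 2) ^ Suc n" .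
      have "norm (y (Suc (Suc n)) z \<kappa> - y (Suc n) z \<kappa>) * W z \<le>
        (norm (integral {0..t} (u (y (Suc n))) - integral {0..t} (u (y n))) + norm (integral {t..t+1} (u (y (Suc n))))) * W z"
        unfolding e1 using Wp[OF z(1)]
        by (intro mult_right_mono order.trans[OF norm_triangle_ineq4]) (auto simp: norm_minus_commute)
      also have "\<dots> \<le> (3 * K * (C / 2 ^ n)) / m + (3 * K) * exp (- m * t) / m"
        using b1 b2 unfolding e2 by (simp add: distrib_right)
      also have "\<dots> \<le> (C / 2 ^ n) / 4 + 3 * K * (1 / 2) ^ Suc n"
      proof (rule add_mono)
        have "3 * K * (C / 2 ^ n) / m = (3 * K / m) * (C / 2 ^ n)" by simp
        also have "\<dots> \<le> (1 / 4) * (C / 2 ^ n)" using \<rho> K unfolding \<rho>_def C_def by (intro mult_right_mono) auto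
        finally show "3 * K * (C / 2 ^ n) / m \<le> (C / 2 ^ n) / 4" by simp
        have "3 * K * exp (- m * t) / m \<le> 3 * K * exp (- m * t) / 1"
          using m K by (intro divide_left_mono) auto
        also have "\<dots> \<le> 3 * K * (1 / 2) ^ Suc n" using ex K by (simp add: mult_left_mono)
        finally show "3 * K * exp (- m * t) / m \<le> 3 * K * (1 / 2) ^ Suc n" .
      qed
      also have "\<dots> = (C / 4 + 3 * K / 2) / 2 ^ n" by (simp add: power_divide field_simps)
      also have "\<dots> \<le> (C / 2) / 2 ^ n" using K by (intro divide_right_mono) (auto simp: C_def)
      also have "\<dots> = C / 2 ^ Suc n" by simp
      finally show "norm (y (Suc (Suc n)) z \<kappa> - y (Suc n) z \<kappa>) * W z \<le> C / 2 ^ Suc n" .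
    qed
  qed
  define L where "L = (\<lambda>z \<kappa>. \<Sum>n. y (Suc n) z \<kappa> - y n z \<kappa>)"
  have conv: "(\<lambda>n. y n z \<kappa>) \<longlonglongrightarrow> L z \<kappa>" and err: "norm (y n z \<kappa> - L z \<kappa>) \<le> 2 * C / 2 ^ n / W z"
    if z: "z \<in> G" "\<kappa> \<in> H" for z \<kappa> n
  proof -
    have dn: "norm (y (Suc n) z \<kappa> - y n z \<kappa>) \<le> C / W z * (1/2) ^ n" for n
      using diff[of n] z Wp[OF z(1)] by (auto simp: field_simps power_divide)
    have sg: "summable (\<lambda>n. C / W z * (1/2::real) ^ n)" by (intro summable_mult summable_geometric) auto
    have sm: "summable (\<lambda>n. y (Suc n) z \<kappa> - y n z \<kappa>)"
      by (rule summable_comparison_test'[OF sg, of 0]) (use dn in auto)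
    have tel: "(\<Sum>k<n. y (Suc k) z \<kappa> - y k z \<kappa>) = y n z \<kappa>" for n
      by (subst sum_lessThan_telescope) (simp add: y0)
    show "(\<lambda>n. y n z \<kappa>) \<longlonglongrightarrow> L z \<kappa>" using summable_LIMSEQ[OF sm] by (simp add: tel L_def)
    have "L z \<kappa> - y n z \<kappa> = (\<Sum>k. y (Suc (k + n)) z \<kappa> - y (k + n) z \<kappa>)"
      using suminf_minus_initial_segment[OF sm, of n] by (simp add: tel L_def)
    also have "norm \<dots> \<le> (\<Sum>k. C / W z * (1/2) ^ (k + n))"
    proof (rule norm_suminf_le)
      show "summable (\<lambda>k. C / W z * (1/2::real) ^ (k + n))"
        using sg by (rule summable_ignore_initial_segment)
    qed (use dn in auto)
    also have "\<dots> = (\<Sum>k. (C / W z * (1/2) ^ n) * (1/2) ^ k)" by (simp add: power_add mult_ac)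
    also have "\<dots> = (C / W z * (1/2) ^ n) * 2"
      by (subst suminf_mult) (auto simp: suminf_geometric intro!: summable_geometric)
    finally show "norm (y n z \<kappa> - L z \<kappa>) \<le> 2 * C / 2 ^ n / W z"
      by (simp add: norm_minus_commute power_divide field_simps)
  qed
  have ul: "\<exists>d>0. cball x d \<subseteq> G \<and> uniform_limit (cball x d \<times> H) (\<lambda>n (x, h). y n x h) (\<lambda>(x, h). L x h) sequentially"
    if x: "x \<in> G" for x
  proof -
    obtain d where d: "d > 0" "cball x d \<subseteq> G" using G x open_contains_cball by blast
    have "\<exists>w\<in>cball x d. \<forall>v\<in>cball x d. W w \<le> W v"
      by (rule continuous_attains_inf) (use d continuous_on_subset[OF Wc d(2)] in auto)
    then obtain w where w: "w \<in> cball x d" "\<And>v. v \<in> cball x d \<Longrightarrow> W w \<le> W v" by blast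
    have Ww: "W w > 0" using Wp w d by blast
    have "uniform_limit (cball x d \<times> H) (\<lambda>n (x, h). y n x h) (\<lambda>(x, h). L x h) sequentially"
    proof (rule uniform_limitI)
      fix e :: real assume e: "e > 0"
      have "(\<lambda>n. 2 * C / W w * (1/2::real) ^ n) \<longlonglongrightarrow> 2 * C / W w * 0"
        by (intro tendsto_intros LIMSEQ_power_zero) auto
      then have "\<forall>\<^sub>F n in sequentially. 2 * C / W w * (1/2::real) ^ n < e"
        using e by (intro order_tendstoD) auto
      then show "\<forall>\<^sub>F n in sequentially. \<forall>p\<in>cball x d \<times> H. dist (case p of (x, h) \<Rightarrow> y n x h) (case p of (x, h) \<Rightarrow> L x h) < e"
      proof eventually_elim
        case (elim n)
        show ?case
        proof (clarsimp simp: dist_norm)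
          fix v h assume v: "norm (x - v) \<le> d" and h: "h \<in> H"
          have vG: "v \<in> cball x d" using v by (simp add: dist_norm)
          have "norm (y n v h - L v h) \<le> 2 * C / 2 ^ n / W v" using err vG d h by blast
          also have "\<dots> \<le> 2 * C / 2 ^ n / W w" using w(2)[OF vG] Ww K
            by (intro divide_left_mono) (auto simp: C_def)
          also have "\<dots> < e" using elim by (simp add: power_divide field_simps)
          finally show "norm (y n v h - L v h) < e" .
        qed
      qed
    qed
    then show ?thesis using d by blast
  qed
  have Lh: "sep_holo L G H" by (rule sep_holo_uniform_limit(1)[OF G yh oH ul])
  have dlim: "(\<lambda>n. deriv (\<lambda>x. y n x \<kappa>) z) \<longlonglongrightarrow> deriv (\<lambda>x. L x \<kappa>) z" if "z \<in> G" "\<kappa> \<in> H" for z \<kappa>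
    by (rule sep_holo_uniform_limit(2)[OF G yh oH ul that])
  show ?thesis
  proof (rule that[of L])
    show "sep_holo L G {\<kappa>. Re \<kappa> > R}" using Lh by (simp add: H_def)
    fix z \<kappa> assume z: "z \<in> G" and "Re \<kappa> > R"
    then have \<kappa>: "\<kappa> \<in> H" by (simp add: H_def)
    show "norm (L z \<kappa>) * W z \<le> 3 * K / (R - K)"
    proof (rule LIMSEQ_le_const2)
      show "(\<lambda>n. norm (y n z \<kappa>) * W z) \<longlonglongrightarrow> norm (L z \<kappa>) * W z"
        by (intro tendsto_intros conv z \<kappa>)
    qed (use yb[OF z \<kappa>] in \<open>auto simp: \<rho>_def m_def\<close>)
    have dy: "deriv (\<lambda>x. y (Suc n) x \<kappa>) z = \<kappa> * y (Suc n) z \<kappa> + F (y n) z \<kappa>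
         - exp (- \<kappa> * of_real (real (Suc n))) * F (y n) (z + of_real (real (Suc n))) \<kappa>" for n
    proof -
      have "sep_holo (I (real (Suc n)) (F (y n))) G H"
        unfolding I_def by (rule sep_holo_shifted_exponential_integral(1)[OF G oH Fholo[OF yh] shift]) auto
      then have hd: "(\<lambda>x. I (real (Suc n)) (F (y n)) x \<kappa>) field_differentiable (at z)"
        using \<kappa> z G holomorphic_on_imp_differentiable_at by (auto simp: sep_holo_def)
      have "deriv (\<lambda>x. y (Suc n) x \<kappa>) z = - deriv (\<lambda>x. I (real (Suc n)) (F (y n)) x \<kappa>) z"
        unfolding yS by (rule deriv_minus[OF hd])
      also have "deriv (\<lambda>x. I (real (Suc n)) (F (y n)) x \<kappa>) z = \<kappa> * I (real (Suc n)) (F (y n)) z \<kappa>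
          + exp (- \<kappa> * of_real (real (Suc n))) * F (y n) (z + of_real (real (Suc n))) \<kappa> - F (y n) z \<kappa>"
        unfolding I_def by (rule sep_holo_shifted_exponential_integral(2)[OF G oH Fholo[OF yh] shift _ z \<kappa>]) auto
      finally show ?thesis by (simp add: yS)
    qed
    have tz: "(\<lambda>n. exp (- \<kappa> * of_real (real (Suc n))) * F (y n) (z + of_real (real (Suc n))) \<kappa>) \<longlonglongrightarrow> 0"
    proof (rule Lim_null_comparison[OF always_eventually[OF allI]])
      fix n
      define s where "s = real (Suc n)"
      have s: "s \<ge> 0" by (simp add: s_def)
      have zs: "z + of_real s \<in> G" using shift z s by blast
      have "norm (F (y n) (z + of_real s) \<kappa>) * W z \<le> norm (F (y n) (z + of_real s) \<kappa>) * (exp (K * s) * W (z + of_real s))"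
        using Wg[OF z s] by (intro mult_left_mono) auto
      also have "\<dots> = norm (F (y n) (z + of_real s) \<kappa>) * W (z + of_real s) * exp (K * s)" by simp
      also have "\<dots> \<le> 3 * K * exp (K * s)" using Fbd[of "z + of_real s" \<kappa> "y n", OF zs \<kappa> yb1[OF zs \<kappa>]] by (intro mult_right_mono) auto
      finally have b: "norm (F (y n) (z + of_real s) \<kappa>) \<le> 3 * K / W z * exp (K * s)"
        using Wp[OF z] by (simp add: field_simps)
      have "norm (exp (- \<kappa> * of_real s) * F (y n) (z + of_real s) \<kappa>) = exp (- Re \<kappa> * s) * norm (F (y n) (z + of_real s) \<kappa>)"
        by (simp add: norm_mult)
      also have "\<dots> \<le> exp (- Re \<kappa> * s) * (3 * K / W z * exp (K * s))" using b by (intro mult_left_mono) auto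
      also have "\<dots> = 3 * K / W z * exp (- (Re \<kappa> - K) * s)" by (simp add: algebra_simps exp_diff exp_add exp_minus field_simps)
      also have "\<dots> \<le> 3 * K / W z * exp (- 1 * s)"
      proof (rule mult_left_mono)
        have "1 * s \<le> (Re \<kappa> - K) * s" using m \<kappa> s by (intro mult_right_mono) (auto simp: H_def m_def)
        then have "- (Re \<kappa> - K) * s \<le> - 1 * s" by linarith
        then show "exp (- (Re \<kappa> - K) * s) \<le> exp (- 1 * s)" by (rule exp_le_cancel_iff[THEN iffD2])
      qed (use K Wp[OF z] in auto)
      also have "exp (- 1 * s) = exp (- 1) * exp (- 1) ^ n"
        unfolding power_Suc[symmetric] by (subst exp_of_nat_mult[symmetric]) (simp add: s_def)
      finally show "norm (exp (- \<kappa> * of_real (real (Suc n))) * F (y n) (z + of_real (real (Suc n))) \<kappa>)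
          \<le> 3 * K / W z * (exp (- 1) * exp (- 1) ^ n)" unfolding s_def .
    next
      have "(\<lambda>n. 3 * K / W z * (exp (- 1) * exp (- 1 :: real) ^ n)) \<longlonglongrightarrow> 3 * K / W z * (exp (- 1) * 0)"
        by (intro tendsto_intros LIMSEQ_power_zero) auto
      then show "(\<lambda>n. 3 * K / W z * (exp (- 1) * exp (- 1 :: real) ^ n)) \<longlonglongrightarrow> 0" by simp
    qed
    have "(\<lambda>n. \<kappa> * y (Suc n) z \<kappa> + F (y n) z \<kappa>
         - exp (- \<kappa> * of_real (real (Suc n))) * F (y n) (z + of_real (real (Suc n))) \<kappa>)
        \<longlonglongrightarrow> \<kappa> * L z \<kappa> + F L z \<kappa> - 0"
      unfolding F_def by (intro tendsto_intros conv z \<kappa> LIMSEQ_Suc[OF conv] tz[unfolded F_def])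
    moreover have "(\<lambda>n. deriv (\<lambda>x. y (Suc n) x \<kappa>) z) \<longlonglongrightarrow> deriv (\<lambda>x. L x \<kappa>) z"
      using dlim[OF z \<kappa>] by (rule LIMSEQ_Suc)
    ultimately have "deriv (\<lambda>x. L x \<kappa>) z = \<kappa> * L z \<kappa> + F L z \<kappa>"
      unfolding dy by (simp add: LIMSEQ_unique)
    moreover have "((\<lambda>z. L z \<kappa>) has_field_derivative deriv (\<lambda>x. L x \<kappa>) z) (at z)"
      using Lh z \<kappa> G by (intro holomorphic_derivI[of _ G]) (auto simp: sep_holo_def)
    ultimately show "((\<lambda>z. L z \<kappa>) has_field_derivative
        \<kappa> * L z \<kappa> + (c0 z \<kappa> + c1 z \<kappa> * L z \<kappa> + c2 z \<kappa> * (L z \<kappa>)\<^sup>2)) (at z)"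
      by (simp add: F_def)
  qed
qed

section \<open>Existence near the leading-order root\<close>

text \<open>The total length of \<open>(p, q)\<close> cannot shrink faster than exponentially.\<close>

lemma Gronwall_backward:
  fixes p q p' q' :: "real \<Rightarrow> complex"
  assumes p: "\<And>s. s \<ge> 0 \<Longrightarrow> (p has_vector_derivative p' s) (at s)"
    and q: "\<And>s. s \<ge> 0 \<Longrightarrow> (q has_vector_derivative q' s) (at s)"
    and p': "\<And>s. s \<ge> 0 \<Longrightarrow> norm (p' s) \<le> K * (norm (p s) + norm (q s))"
    and q': "\<And>s. s \<ge> 0 \<Longrightarrow> norm (q' s) \<le> K * (norm (p s) + norm (q s))"
    and K: "K \<ge> 0" and t: "t \<ge> 0"
  shows "(norm (p 0))\<^sup>2 + (norm (q 0))\<^sup>2 \<le> exp (4 * K * t) * ((norm (p t))\<^sup>2 + (norm (q t))\<^sup>2)"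
proof -
  define N where "N = (\<lambda>s. exp (4 * K * s) * (p s \<bullet> p s + q s \<bullet> q s))"
  have "N 0 \<le> N t"
  proof (rule DERIV_nonneg_imp_nondecreasing[OF t])
    fix s assume s: "0 \<le> s" "s \<le> t"
    have "(N has_real_derivative (exp (4 * K * s) * (4 * K * (p s \<bullet> p s + q s \<bullet> q s) + 2 * (p s \<bullet> p' s + q s \<bullet> q' s)))) (at s)"
    proof -
      have 1: "((\<lambda>s. p s \<bullet> p s) has_real_derivative 2 * (p s \<bullet> p' s)) (at s)"
        using bounded_bilinear.has_vector_derivative[OF bounded_bilinear_inner p[OF s(1)] p[OF s(1)]]
        by (simp add: has_real_derivative_iff_has_vector_derivative inner_commute)
      have 2: "((\<lambda>s. q s \<bullet> q s) has_real_derivative 2 * (q s \<bullet> q' s)) (at s)"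
        using bounded_bilinear.has_vector_derivative[OF bounded_bilinear_inner q[OF s(1)] q[OF s(1)]]
        by (simp add: has_real_derivative_iff_has_vector_derivative inner_commute)
      show ?thesis unfolding N_def
        by (rule derivative_eq_intros 1 2 refl | simp add: algebra_simps)+
    qed
    moreover have "4 * K * (p s \<bullet> p s + q s \<bullet> q s) + 2 * (p s \<bullet> p' s + q s \<bullet> q' s) \<ge> 0"
    proof -
      let ?p = "norm (p s)" and ?q = "norm (q s)"
      have "\<bar>p s \<bullet> p' s\<bar> \<le> ?p * (K * (?p + ?q))"
        by (rule order.trans[OF Cauchy_Schwarz_ineq2 mult_left_mono[OF p'[OF s(1)]]]) auto
      moreover have "\<bar>q s \<bullet> q' s\<bar> \<le> ?q * (K * (?p + ?q))"
        by (rule order.trans[OF Cauchy_Schwarz_ineq2 mult_left_mono[OF q'[OF s(1)]]]) auto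
      ultimately have "p s \<bullet> p' s + q s \<bullet> q' s \<ge> - (K * (?p + ?q)\<^sup>2)"
        by (simp add: power2_eq_square algebra_simps abs_le_iff)
      moreover have "K * (?p + ?q)\<^sup>2 \<le> K * (2 * (?p\<^sup>2 + ?q\<^sup>2))"
      proof (rule mult_left_mono[OF _ K])
        have "0 \<le> (?p - ?q)\<^sup>2" by simp
        then show "(?p + ?q)\<^sup>2 \<le> 2 * (?p\<^sup>2 + ?q\<^sup>2)" by (simp add: power2_eq_square algebra_simps)
      qed
      moreover have "p s \<bullet> p s + q s \<bullet> q s = ?p\<^sup>2 + ?q\<^sup>2" by (simp add: power2_norm_eq_inner)
      ultimately show ?thesis by (simp add: algebra_simps)
    qed
    ultimately show "\<exists>y. (N has_real_derivative y) (at s) \<and> 0 \<le> y" by fastforce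
  qed
  then show ?thesis by (simp add: N_def power2_norm_eq_inner)
qed

text \<open>With \<open>A1 = \<kappa> (A - A0)\<close> and likewise \<open>B1\<close>, \<open>C1\<close>, the substitution
  \<open>F = F0 + g / (1 - A0 g)\<close> removes the quadratic term \<open>\<kappa> A0 v\<^sup>2\<close> of the equation for
  \<open>v = F - F0\<close> and leads to \<open>g' = \<kappa> g + n0 + (c1 - 2 A0' F0) g + \<mu> g\<^sup>2\<close>.
  Put \<open>\<psi> = 1 - A0 F0\<close>. The functions \<open>A0\<close>, \<open>\<psi> = (1 + B0) / 2\<close>, \<open>F0 \<psi> = - C0\<close> and their
  derivatives are bounded although \<open>F0\<close> need not be. Consequently \<open>c1\<close> is bounded, \<open>\<mu>\<close> is a
  bounded combination of \<open>\<psi>\<^sup>2\<close>, \<open>A0 \<psi>\<close>, \<open>A0\<^sup>2\<close>, and \<open>n0\<close> becomes bounded after multiplication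
  with any of these. The one uncontrolled term, \<open>- 2 A0' F0\<close>, is removed by the factor \<open>\<sigma>\<^sup>2\<close>
  with \<open>\<sigma>' = - A0' F0 \<sigma>\<close>. Then \<open>(\<sigma> \<psi>, \<sigma> A0)\<close> satisfies a linear system with bounded coefficients,
  and its squared length is the weight. On the compact set \<open>L\<close> the weight divided by
  \<open>\<bar>\<sigma>\<bar>\<^sup>2\<close> is bounded below, so the ball of radius \<open>O (1 / R)\<close> for \<open>y\<close> gives a small \<open>g\<close>.\<close>

lemma Riccati_solution_near_root:
  fixes A B C :: "complex \<Rightarrow> complex \<Rightarrow> complex" and A0 B0 C0 F0 :: "complex \<Rightarrow> complex"
  assumes G: "open G" "convex G" and shift: "\<And>z s. z \<in> G \<Longrightarrow> s \<ge> 0 \<Longrightarrow> z + of_real s \<in> G"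
    and hol: "A0 holomorphic_on G" "F0 holomorphic_on G"
    and lin: "\<And>z. z \<in> G \<Longrightarrow> 2 * A0 z * F0 z + B0 z = 1"
    and root: "\<And>z. z \<in> G \<Longrightarrow> A0 z * (F0 z)\<^sup>2 + B0 z * F0 z + C0 z = 0"
    and K: "K \<ge> 1"
    and bd: "\<And>z. z \<in> G \<Longrightarrow> norm (A0 z) \<le> K" "\<And>z. z \<in> G \<Longrightarrow> norm (B0 z) \<le> K" "\<And>z. z \<in> G \<Longrightarrow> norm (C0 z) \<le> K"
    and bd': "\<And>z. z \<in> G \<Longrightarrow> norm (deriv A0 z) \<le> K" "\<And>z. z \<in> G \<Longrightarrow> norm (deriv B0 z) \<le> K" "\<And>z. z \<in> G \<Longrightarrow> norm (deriv C0 z) \<le> K"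
    and R0: "R0 \<ge> 0"
    and sh: "sep_holo A G {\<kappa>. Re \<kappa> > R0}" "sep_holo B G {\<kappa>. Re \<kappa> > R0}" "sep_holo C G {\<kappa>. Re \<kappa> > R0}"
    and rem: "\<And>z \<kappa>. z \<in> G \<Longrightarrow> Re \<kappa> > R0 \<Longrightarrow> norm (\<kappa> * (A z \<kappa> - A0 z)) \<le> K"
       "\<And>z \<kappa>. z \<in> G \<Longrightarrow> Re \<kappa> > R0 \<Longrightarrow> norm (\<kappa> * (B z \<kappa> - B0 z)) \<le> K"
       "\<And>z \<kappa>. z \<in> G \<Longrightarrow> Re \<kappa> > R0 \<Longrightarrow> norm (\<kappa> * (C z \<kappa> - C0 z)) \<le> K"
    and L: "compact L" "L \<subseteq> G" and U: "U \<subseteq> L" "open U"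
  obtains R F where "R \<ge> R0" "sep_holo F U {\<kappa>. Re \<kappa> > R}"
    "\<And>z \<kappa>. z \<in> U \<Longrightarrow> Re \<kappa> > R \<Longrightarrow> deriv (\<lambda>z. F z \<kappa>) z = \<kappa> * (A z \<kappa> * (F z \<kappa>)\<^sup>2 + B z \<kappa> * F z \<kappa> + C z \<kappa>)"
    "\<And>z \<kappa>. z \<in> U \<Longrightarrow> Re \<kappa> > R \<Longrightarrow> norm (A0 z * (F z \<kappa> - F0 z)) \<le> 1 / 2"
    "\<And>z \<kappa>. z \<in> U \<Longrightarrow> Re \<kappa> > R \<Longrightarrow> norm (F z \<kappa> - F0 z) \<le> 1"
proof -
  define a' where "a' = deriv A0"
  define f' where "f' = deriv F0"
  define \<psi> where "\<psi> = (\<lambda>z. 1 - A0 z * F0 z)"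
  define \<psi>' where "\<psi>' = (\<lambda>z. - (a' z * F0 z + A0 z * f' z))"
  define b' where "b' = deriv B0"
  define c' where "c' = deriv C0"
  have dA: "(A0 has_field_derivative a' z) (at z)" and dF: "(F0 has_field_derivative f' z) (at z)" if "z \<in> G" for z
    using hol G that by (auto simp: a'_def f'_def intro: holomorphic_derivI)
  have d\<psi>: "(\<psi> has_field_derivative \<psi>' z) (at z)" if "z \<in> G" for z
    unfolding \<psi>_def \<psi>'_def using dA[OF that] dF[OF that]
    by (auto intro!: derivative_eq_intros)
  have B0: "B0 z = 2 * \<psi> z - 1" if "z \<in> G" for z using lin[OF that] by (simp add: \<psi>_def algebra_simps)
  have C0: "C0 z = - F0 z * \<psi> z" if "z \<in> G" for z
  proof -
    have e: "B0 z = 1 - 2 * A0 z * F0 z" using lin[OF that] by (simp add: algebra_simps)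
    have "C0 z = - (A0 z * (F0 z)\<^sup>2 + B0 z * F0 z)" by (rule minus_unique[OF root[OF that], symmetric])
    also have "\<dots> = - F0 z * \<psi> z" unfolding e by (simp add: \<psi>_def power2_eq_square algebra_simps)
    finally show ?thesis .
  qed
  have b': "b' z = 2 * \<psi>' z" if z: "z \<in> G" for z
  proof -
    have "((\<lambda>z. 2 * \<psi> z - 1) has_field_derivative 2 * \<psi>' z) (at z)"
      using d\<psi>[OF z] by (auto intro!: derivative_eq_intros)
    then have "(B0 has_field_derivative 2 * \<psi>' z) (at z)"
      by (rule has_field_derivative_transform_within_open[OF _ G(1) z]) (simp add: B0)
    then show ?thesis by (simp add: b'_def DERIV_imp_deriv)
  qed
  have c': "c' z = - (f' z * \<psi> z + F0 z * \<psi>' z)" if z: "z \<in> G" for z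
  proof -
    have "((\<lambda>z. - F0 z * \<psi> z) has_field_derivative - (f' z * \<psi> z + F0 z * \<psi>' z)) (at z)"
      using d\<psi>[OF z] dF[OF z] by (auto intro!: derivative_eq_intros)
    then have "(C0 has_field_derivative - (f' z * \<psi> z + F0 z * \<psi>' z)) (at z)"
      by (rule has_field_derivative_transform_within_open[OF _ G(1) z]) (simp add: C0)
    then show ?thesis by (simp add: c'_def DERIV_imp_deriv)
  qed
  have hol': "a' holomorphic_on G" "f' holomorphic_on G" "\<psi> holomorphic_on G" "\<psi>' holomorphic_on G"
    unfolding a'_def f'_def \<psi>_def \<psi>'_def using hol G by (auto intro!: holomorphic_intros holomorphic_deriv)
  have n\<psi>: "norm (\<psi> z) \<le> K" if "z \<in> G" for z
  proof -
    have "2 * \<psi> z = 1 + B0 z" using B0[OF that] by simp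
    then have "2 * norm (\<psi> z) = norm (1 + B0 z)" by (metis norm_mult norm_numeral)
    also have "\<dots> \<le> 1 + K" using norm_triangle_ineq[of 1 "B0 z"] bd(2)[OF that] by simp
    finally show ?thesis using K by simp
  qed
  have n\<phi>: "norm (A0 z * F0 z) \<le> K" if "z \<in> G" for z
  proof -
    have "2 * (A0 z * F0 z) = 1 - B0 z" using lin[OF that] by (simp add: algebra_simps)
    then have "2 * norm (A0 z * F0 z) = norm (1 - B0 z)" by (metis norm_mult norm_numeral)
    also have "\<dots> \<le> 1 + K" using norm_triangle_ineq4[of 1 "B0 z"] bd(2)[OF that] by simp
    finally show ?thesis using K by simp
  qed
  have n\<psi>': "norm (\<psi>' z) \<le> K" if "z \<in> G" for z
  proof -
    have "2 * norm (\<psi>' z) = norm (b' z)" using b'[OF that] by (simp add: norm_mult)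
    also have "\<dots> \<le> K" using bd'(2)[OF that] by (simp add: b'_def)
    finally show ?thesis using K norm_ge_zero[of "\<psi>' z"] by linarith
  qed
  have "(\<lambda>z. - (a' z * F0 z)) holomorphic_on G" using hol' hol by (intro holomorphic_intros)
  then obtain P where P: "\<And>z. z \<in> G \<Longrightarrow> (P has_field_derivative - (a' z * F0 z)) (at z within G)"
    using holomorphic_convex_primitive'[OF G(2,1)] by blast
  then have dP: "(P has_field_derivative - (a' z * F0 z)) (at z)" if "z \<in> G" for z
    using G that by (metis at_within_open)
  define \<sigma> where "\<sigma> = (\<lambda>z. exp (P z))"
  have d\<sigma>: "(\<sigma> has_field_derivative - (a' z * F0 z) * \<sigma> z) (at z)" if "z \<in> G" for z
    unfolding \<sigma>_def using dP[OF that] by (auto intro!: derivative_eq_intros)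
  have \<sigma>0: "\<sigma> z \<noteq> 0" for z by (simp add: \<sigma>_def)
  have h\<sigma>: "\<sigma> holomorphic_on G" using d\<sigma> G(1) by (subst holomorphic_on_open) auto
  define N where "N = (\<lambda>z. (norm (\<psi> z))\<^sup>2 + (norm (A0 z))\<^sup>2)"
  define W where "W = (\<lambda>z. (norm (\<sigma> z * \<psi> z))\<^sup>2 + (norm (\<sigma> z * A0 z))\<^sup>2)"
  have WN: "W z = (norm (\<sigma> z))\<^sup>2 * N z" for z
    by (simp add: W_def N_def norm_mult power_mult_distrib algebra_simps)
  have Npos: "N z > 0" for z
  proof -
    have "\<psi> z \<noteq> 0 \<or> A0 z \<noteq> 0" by (auto simp: \<psi>_def)
    then show ?thesis unfolding N_def by (auto intro: add_pos_nonneg add_nonneg_pos)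
  qed
  have Wp: "W z > 0" for z using Npos \<sigma>0 by (simp add: WN)
  have contN: "continuous_on G N"
    unfolding N_def using hol'(3) hol(1) by (intro continuous_intros holomorphic_on_imp_continuous_on)
  have Wc: "continuous_on G W"
    unfolding W_def using hol'(3) hol(1) h\<sigma> by (intro continuous_intros holomorphic_on_imp_continuous_on)
  define K' where "K' = 10 * K ^ 3"
  have K3: "K \<le> K ^ 3" "K\<^sup>2 \<le> K ^ 3" "K ^ 3 > 0"
    using K power_increasing[of 1 3 K] power_increasing[of 2 3 K] by auto
  have K': "K' > 0" "4 * K \<le> K'" using K K3 by (auto simp: K'_def)
  have Wg: "W z \<le> exp (K' * s) * W (z + of_real s)" if z: "z \<in> G" and s: "s \<ge> 0" for z s
  proof -
    define p where "p = (\<lambda>s::real. \<sigma> (z + of_real s) * \<psi> (z + of_real s))"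
    define q where "q = (\<lambda>s::real. \<sigma> (z + of_real s) * A0 (z + of_real s))"
    define p' where "p' = (\<lambda>s::real. 2 * \<psi>' (z + of_real s) * p s - c' (z + of_real s) * q s)"
    define q' where "q' = (\<lambda>s::real. a' (z + of_real s) * p s)"
    have vd: "((\<lambda>s. h (z + of_real s)) has_vector_derivative h') (at s)"
      if "(h has_field_derivative h') (at (z + of_real s))" for h h' and s :: real
    proof -
      have a: "((\<lambda>w. z + w) has_field_derivative 1) (at (of_real s :: complex))" by (auto intro!: derivative_eq_intros)
      have "((\<lambda>w. h (z + w)) has_field_derivative h') (at (of_real s))"
        using DERIV_chain2[OF that a] by simp
      from has_vector_derivative_real_field[OF this] show ?thesis by simp
    qed
    have "(norm (p 0))\<^sup>2 + (norm (q 0))\<^sup>2 \<le> exp (4 * K * s) * ((norm (p s))\<^sup>2 + (norm (q s))\<^sup>2)"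
    proof (rule Gronwall_backward[where p' = p' and q' = q'])
      fix s :: real assume s: "s \<ge> 0"
      let ?w = "z + of_real s"
      have w: "?w \<in> G" using shift z s by blast
      have "((\<lambda>w. \<sigma> w * \<psi> w) has_field_derivative p' s) (at ?w)"
        using d\<sigma>[OF w] d\<psi>[OF w]
        by (rule derivative_eq_intros) 
           (simp add: p'_def p_def q_def c'[OF w], simp add: \<psi>'_def \<psi>_def algebra_simps)
      from vd[OF this] show "(p has_vector_derivative p' s) (at s)" by (simp add: p_def)
      have "((\<lambda>w. \<sigma> w * A0 w) has_field_derivative q' s) (at ?w)"
        using d\<sigma>[OF w] dA[OF w]
        by (rule derivative_eq_intros) (simp add: q'_def p_def \<psi>_def algebra_simps)
      from vd[OF this] show "(q has_vector_derivative q' s) (at s)" by (simp add: q_def)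
      have "norm (p' s) \<le> norm (b' ?w) * norm (p s) + norm (c' ?w) * norm (q s)"
        unfolding p'_def by (rule order.trans[OF norm_triangle_ineq4]) (simp add: norm_mult b'[OF w])
      also have "\<dots> \<le> K * norm (p s) + K * norm (q s)"
        using bd'[OF w] by (intro add_mono mult_right_mono) (auto simp: b'_def c'_def)
      finally show "norm (p' s) \<le> K * (norm (p s) + norm (q s))" by (simp add: algebra_simps)
      have "norm (q' s) = norm (a' ?w) * norm (p s)" by (simp add: q'_def norm_mult)
      also have "\<dots> \<le> K * (norm (p s) + norm (q s))" using bd'(1)[OF w] K by (intro mult_mono) (auto simp: a'_def)
      finally show "norm (q' s) \<le> K * (norm (p s) + norm (q s))" .
    qed (use K s in auto)
    then have "W z \<le> exp (4 * K * s) * W (z + of_real s)" by (simp add: W_def p_def q_def)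
    also have "\<dots> \<le> exp (K' * s) * W (z + of_real s)"
      using K' s less_imp_le[OF Wp] by (intro mult_right_mono) (auto intro!: mult_right_mono)
    finally show ?thesis .
  qed
  define A1 where "A1 = (\<lambda>z \<kappa>. \<kappa> * (A z \<kappa> - A0 z))"
  define B1 where "B1 = (\<lambda>z \<kappa>. \<kappa> * (B z \<kappa> - B0 z))"
  define C1 where "C1 = (\<lambda>z \<kappa>. \<kappa> * (C z \<kappa> - C0 z))"
  define n0 where "n0 = (\<lambda>z \<kappa>. A1 z \<kappa> * (F0 z)\<^sup>2 + B1 z \<kappa> * F0 z + C1 z \<kappa> - f' z)"
  define \<mu> where "\<mu> = (\<lambda>z \<kappa>. A1 z \<kappa> * (\<psi> z)\<^sup>2 - A0 z * B1 z \<kappa> * \<psi> z + (A0 z)\<^sup>2 * C1 z \<kappa> + (A0 z * \<psi>' z - a' z * \<psi> z))"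
  define c0 where "c0 = (\<lambda>z \<kappa>. n0 z \<kappa> / (\<sigma> z)\<^sup>2)"
  define c1 where "c1 = (\<lambda>z \<kappa>. (2 * \<psi> z - 1) * B1 z \<kappa> + 2 * A1 z \<kappa> * (F0 z * \<psi> z) - 2 * A0 z * C1 z \<kappa> - 2 * \<psi>' z)"
  define c2 where "c2 = (\<lambda>z \<kappa>. \<mu> z \<kappa> * (\<sigma> z)\<^sup>2)"
  \<comment> \<open>A positive lower bound on \<open>L\<close>; the infimum of the empty set is unspecified.\<close>
  define N0 where "N0 = (if L = {} then 1 else Inf (N ` L))"
  have N0: "N0 > 0" "\<And>z. z \<in> L \<Longrightarrow> N0 \<le> N z"
  proof -
    have "\<exists>m>0. \<forall>z\<in>L. m \<le> N z"
    proof (cases "L = {}")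
      case False
      then obtain w where "w \<in> L" "\<And>v. v \<in> L \<Longrightarrow> N w \<le> N v"
        using continuous_attains_inf[OF L(1) _ continuous_on_subset[OF contN L(2)]] by blast
      then show ?thesis using Npos by blast
    qed (auto intro: exI[of _ 1])
    then obtain m where m: "m > 0" "\<And>z. z \<in> L \<Longrightarrow> m \<le> N z" by blast
    show "N0 > 0"
    proof (cases "L = {}")
      case False
      then have "m \<le> N0" unfolding N0_def using m by (auto intro!: cINF_greatest)
      then show ?thesis using m by simp
    qed (simp add: N0_def)
    show "N0 \<le> N z" if "z \<in> L" for z
      unfolding N0_def using that m by (auto intro!: cINF_lower bdd_belowI2[of _ m])
  qed
  \<comment> \<open>The second entry is needed for the contraction, the third for \<open>norm g \<le> 1 / (4 K)\<close> on \<open>L\<close>.\<close>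
  define R where "R = max R0 (max (13 * K' + 1) (K' + 12 * K * K' / N0))"
  have R: "R \<ge> R0" "R \<ge> 13 * K' + 1" "R - K' \<ge> 12 * K * K' / N0" by (auto simp: R_def)
  let ?H = "{\<kappa>::complex. Re \<kappa> > R}"
  have bnd1: "norm (A1 z \<kappa>) \<le> K" "norm (B1 z \<kappa>) \<le> K" "norm (C1 z \<kappa>) \<le> K" if "z \<in> G" "Re \<kappa> > R" for z \<kappa>
    using rem[OF that(1)] that(2) R(1) by (auto simp: A1_def B1_def C1_def)
  have hB: "B0 holomorphic_on G"
    by (rule holomorphic_transform[of "\<lambda>z. 2 * \<psi> z - 1"]) (use hol' B0 in \<open>auto intro!: holomorphic_intros\<close>)
  have hC: "C0 holomorphic_on G"
    by (rule holomorphic_transform[of "\<lambda>z. - F0 z * \<psi> z"]) (use hol hol' C0 in \<open>auto intro!: holomorphic_intros\<close>)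
  have subH: "?H \<subseteq> {\<kappa>. Re \<kappa> > R0}" using R(1) by auto
  have s1: "sep_holo A1 G ?H" "sep_holo B1 G ?H" "sep_holo C1 G ?H"
    unfolding A1_def B1_def C1_def
    by (intro sep_holo_mult sep_holo_diff sep_holo_const_fst[OF hol(1)] sep_holo_const_fst[OF hB] sep_holo_const_fst[OF hC]
        sep_holo_const_snd holomorphic_on_ident sep_holo_subset[OF sh(1) order_refl subH]
        sep_holo_subset[OF sh(2) order_refl subH] sep_holo_subset[OF sh(3) order_refl subH])+
  note cf = sep_holo_const_fst[OF hol(1)] sep_holo_const_fst[OF hol(2)] sep_holo_const_fst[OF hol'(1)]
    sep_holo_const_fst[OF hol'(2)] sep_holo_const_fst[OF hol'(3)] sep_holo_const_fst[OF hol'(4)] sep_holo_const_fst[OF h\<sigma>]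
    sep_holo_const_fst[OF holomorphic_on_const]
  have sc: "sep_holo c0 G ?H" "sep_holo c1 G ?H" "sep_holo c2 G ?H"
    unfolding c0_def c1_def c2_def n0_def \<mu>_def
    by (intro sep_holo_add sep_holo_diff sep_holo_mult sep_holo_power sep_holo_divide s1 cf; simp add: \<sigma>0)+
  have bn: "norm (x * y) \<le> p * q" if "norm x \<le> p" "norm y \<le> q" for x y :: complex and p q
    unfolding norm_mult using that order.trans[OF norm_ge_zero that(1)] by (intro mult_mono) auto
  have bp: "norm (x + y) \<le> p + q" if "norm x \<le> p" "norm y \<le> q" for x y :: complex and p q
    using norm_triangle_ineq[of x y] that by linarith
  have bm: "norm (x - y) \<le> p + q" if "norm x \<le> p" "norm y \<le> q" for x y :: complex and p q
    using norm_triangle_ineq4[of x y] that by linarith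
  have c0b: "norm (c0 z \<kappa>) * W z \<le> K'" if z: "z \<in> G" and \<kappa>: "Re \<kappa> > R" for z \<kappa>
  proof -
    have "norm (c0 z \<kappa>) * W z = norm (n0 z \<kappa>) * N z"
      using \<sigma>0[of z] by (simp add: c0_def WN norm_divide norm_power)
    also have "\<dots> = norm (n0 z \<kappa> * (\<psi> z * \<psi> z)) + norm (n0 z \<kappa> * (A0 z * A0 z))"
      by (simp add: N_def norm_mult algebra_simps power2_eq_square)
    also have "n0 z \<kappa> * (\<psi> z * \<psi> z) = A1 z \<kappa> * (C0 z * C0 z) - B1 z \<kappa> * (C0 z * \<psi> z) + C1 z \<kappa> * (\<psi> z * \<psi> z) + (\<psi> z * c' z - C0 z * \<psi>' z)"
      unfolding n0_def C0[OF z] c'[OF z] by (simp add: algebra_simps power2_eq_square)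
    also have "n0 z \<kappa> * (A0 z * A0 z) = A1 z \<kappa> * ((A0 z * F0 z) * (A0 z * F0 z)) + B1 z \<kappa> * (A0 z * (A0 z * F0 z)) + C1 z \<kappa> * (A0 z * A0 z)
         + (A0 z * \<psi>' z + a' z * (A0 z * F0 z))"
      unfolding n0_def \<psi>'_def by (simp add: algebra_simps power2_eq_square)
    also have "norm (A1 z \<kappa> * (C0 z * C0 z) - B1 z \<kappa> * (C0 z * \<psi> z) + C1 z \<kappa> * (\<psi> z * \<psi> z) + (\<psi> z * c' z - C0 z * \<psi>' z))
       \<le> K * (K * K) + K * (K * K) + K * (K * K) + (K * K + K * K)"
      by (intro bn bp bm bnd1 z \<kappa> bd n\<psi> n\<psi>' bd'(3)[folded c'_def])
    also have "norm (A1 z \<kappa> * ((A0 z * F0 z) * (A0 z * F0 z)) + B1 z \<kappa> * (A0 z * (A0 z * F0 z)) + C1 z \<kappa> * (A0 z * A0 z)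
         + (A0 z * \<psi>' z + a' z * (A0 z * F0 z))) \<le> K * (K * K) + K * (K * K) + K * (K * K) + (K * K + K * K)"
      by (intro bp bn[OF _ n\<phi>] bn[OF _ bn[OF n\<phi> n\<phi>]] bn[OF _ bn[OF _ n\<phi>]] bn[OF _ bn[OF bd(1) bd(1)]] bn[OF bd(1) n\<psi>'] bnd1 z \<kappa> bd bd'(1)[folded a'_def])
    finally have "norm (c0 z \<kappa>) * W z \<le> 6 * K ^ 3 + 4 * K\<^sup>2" by (simp add: power2_eq_square power3_eq_cube)
    then show ?thesis using K3 by (simp add: K'_def)
  qed
  have c1b: "norm (c1 z \<kappa>) \<le> K'" if z: "z \<in> G" and \<kappa>: "Re \<kappa> > R" for z \<kappa>
  proof -
    have "c1 z \<kappa> = B0 z * B1 z \<kappa> - 2 * (A1 z \<kappa> * C0 z) - 2 * (A0 z * C1 z \<kappa>) - b' z"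
      unfolding c1_def B0[OF z] C0[OF z] b'[OF z] by (simp add: algebra_simps)
    also have "norm \<dots> \<le> K * K + 2 * (K * K) + 2 * (K * K) + K"
      by (intro bm bn bnd1 z \<kappa> bd bd'(2)[folded b'_def]) auto
    also have "\<dots> \<le> K'" using K3 by (simp add: K'_def power2_eq_square)
    finally show ?thesis .
  qed
  have c2b: "norm (c2 z \<kappa>) \<le> K' * W z" if z: "z \<in> G" and \<kappa>: "Re \<kappa> > R" for z \<kappa>
  proof -
    have A\<psi>: "norm (A0 z * \<psi> z) \<le> N z"
    proof -
      have "0 \<le> (norm (A0 z) - norm (\<psi> z))\<^sup>2" by simp
      then have "2 * norm (A0 z * \<psi> z) \<le> N z" by (simp add: N_def norm_mult power2_eq_square algebra_simps)
      then show ?thesis using norm_ge_zero[of "A0 z * \<psi> z"] by linarith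
    qed
    have AA: "norm (A0 z * A0 z) \<le> N z" "norm (\<psi> z * \<psi> z) \<le> N z"
      by (simp_all add: N_def norm_mult power2_eq_square)
    have \<mu>: "\<mu> z \<kappa> = A1 z \<kappa> * (\<psi> z * \<psi> z) - B1 z \<kappa> * (A0 z * \<psi> z) + C1 z \<kappa> * (A0 z * A0 z)
        + (b' z * (A0 z * \<psi> z) - a' z * (\<psi> z * \<psi> z) - c' z * (A0 z * A0 z))"
      unfolding \<mu>_def b'[OF z] c'[OF z] by (simp add: \<psi>'_def \<psi>_def algebra_simps power2_eq_square)
    have "norm (\<mu> z \<kappa>) \<le> K * N z + K * N z + K * N z + (K * N z + K * N z + K * N z)"
      unfolding \<mu>
      by (rule bp[OF bp[OF bm[OF bn[OF bnd1(1)[OF z \<kappa>] AA(2)] bn[OF bnd1(2)[OF z \<kappa>] A\<psi>]] bn[OF bnd1(3)[OF z \<kappa>] AA(1)]]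
          bm[OF bm[OF bn[OF bd'(2)[OF z, folded b'_def] A\<psi>] bn[OF bd'(1)[OF z, folded a'_def] AA(2)]] bn[OF bd'(3)[OF z, folded c'_def] AA(1)]]])
    also have "\<dots> = (6 * K) * N z" by (simp add: algebra_simps)
    also have "\<dots> \<le> K' * N z"
    proof (rule mult_right_mono)
      show "6 * K \<le> K'" unfolding K'_def using K3(1,3) by linarith
    qed (use Npos[of z] in simp)
    finally have le: "norm (\<mu> z \<kappa>) \<le> K' * N z" .
    have "norm (c2 z \<kappa>) = norm (\<mu> z \<kappa>) * (norm (\<sigma> z))\<^sup>2" by (simp only: c2_def norm_mult norm_power)
    also have "\<dots> \<le> K' * N z * (norm (\<sigma> z))\<^sup>2" using le by (rule mult_right_mono) simp
    also have "\<dots> = K' * W z" by (simp only: WN mult.assoc mult.commute[of "N z"])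
    finally show ?thesis .
  qed
  obtain y where y: "sep_holo y G ?H"
    and yb: "\<And>z \<kappa>. z \<in> G \<Longrightarrow> Re \<kappa> > R \<Longrightarrow> norm (y z \<kappa>) * W z \<le> 3 * K' / (R - K')"
    and yd: "\<And>z \<kappa>. z \<in> G \<Longrightarrow> Re \<kappa> > R \<Longrightarrow> ((\<lambda>z. y z \<kappa>) has_field_derivative
        \<kappa> * y z \<kappa> + (c0 z \<kappa> + c1 z \<kappa> * y z \<kappa> + c2 z \<kappa> * (y z \<kappa>)\<^sup>2)) (at z)"
    using weighted_Picard_solution[OF G(1) shift Wc Wp Wg K'(1) R(2) sc c0b c1b c2b] by blast
  define g where "g = (\<lambda>z \<kappa>. (\<sigma> z)\<^sup>2 * y z \<kappa>)"
  define F where "F = (\<lambda>z \<kappa>. F0 z + g z \<kappa> / (1 - A0 z * g z \<kappa>))"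
  have gb: "norm (g z \<kappa>) \<le> 1 / (4 * K)" if z: "z \<in> U" and \<kappa>: "Re \<kappa> > R" for z \<kappa>
  proof -
    have zL: "z \<in> L" "z \<in> G" using z U L by auto
    have "norm (g z \<kappa>) * N z = norm (y z \<kappa>) * W z" by (simp add: g_def WN norm_mult norm_power)
    also have "\<dots> \<le> 3 * K' / (R - K')" using yb zL \<kappa> by blast
    also have "\<dots> \<le> 3 * K' / (12 * K * K' / N0)"
    proof (rule divide_left_mono[OF R(3)])
      have "K' < R" using R(2) K' by linarith
      then show "0 < (R - K') * (12 * K * K' / N0)" using K' N0(1) K by (intro mult_pos_pos divide_pos_pos) auto
    qed (use K' in simp)
    also have "\<dots> = N0 / (4 * K)" using K' K N0 by (simp add: field_simps)
    finally have "norm (g z \<kappa>) * N z \<le> N0 / (4 * K)" .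
    moreover have "norm (g z \<kappa>) * N0 \<le> norm (g z \<kappa>) * N z" using N0(2)[OF zL(1)] by (intro mult_left_mono) auto
    ultimately have "norm (g z \<kappa>) * N0 \<le> (1 / (4 * K)) * N0" by simp
    then show ?thesis using N0(1) by (rule mult_right_le_imp_le)
  qed
  have Agb: "norm (A0 z * g z \<kappa>) \<le> 1 / 4" if z: "z \<in> U" and \<kappa>: "Re \<kappa> > R" for z \<kappa>
  proof -
    have "norm (A0 z * g z \<kappa>) \<le> K * (1 / (4 * K))" using z U L by (intro bn bd gb \<kappa>) auto
    then show ?thesis using K by simp
  qed
  have dn: "norm (1 - A0 z * g z \<kappa>) \<ge> 3 / 4" if z: "z \<in> U" and \<kappa>: "Re \<kappa> > R" for z \<kappa>
    using Agb[OF that] norm_triangle_ineq2[of 1 "A0 z * g z \<kappa>"] by simp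
  have UG: "U \<subseteq> G" using U L by auto
  show ?thesis
  proof (rule that[of R F])
    show "R \<ge> R0" by (rule R)
    have "sep_holo g U ?H" unfolding g_def
      by (rule sep_holo_subset[OF _ UG order_refl]) (intro sep_holo_mult sep_holo_power cf y)
    moreover have "1 - A0 z * g z \<kappa> \<noteq> 0" if "z \<in> U" "\<kappa> \<in> ?H" for z \<kappa> using dn[of z \<kappa>] that by auto
    ultimately show "sep_holo F U ?H" unfolding F_def
      by (intro sep_holo_add sep_holo_divide sep_holo_diff sep_holo_mult cf(8)
          sep_holo_subset[OF cf(1) UG order_refl] sep_holo_subset[OF cf(2) UG order_refl]) auto
    fix z \<kappa> assume z: "z \<in> U" and \<kappa>: "Re \<kappa> > R"
    have zG: "z \<in> G" using z UG by auto
    have n0': "1 - A0 z * g z \<kappa> \<noteq> 0" using dn[OF z \<kappa>] by auto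
    have Fv: "norm (F z \<kappa> - F0 z) \<le> norm (g z \<kappa>) / (3 / 4)"
    proof -
      have "norm (F z \<kappa> - F0 z) = norm (g z \<kappa>) / norm (1 - A0 z * g z \<kappa>)" by (simp add: F_def norm_divide)
      also have "\<dots> \<le> norm (g z \<kappa>) / (3 / 4)"
        using dn[OF z \<kappa>] by (intro divide_left_mono) auto
      finally show ?thesis .
    qed
    show "norm (F z \<kappa> - F0 z) \<le> 1"
    proof -
      have "1 / (4 * K) \<le> 1 / 4" using K by (simp add: field_simps)
      then show ?thesis using Fv gb[OF z \<kappa>] by simp
    qed
    have "norm (A0 z) * norm (F z \<kappa> - F0 z) \<le> norm (A0 z) * (norm (g z \<kappa>) / (3 / 4))"
      using Fv by (intro mult_left_mono) auto
    then show "norm (A0 z * (F z \<kappa> - F0 z)) \<le> 1 / 2"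
      using Agb[OF z \<kappa>] by (simp add: norm_mult)
    have R\<kappa>: "\<kappa> \<noteq> 0" using \<kappa> R(1) R0 by auto
    have gd: "((\<lambda>z. g z \<kappa>) has_field_derivative
       \<kappa> * g z \<kappa> + n0 z \<kappa> + (c1 z \<kappa> - 2 * a' z * F0 z) * g z \<kappa> + \<mu> z \<kappa> * (g z \<kappa>)\<^sup>2) (at z)"
      unfolding g_def
      by (rule derivative_eq_intros d\<sigma>[OF zG] yd[OF zG \<kappa>] refl)+
         (use \<sigma>0[of z] in \<open>simp add: c0_def c2_def field_simps power2_eq_square\<close>)
    let ?g = "g z \<kappa>" and ?D = "1 - A0 z * g z \<kappa>"
    have Fd: "((\<lambda>z. F z \<kappa>) has_field_derivative
       f' z + (\<kappa> * ?g + n0 z \<kappa> + (c1 z \<kappa> - 2 * a' z * F0 z) * ?g + \<mu> z \<kappa> * ?g\<^sup>2 + a' z * ?g\<^sup>2) / ?D\<^sup>2) (at z)"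
      unfolding F_def
      by (rule derivative_eq_intros dA[OF zG] dF[OF zG] gd refl n0')+
         (use n0' in \<open>simp add: power2_eq_square, simp add: algebra_simps\<close>)
    have aux: "(f' z + X / ?D\<^sup>2) * ?D\<^sup>2 = f' z * ?D\<^sup>2 + X" for X
      using n0' by (simp add: distrib_right)
    have FD: "F z \<kappa> * ?D = F0 z + ?g * \<psi> z"
      unfolding F_def using n0' by (simp add: \<psi>_def field_simps)
    have eqA: "\<kappa> * A z \<kappa> = \<kappa> * A0 z + A1 z \<kappa>" "\<kappa> * B z \<kappa> = \<kappa> * B0 z + B1 z \<kappa>" "\<kappa> * C z \<kappa> = \<kappa> * C0 z + C1 z \<kappa>"
      by (simp_all add: A1_def B1_def C1_def algebra_simps)
    have "(\<kappa> * (A z \<kappa> * (F z \<kappa>)\<^sup>2 + B z \<kappa> * F z \<kappa> + C z \<kappa>)) * ?D\<^sup>2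
        = (\<kappa> * A z \<kappa>) * (F z \<kappa> * ?D)\<^sup>2 + (\<kappa> * B z \<kappa>) * (F z \<kappa> * ?D) * ?D + (\<kappa> * C z \<kappa>) * ?D\<^sup>2"
      by (simp add: power2_eq_square algebra_simps)
    also have "\<dots> = f' z * ?D\<^sup>2 + (\<kappa> * ?g + n0 z \<kappa> + (c1 z \<kappa> - 2 * a' z * F0 z) * ?g + \<mu> z \<kappa> * ?g\<^sup>2 + a' z * ?g\<^sup>2)"
      unfolding FD eqA B0[OF zG] C0[OF zG] n0_def c1_def \<mu>_def \<psi>'_def \<psi>_def
      by (simp add: power2_eq_square algebra_simps)
    also have "\<dots> = (f' z + (\<kappa> * ?g + n0 z \<kappa> + (c1 z \<kappa> - 2 * a' z * F0 z) * ?g + \<mu> z \<kappa> * ?g\<^sup>2 + a' z * ?g\<^sup>2) / ?D\<^sup>2) * ?D\<^sup>2"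
      by (rule aux[symmetric])
    finally have "\<kappa> * (A z \<kappa> * (F z \<kappa>)\<^sup>2 + B z \<kappa> * F z \<kappa> + C z \<kappa>)
       = f' z + (\<kappa> * ?g + n0 z \<kappa> + (c1 z \<kappa> - 2 * a' z * F0 z) * ?g + \<mu> z \<kappa> * ?g\<^sup>2 + a' z * ?g\<^sup>2) / ?D\<^sup>2"
      using n0' by simp
    then show "deriv (\<lambda>z. F z \<kappa>) z = \<kappa> * (A z \<kappa> * (F z \<kappa>)\<^sup>2 + B z \<kappa> * F z \<kappa> + C z \<kappa>)"
      using DERIV_imp_deriv[OF Fd] by simp
  qed
qed

section \<open>Gevrey estimates by recursion\<close>

text \<open>Each of the \<open>n - 1\<close> terms is at most \<open>(n - 1)!\<close>.\<close>

lemma sum_fact_mult_fact_le: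
  assumes "n \<ge> 1"
  shows "(\<Sum>k = 1..<n. fact k * fact (n - k) :: real) \<le> fact n"
proof -
  have "(\<Sum>k = 1..<n. fact k * fact (n - k) :: real) \<le> (\<Sum>k = 1..<n. fact (n - 1))"
  proof (rule sum_mono)
    fix k assume k: "k \<in> {1..<n}"
    define i where "i = n - 1 - k"
    have n: "n = k + i + 1" using k by (auto simp: i_def)
    have "fact k * fact (i + 1) \<le> (fact (k + i) :: nat)"
    proof (induction i)
      case (Suc i)
      have "fact k * fact (Suc i + 1) = (i + 2) * (fact k * fact (i + 1) :: nat)" by (simp add: algebra_simps)
      also have "\<dots> \<le> (k + Suc i) * fact (k + i)" using Suc k by (intro mult_mono) auto
      also have "\<dots> = fact (k + Suc i)" by simp
      finally show ?case .
    qed simp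
    then have "(fact k * fact (n - k) :: nat) \<le> fact (n - 1)" by (simp add: n)
    then show "(fact k * fact (n - k) :: real) \<le> fact (n - 1)"
      by (metis of_nat_fact of_nat_le_iff of_nat_mult)
  qed
  also have "\<dots> = real (n - 1) * fact (n - 1)" by simp
  also have "\<dots> \<le> real n * fact (n - 1)" by (intro mult_right_mono) auto
  also have "\<dots> = fact n" using assms by (simp add: fact_reduce)
  finally show ?thesis .
qed

text \<open>The remainder of order \<open>n\<close> of a product, where \<open>g\<close> lists the coefficients of the first
  factor, \<open>r\<close> is its remainder of order \<open>n\<close>, and \<open>h\<close> lists the remainders of the second factor
  (so that \<open>h 0\<close> is its value). Taking coefficients for remainders gives the coefficients of
  the product, which allows one recursion to cover both.\<close>

definition conv_rem :: "(nat \<Rightarrow> complex) \<Rightarrow> complex \<Rightarrow> (nat \<Rightarrow> complex) \<Rightarrow> nat \<Rightarrow> complex" where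
  "conv_rem g r h n = (\<Sum>k<n. g k * h (n - k)) + r * h 0"

text \<open>The sum omits both ends, and the bounds have \<open>B\<close> to the power \<open>k - 1\<close> rather than \<open>k\<close>; so the
  result carries one power of \<open>B\<close> less than the bound for a single term of order \<open>n\<close>. This gain is
  what closes the recursion below for large \<open>B\<close>.\<close>

lemma Gevrey_convolution_bound:
  fixes g h :: "nat \<Rightarrow> complex" and D1 D2 B \<delta> :: real
  assumes n: "n \<ge> 1" and B: "B \<ge> 0" "\<delta> > 0" "D1 \<ge> 0" "D2 \<ge> 0"
    and g: "\<And>k. 1 \<le> k \<Longrightarrow> k < n \<Longrightarrow> norm (g k) \<le> D1 * B ^ (k - 1) * fact k / \<delta> ^ k"
    and h: "\<And>k. 1 \<le> k \<Longrightarrow> k < n \<Longrightarrow> norm (h k) \<le> D2 * B ^ (k - 1) * fact k / \<delta> ^ k"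
  shows "norm (\<Sum>k = 1..<n. g k * h (n - k)) \<le> D1 * D2 * B ^ (n - 2) * fact n / \<delta> ^ n"
proof -
  have "norm (\<Sum>k = 1..<n. g k * h (n - k)) \<le> (\<Sum>k = 1..<n. D1 * D2 * B ^ (n - 2) / \<delta> ^ n * (fact k * fact (n - k)))"
  proof (rule sum_norm_le)
    fix k assume k: "k \<in> {1..<n}"
    have "norm (g k * h (n - k)) \<le> (D1 * B ^ (k - 1) * fact k / \<delta> ^ k) * (D2 * B ^ (n - k - 1) * fact (n - k) / \<delta> ^ (n - k))"
      unfolding norm_mult using g[of k] h[of "n - k"] k B by (intro mult_mono) auto
    also have "\<dots> = D1 * D2 * (B ^ (k - 1) * B ^ (n - k - 1)) / (\<delta> ^ k * \<delta> ^ (n - k)) * (fact k * fact (n - k))"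
      by simp
    also have "B ^ (k - 1) * B ^ (n - k - 1) = B ^ (n - 2)"
      using k by (simp add: power_add[symmetric])
    also have "\<delta> ^ k * \<delta> ^ (n - k) = \<delta> ^ n" using k by (simp add: power_add[symmetric])
    finally show "norm (g k * h (n - k)) \<le> D1 * D2 * B ^ (n - 2) / \<delta> ^ n * (fact k * fact (n - k))" .
  qed
  also have "\<dots> = D1 * D2 * B ^ (n - 2) / \<delta> ^ n * (\<Sum>k = 1..<n. fact k * fact (n - k))"
    by (simp add: sum_distrib_left)
  also have "\<dots> \<le> D1 * D2 * B ^ (n - 2) / \<delta> ^ n * fact n"
    using sum_fact_mult_fact_le[OF n] B by (intro mult_left_mono) auto
  finally show ?thesis by simp
qed

lemma sum_lessThan_split_first: "n \<ge> 1 \<Longrightarrow> (\<Sum>k<n. f k) = f 0 + (\<Sum>k=1..<n. f k)"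
  for f :: "nat \<Rightarrow> 'a::comm_monoid_add"
  by (simp add: sum.atLeast_Suc_lessThan[of 0 n f] lessThan_atLeast0)

lemma one_plus_inverse_power_le_3: "(real (Suc m) / real m) ^ m \<le> 3" if "m \<ge> 1"
proof -
  have "(real (Suc m) / real m) ^ m = (1 + 1 / real m) ^ m" using that by (simp add: field_simps)
  also have "\<dots> \<le> exp 1" using exp_ge_one_plus_x_over_n_power_n[of m 1] that by simp
  also have "\<dots> \<le> 3" by (rule exp_le)
  finally show ?thesis .
qed

text \<open>The unknown \<open>y n\<close> occurs in the recursion only through the term of index 0, with the factor
  \<open>a 0 (f 0 + y 0) + b 0 = 1 + a 0 (y 0 - f 0)\<close>, which is at least \<open>1 / 2\<close> in modulus. Everything
  else is a convolution without its end terms, a derivative, or a remainder of a coefficient,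
  and for \<open>n \<ge> 2\<close> carries at most \<open>B\<close> to the power \<open>n - 2\<close>.\<close>

lemma Gevrey_recursion_step:
  fixes a b ra rb rc f y :: "nat \<Rightarrow> complex" and y' :: complex
  assumes n: "n \<ge> 1" and \<delta>: "0 < \<delta>" "\<delta> \<le> 1"
    and K0: "K0 \<ge> 0" and CM: "C \<ge> 0" "M \<ge> 0" and D: "D \<ge> 0" and B: "B \<ge> 1" "B \<ge> M"
    and D1: "D \<ge> 2 * (K0 + C * M * (K0\<^sup>2 + K0 + 1))"
    and DB: "D * B \<ge> 2 * (3 * D + C * D\<^sup>2 + C * M * (2 * K0 + D) * D + C * M * D + C * M\<^sup>2 * (K0\<^sup>2 + K0 + 1))"
    and a: "\<And>k. norm (a k) \<le> C * M ^ k * fact k" and b: "\<And>k. norm (b k) \<le> C * M ^ k * fact k"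
    and ra: "norm (ra n) \<le> C * M ^ n * fact n" and rb: "norm (rb n) \<le> C * M ^ n * fact n"
    and rc: "norm (rc n) \<le> C * M ^ n * fact n"
    and f0: "norm (f 0) \<le> K0" and y0: "norm (y 0) \<le> K0"
    and f: "\<And>k. 1 \<le> k \<Longrightarrow> k < n \<Longrightarrow> norm (f k) \<le> D * B ^ (k - 1) * fact k / \<delta> ^ k"
    and y: "\<And>k. 1 \<le> k \<Longrightarrow> k < n \<Longrightarrow> norm (y k) \<le> D * B ^ (k - 1) * fact k / \<delta> ^ k"
    and y'1: "n = 1 \<Longrightarrow> norm y' \<le> K0 / \<delta>"
    and y'2: "n \<ge> 2 \<Longrightarrow> norm y' \<le> 3 * D * B ^ (n - 2) * fact n / \<delta> ^ n"
    and lin: "2 * a 0 * f 0 + b 0 = 1" and sm: "norm (a 0 * (y 0 - f 0)) \<le> 1 / 2"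
    and rec: "y' = (\<Sum>k<n. a k * conv_rem f (y (n - k)) y (n - k)) + ra n * (y 0)\<^sup>2
       + (\<Sum>k<n. b k * y (n - k)) + rb n * y 0 + rc n"
  shows "norm (y n) \<le> D * B ^ (n - 1) * fact n / \<delta> ^ n"
proof -
  define E where "E = a 0 * (\<Sum>k=1..<n. f k * y (n - k)) + (\<Sum>k=1..<n. a k * conv_rem f (y (n - k)) y (n - k))
     + (\<Sum>k=1..<n. b k * y (n - k)) + (ra n * (y 0)\<^sup>2 + rb n * y 0 + rc n)"
  have "y' = y n * (2 * a 0 * f 0 + b 0 + a 0 * (y 0 - f 0)) + E"
    unfolding rec E_def sum_lessThan_split_first[OF n, of "\<lambda>k. a k * conv_rem f (y (n - k)) y (n - k)"]
      sum_lessThan_split_first[OF n, of "\<lambda>k. b k * y (n - k)"]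
    by (simp add: conv_rem_def[of f "y n"] sum_lessThan_split_first[OF n, of "\<lambda>k. f k * y (n - k)"] algebra_simps power2_eq_square)
  then have yn: "y n * (1 + a 0 * (y 0 - f 0)) = y' - E" by (simp add: lin)
  have half: "norm (y n) \<le> 2 * (norm y' + norm E)"
  proof -
    have "1 / 2 \<le> norm (1 + a 0 * (y 0 - f 0))"
      using norm_diff_ineq[of 1 "a 0 * (y 0 - f 0)"] sm by simp
    then have "norm (y n) * (1 / 2) \<le> norm (y n) * norm (1 + a 0 * (y 0 - f 0))" by (intro mult_left_mono) auto
    also have "\<dots> = norm (y' - E)" by (simp add: yn norm_mult[symmetric])
    also have "\<dots> \<le> norm y' + norm E" by (rule norm_triangle_ineq4)
    finally show ?thesis by simp
  qed
  have S4: "norm (ra n * (y 0)\<^sup>2 + rb n * y 0 + rc n) \<le> C * M ^ n * fact n * (K0\<^sup>2 + K0 + 1)"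
  proof -
    have "norm (ra n * (y 0)\<^sup>2 + rb n * y 0 + rc n) \<le> norm (ra n) * norm (y 0) ^ 2 + norm (rb n) * norm (y 0) + norm (rc n)"
      by (intro order.trans[OF norm_triangle_ineq] add_mono) (auto simp: norm_mult norm_power)
    also have "\<dots> \<le> C * M ^ n * fact n * K0\<^sup>2 + C * M ^ n * fact n * K0 + C * M ^ n * fact n"
      using ra rb rc y0 CM K0 by (intro add_mono mult_mono power_mono) auto
    finally show ?thesis by (simp add: algebra_simps)
  qed
  show ?thesis
  proof (cases "n = 1")
    case True
    have "norm E \<le> C * M * (K0\<^sup>2 + K0 + 1)" using S4 True by (simp add: E_def)
    also have "\<dots> \<le> C * M * (K0\<^sup>2 + K0 + 1) / \<delta>"
    proof -
      have "0 \<le> C * M * (K0\<^sup>2 + K0 + 1)" using CM K0 by simp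
      then show ?thesis using \<delta> by (simp add: le_divide_eq mult_left_le)
    qed
    finally have "2 * (norm y' + norm E) \<le> 2 * (K0 / \<delta> + C * M * (K0\<^sup>2 + K0 + 1) / \<delta>)"
      using y'1[OF True] by (intro mult_left_mono add_mono) auto
    with half have "norm (y n) \<le> 2 * (K0 / \<delta> + C * M * (K0\<^sup>2 + K0 + 1) / \<delta>)" by (rule order.trans)
    also have "\<dots> = 2 * (K0 + C * M * (K0\<^sup>2 + K0 + 1)) / \<delta>" by (simp add: add_divide_distrib)
    also have "\<dots> \<le> D / \<delta>" using D1 \<delta> by (intro divide_right_mono) auto
    finally show ?thesis using True by simp
  next
    case False
    then have n2: "n \<ge> 2" using n by simp
    define u where "u = B ^ (n - 2) * fact n / \<delta> ^ n"
    have u: "u \<ge> 0" using B \<delta> by (simp add: u_def)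
    have Mk: "C * M ^ k * fact k \<le> C * M * B ^ (k - 1) * fact k / \<delta> ^ k" if "k \<ge> 1" for k
    proof -
      have "M ^ k = M * M ^ (k - 1)" using that by (simp add: power_eq_if)
      also have "\<dots> \<le> M * B ^ (k - 1)" using B CM by (intro mult_left_mono power_mono) auto
      finally have "C * M ^ k * fact k \<le> C * (M * B ^ (k - 1)) * fact k" using CM
        by (intro mult_right_mono mult_left_mono) auto
      also have "\<dots> \<le> C * (M * B ^ (k - 1)) * fact k / \<delta> ^ k"
      proof -
        have "\<delta> ^ k \<le> 1" using \<delta> by (intro power_le_one) auto
        moreover have "0 \<le> C * (M * B ^ (k - 1)) * fact k" using CM B by simp
        ultimately show ?thesis using \<delta> by (simp add: le_divide_eq mult_left_le)
      qed
      finally show ?thesis by (simp add: mult.assoc)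
    qed
    have T: "norm (conv_rem f (y m) y m) \<le> (2 * K0 + D) * D * B ^ (m - 1) * fact m / \<delta> ^ m"
      if m: "1 \<le> m" "m < n" for m
    proof -
      have "conv_rem f (y m) y m = f 0 * y m + (\<Sum>k=1..<m. f k * y (m - k)) + y m * y 0"
        by (simp add: conv_rem_def sum_lessThan_split_first[OF m(1)])
      also have "norm \<dots> \<le> norm (f 0) * norm (y m) + norm (\<Sum>k=1..<m. f k * y (m - k)) + norm (y m) * norm (y 0)"
        by (intro order.trans[OF norm_triangle_ineq] add_mono) (auto simp: norm_mult)
      also have "\<dots> \<le> K0 * (D * B ^ (m - 1) * fact m / \<delta> ^ m) + D * D * B ^ (m - 1) * fact m / \<delta> ^ m
           + (D * B ^ (m - 1) * fact m / \<delta> ^ m) * K0"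
      proof (intro add_mono mult_mono)
        have "norm (\<Sum>k=1..<m. f k * y (m - k)) \<le> D * D * B ^ (m - 2) * fact m / \<delta> ^ m"
          by (rule Gevrey_convolution_bound) (use m \<delta> D B f y in auto)
        also have "\<dots> \<le> D * D * B ^ (m - 1) * fact m / \<delta> ^ m"
          using D B \<delta> by (intro divide_right_mono mult_right_mono mult_left_mono power_increasing) auto
        finally show "norm (\<Sum>k=1..<m. f k * y (m - k)) \<le> D * D * B ^ (m - 1) * fact m / \<delta> ^ m" .
      qed (use m f0 y0 K0 y[of m] D B \<delta> in auto)
      finally show ?thesis by (simp add: algebra_simps add_divide_distrib)
    qed
    have S1: "norm (a 0 * (\<Sum>k=1..<n. f k * y (n - k))) \<le> C * D\<^sup>2 * u"
    proof -
      have "norm (\<Sum>k=1..<n. f k * y (n - k)) \<le> D * D * B ^ (n - 2) * fact n / \<delta> ^ n"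
        by (rule Gevrey_convolution_bound) (use n \<delta> D B f y in auto)
      moreover have "norm (a 0) \<le> C" using a[of 0] by simp
      ultimately have "norm (a 0 * (\<Sum>k=1..<n. f k * y (n - k))) \<le> C * (D * D * B ^ (n - 2) * fact n / \<delta> ^ n)"
        unfolding norm_mult using CM by (intro mult_mono) auto
      then show ?thesis by (simp add: u_def power2_eq_square mult.assoc)
    qed
    have S2: "norm (\<Sum>k=1..<n. a k * conv_rem f (y (n - k)) y (n - k)) \<le> C * M * (2 * K0 + D) * D * u"
    proof -
      have "norm (\<Sum>k=1..<n. a k * (\<lambda>m. conv_rem f (y m) y m) (n - k)) \<le> (C * M) * ((2 * K0 + D) * D) * B ^ (n - 2) * fact n / \<delta> ^ n"
      proof (rule Gevrey_convolution_bound)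
        fix k assume "1 \<le> k" "k < n"
        show "norm (a k) \<le> C * M * B ^ (k - 1) * fact k / \<delta> ^ k" using a[of k] Mk[OF \<open>1 \<le> k\<close>] by linarith
        show "norm (conv_rem f (y k) y k) \<le> (2 * K0 + D) * D * B ^ (k - 1) * fact k / \<delta> ^ k" by (rule T) fact+
      qed (use n \<delta> D B CM K0 in auto)
      then show ?thesis by (simp add: u_def mult.assoc)
    qed
    have S3: "norm (\<Sum>k=1..<n. b k * y (n - k)) \<le> C * M * D * u"
    proof -
      have "norm (\<Sum>k=1..<n. b k * y (n - k)) \<le> (C * M) * D * B ^ (n - 2) * fact n / \<delta> ^ n"
      proof (rule Gevrey_convolution_bound)
        fix k assume "1 \<le> k" "k < n"
        show "norm (b k) \<le> C * M * B ^ (k - 1) * fact k / \<delta> ^ k" using b[of k] Mk[OF \<open>1 \<le> k\<close>] by linarith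
      qed (use n \<delta> D B CM y in auto)
      then show ?thesis by (simp add: u_def mult.assoc)
    qed
    have "C * M ^ n * fact n \<le> C * M\<^sup>2 * u"
    proof -
      have "M ^ n = M\<^sup>2 * M ^ (n - 2)" using n2 by (metis le_add_diff_inverse power_add)
      also have "\<dots> \<le> M\<^sup>2 * B ^ (n - 2)" using B CM by (intro mult_left_mono power_mono) auto
      finally have "C * M ^ n * fact n \<le> C * (M\<^sup>2 * B ^ (n - 2)) * fact n" using CM
        by (intro mult_right_mono mult_left_mono) auto
      also have "\<dots> \<le> C * (M\<^sup>2 * B ^ (n - 2)) * fact n / \<delta> ^ n"
      proof -
        have "\<delta> ^ n \<le> 1" using \<delta> by (intro power_le_one) auto
        moreover have "0 \<le> C * (M\<^sup>2 * B ^ (n - 2)) * fact n" using CM B by simp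
        ultimately show ?thesis using \<delta> by (simp add: le_divide_eq mult_left_le)
      qed
      finally show ?thesis by (simp add: u_def mult.assoc)
    qed
    then have "C * M ^ n * fact n * (K0\<^sup>2 + K0 + 1) \<le> C * M\<^sup>2 * u * (K0\<^sup>2 + K0 + 1)"
      using K0 by (intro mult_right_mono) auto
    with S4 have S4': "norm (ra n * (y 0)\<^sup>2 + rb n * y 0 + rc n) \<le> C * M\<^sup>2 * u * (K0\<^sup>2 + K0 + 1)" by linarith
    have "norm E \<le> norm (a 0 * (\<Sum>k=1..<n. f k * y (n - k))) + norm (\<Sum>k=1..<n. a k * conv_rem f (y (n - k)) y (n - k))
      + norm (\<Sum>k=1..<n. b k * y (n - k)) + norm (ra n * (y 0)\<^sup>2 + rb n * y 0 + rc n)"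
      unfolding E_def by (intro order.trans[OF norm_triangle_ineq] add_mono order_refl)
    also have "\<dots> \<le> C * D\<^sup>2 * u + C * M * (2 * K0 + D) * D * u + C * M * D * u + C * M\<^sup>2 * u * (K0\<^sup>2 + K0 + 1)"
      by (intro add_mono S1 S2 S3 S4')
    finally have "2 * (norm y' + norm E) \<le> 2 * (3 * D * u + (C * D\<^sup>2 * u + C * M * (2 * K0 + D) * D * u + C * M * D * u + C * M\<^sup>2 * u * (K0\<^sup>2 + K0 + 1)))"
      using y'2[OF n2] by (simp add: u_def mult.assoc)
    also have "\<dots> = 2 * (3 * D + C * D\<^sup>2 + C * M * (2 * K0 + D) * D + C * M * D + C * M\<^sup>2 * (K0\<^sup>2 + K0 + 1)) * u"
      by (simp add: algebra_simps)
    also have "\<dots> \<le> D * B * u" using DB u by (intro mult_right_mono) auto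
    also have "\<dots> = D * (B * B ^ (n - 2)) * fact n / \<delta> ^ n" by (simp add: u_def)
    also have "B * B ^ (n - 2) = B ^ (n - 1)" using n2
      by (metis Suc_1 Suc_diff_Suc Suc_le_eq power_Suc diff_Suc_Suc diff_Suc_1 One_nat_def)
    finally show ?thesis using half by linarith
  qed
qed

text \<open>The hypothesis on \<open>f\<close> says that the bounds for \<open>y\<close> below order \<open>n\<close> entail those for \<open>f\<close>. It is
  trivial for \<open>f = y\<close>, which is how the coefficients themselves are estimated, and it is trivial
  when the bounds for \<open>f\<close> are known, which is how the remainders are estimated afterwards.\<close>

lemma Gevrey_recursion_bound:
  fixes a b ra rb rc f y :: "nat \<Rightarrow> complex \<Rightarrow> complex" and U :: "complex set"
  assumes U: "open U" and K0: "K0 \<ge> 0" and CM: "C \<ge> 0" "M \<ge> 0" and D: "D \<ge> 0" and B: "B \<ge> 1" "B \<ge> M"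
    and D1: "D \<ge> 2 * (K0 + C * M * (K0\<^sup>2 + K0 + 1))"
    and DB: "D * B \<ge> 2 * (3 * D + C * D\<^sup>2 + C * M * (2 * K0 + D) * D + C * M * D + C * M\<^sup>2 * (K0\<^sup>2 + K0 + 1))"
    and a: "\<And>k z. z \<in> U \<Longrightarrow> norm (a k z) \<le> C * M ^ k * fact k"
    and b: "\<And>k z. z \<in> U \<Longrightarrow> norm (b k z) \<le> C * M ^ k * fact k"
    and ra: "\<And>k z. z \<in> U \<Longrightarrow> norm (ra k z) \<le> C * M ^ k * fact k"
    and rb: "\<And>k z. z \<in> U \<Longrightarrow> norm (rb k z) \<le> C * M ^ k * fact k"
    and rc: "\<And>k z. z \<in> U \<Longrightarrow> norm (rc k z) \<le> C * M ^ k * fact k"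
    and f0: "\<And>z. z \<in> U \<Longrightarrow> norm (f 0 z) \<le> K0" and y0: "\<And>z. z \<in> U \<Longrightarrow> norm (y 0 z) \<le> K0"
    and yh: "\<And>n. y n holomorphic_on U"
    and f: "\<And>n. (\<And>k z \<delta>. 1 \<le> k \<Longrightarrow> k < n \<Longrightarrow> 0 < \<delta> \<Longrightarrow> \<delta> \<le> 1 \<Longrightarrow> cball z \<delta> \<subseteq> U \<Longrightarrow>
         norm (y k z) \<le> D * B ^ (k - 1) * fact k / \<delta> ^ k) \<Longrightarrow>
       (\<And>k z \<delta>. 1 \<le> k \<Longrightarrow> k < n \<Longrightarrow> 0 < \<delta> \<Longrightarrow> \<delta> \<le> 1 \<Longrightarrow> cball z \<delta> \<subseteq> U \<Longrightarrow>
         norm (f k z) \<le> D * B ^ (k - 1) * fact k / \<delta> ^ k)"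
    and lin: "\<And>z. z \<in> U \<Longrightarrow> 2 * a 0 z * f 0 z + b 0 z = 1"
    and sm: "\<And>z. z \<in> U \<Longrightarrow> norm (a 0 z * (y 0 z - f 0 z)) \<le> 1 / 2"
    and rec: "\<And>n z. n \<ge> 1 \<Longrightarrow> z \<in> U \<Longrightarrow> deriv (y (n - 1)) z =
       (\<Sum>k<n. a k z * conv_rem (\<lambda>k. f k z) (y (n - k) z) (\<lambda>k. y k z) (n - k)) + ra n z * (y 0 z)\<^sup>2
       + (\<Sum>k<n. b k z * y (n - k) z) + rb n z * y 0 z + rc n z"
    and n: "n \<ge> 1" and \<delta>: "0 < \<delta>" "\<delta> \<le> 1" "cball z \<delta> \<subseteq> U"
  shows "norm (y n z) \<le> D * B ^ (n - 1) * fact n / \<delta> ^ n"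
  using n \<delta>
proof (induction n arbitrary: z \<delta> rule: less_induct)
  case (less n)
  have IH: "norm (y k z) \<le> D * B ^ (k - 1) * fact k / \<delta> ^ k"
    if "1 \<le> k" "k < n" "0 < \<delta>" "\<delta> \<le> 1" "cball z \<delta> \<subseteq> U" for k z \<delta>
    using less.IH that by blast
  have zU: "z \<in> U" using less.prems by auto
  show ?case
  proof (rule Gevrey_recursion_step[where a = "\<lambda>k. a k z" and b = "\<lambda>k. b k z" and ra = "\<lambda>k. ra k z" and rb = "\<lambda>k. rb k z"
        and rc = "\<lambda>k. rc k z" and f = "\<lambda>k. f k z" and y = "\<lambda>k. y k z" and y' = "deriv (y (n - 1)) z"])
    show "D * B \<ge> 2 * (3 * D + C * D\<^sup>2 + C * M * (2 * K0 + D) * D + C * M * D + C * M\<^sup>2 * (K0\<^sup>2 + K0 + 1))" by (rule DB)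
    show "norm (deriv (y (n - 1)) z) \<le> K0 / \<delta>" if "n = 1"
      by (rule norm_deriv_le_Cauchy[OF yh less.prems(4) U less.prems(2)])
         (use that y0 less.prems(4) in auto)
    show "norm (f k z) \<le> D * B ^ (k - 1) * fact k / \<delta> ^ k" if "1 \<le> k" "k < n" for k
      by (rule f[OF IH]) (use that less.prems in auto)
    show "norm (deriv (y (n - 1)) z) \<le> 3 * D * B ^ (n - 2) * fact n / \<delta> ^ n" if n2: "n \<ge> 2"
    proof -
      define m where "m = n - 1"
      have m: "m \<ge> 1" "n = Suc m" using n2 by (auto simp: m_def)
      define d where "d = \<delta> * real m / real n"
      have d: "0 < d" "d \<le> 1"
      proof -
        show "0 < d" using less.prems m by (simp add: d_def)
        have "\<delta> * real m \<le> 1 * real n" using less.prems m by (intro mult_mono) auto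
        then show "d \<le> 1" using m by (simp add: d_def field_simps)
      qed
      have e: "\<delta> / real n + d = \<delta>"
      proof -
        have "\<delta> / real n + d = (\<delta> + \<delta> * real m) / real n" by (simp add: d_def add_divide_distrib)
        also have "\<delta> + \<delta> * real m = \<delta> * real n" by (simp add: m algebra_simps)
        finally show ?thesis using m by simp
      qed
      define Q where "Q = D * B ^ (m - 1) * fact m / d ^ m"
      have "norm (deriv (y m) z) \<le> Q / (\<delta> / real n)"
      proof (rule norm_deriv_le_Cauchy[OF yh _ U])
        show "cball z (\<delta> / real n) \<subseteq> U"
          using less.prems e d by (intro order.trans[OF subset_cball less.prems(4)]) auto
        show "0 < \<delta> / real n" using less.prems m by simp
        fix w assume w: "w \<in> cball z (\<delta> / real n)"
        have "cball w d \<subseteq> cball z \<delta>"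
        proof
          fix v assume "v \<in> cball w d"
          then show "v \<in> cball z \<delta>" using w e dist_triangle[of z v w] by simp
        qed
        then show "norm (y m w) \<le> Q" unfolding Q_def
          using m d less.prems by (intro IH) auto
      qed
      also have "\<dots> \<le> 3 * D * B ^ (n - 2) * fact n / \<delta> ^ n"
      proof -
        have dm: "1 / d ^ m = (real (Suc m) / real m) ^ m / \<delta> ^ m"
          using m less.prems by (simp add: d_def power_divide power_mult_distrib field_simps)
        have "Q = D * B ^ (m - 1) * fact m * (1 / d ^ m)" by (simp add: Q_def)
        also have "\<dots> \<le> D * B ^ (m - 1) * fact m * (3 / \<delta> ^ m)"
          unfolding dm using one_plus_inverse_power_le_3[OF m(1)] D B less.prems
          by (intro mult_left_mono divide_right_mono) auto
        finally have "Q / (\<delta> / real n) \<le> D * B ^ (m - 1) * fact m * (3 / \<delta> ^ m) / (\<delta> / real n)"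
          using less.prems by (intro divide_right_mono) auto
        also have "\<dots> = 3 * D * B ^ (n - 2) * fact n / \<delta> ^ n"
          using m less.prems by (simp add: field_simps)
        finally show ?thesis .
      qed
      finally show ?thesis by (simp add: m_def)
    qed
  qed (use assms(2-8) a b ra rb rc f0 y0 lin sm rec less.prems zU IH in auto)
qed

text \<open>The remainder of order \<open>n\<close> of an expansion in powers of \<open>1 / \<kappa>\<close>, normalised to be bounded.\<close>

definition scaled_rem :: "complex \<Rightarrow> complex \<Rightarrow> (nat \<Rightarrow> complex) \<Rightarrow> nat \<Rightarrow> complex" where
  "scaled_rem \<kappa> g gs n = \<kappa> ^ n * (g - (\<Sum>k<n. gs k / \<kappa> ^ k))"

lemma scaled_rem_0 [simp]: "scaled_rem \<kappa> g gs 0 = g"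
  by (simp add: scaled_rem_def)

lemma scaled_rem_add:
  "scaled_rem \<kappa> (g + h) (\<lambda>n. gs n + hs n) n = scaled_rem \<kappa> g gs n + scaled_rem \<kappa> h hs n"
  by (simp add: scaled_rem_def sum.distrib add_divide_distrib algebra_simps)

lemma scaled_rem_mult:
  assumes "\<kappa> \<noteq> 0"
  shows "scaled_rem \<kappa> (g * h) (\<lambda>n. \<Sum>k\<le>n. gs k * hs (n - k)) n =
    conv_rem gs (scaled_rem \<kappa> g gs n) (scaled_rem \<kappa> h hs) n"
proof -
  have "(\<Sum>m<n. (\<Sum>k\<le>m. gs k * hs (m - k)) / \<kappa> ^ m) = (\<Sum>m<n. \<Sum>k\<le>m. gs k / \<kappa> ^ k * (hs (m - k) / \<kappa> ^ (m - k)))"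
    unfolding sum_divide_distrib
    by (intro sum.cong refl) (simp add: power_add[symmetric])
  also have "\<dots> = (\<Sum>(k, j)\<in>{(k, j). k + j < n}. gs k / \<kappa> ^ k * (hs j / \<kappa> ^ j))"
    by (rule sum.triangle_reindex[symmetric])
  also have "{(k, j). k + j < n} = (SIGMA k:{..<n}. {..<n - k})" by auto
  also have "(\<Sum>(k, j)\<in>(SIGMA k:{..<n}. {..<n - k}). gs k / \<kappa> ^ k * (hs j / \<kappa> ^ j)) =
      (\<Sum>k<n. gs k / \<kappa> ^ k * (\<Sum>j<n - k. hs j / \<kappa> ^ j))"
    by (simp add: sum.Sigma[symmetric] sum_distrib_left)
  finally have "g * h - (\<Sum>m<n. (\<Sum>k\<le>m. gs k * hs (m - k)) / \<kappa> ^ m)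
     = (g - (\<Sum>k<n. gs k / \<kappa> ^ k)) * h + (\<Sum>k<n. gs k / \<kappa> ^ k * (h - (\<Sum>j<n - k. hs j / \<kappa> ^ j)))"
    by (simp add: algebra_simps sum_subtractf sum_distrib_left sum_distrib_right)
  then have "scaled_rem \<kappa> (g * h) (\<lambda>n. \<Sum>k\<le>n. gs k * hs (n - k)) n =
     scaled_rem \<kappa> g gs n * h + (\<Sum>k<n. \<kappa> ^ n * (gs k / \<kappa> ^ k * (h - (\<Sum>j<n - k. hs j / \<kappa> ^ j))))"
    by (simp add: scaled_rem_def distrib_left sum_distrib_left mult.assoc)
  also have "(\<Sum>k<n. \<kappa> ^ n * (gs k / \<kappa> ^ k * (h - (\<Sum>j<n - k. hs j / \<kappa> ^ j)))) = (\<Sum>k<n. gs k * scaled_rem \<kappa> h hs (n - k))"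
    using assms by (intro sum.cong refl) (simp add: scaled_rem_def power_diff)
  finally show ?thesis by (simp add: conv_rem_def)
qed

lemma conv_rem_self: "conv_rem g (g n) h n = (\<Sum>k\<le>n. g k * h (n - k))"
  by (simp add: conv_rem_def lessThan_Suc_atMost[symmetric])

text \<open>Remainders of order \<open>n\<close> of both sides of the equation \<open>F' / \<kappa> = A F\<^sup>2 + B F + C\<close> give the
  recursion for the remainders of \<open>F\<close>: the left side contributes the derivative of the
  remainder of order \<open>n - 1\<close>.\<close>

lemma Gevrey_expansion_of_Riccati_solution:
  fixes A B C F :: "complex \<Rightarrow> complex \<Rightarrow> complex" and As Bs Cs Fs :: "nat \<Rightarrow> complex \<Rightarrow> complex"
  assumes U: "open U" and H: "0 \<notin> H"
    and Fh: "\<And>\<kappa>. \<kappa> \<in> H \<Longrightarrow> (\<lambda>z. F z \<kappa>) holomorphic_on U" and Fsh: "\<And>k. Fs k holomorphic_on U"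
    and ode: "\<And>z \<kappa>. z \<in> U \<Longrightarrow> \<kappa> \<in> H \<Longrightarrow> deriv (\<lambda>z. F z \<kappa>) z = \<kappa> * (A z \<kappa> * (F z \<kappa>)\<^sup>2 + B z \<kappa> * F z \<kappa> + C z \<kappa>)"
    and formal: "\<And>n z. z \<in> U \<Longrightarrow> (if n = 0 then 0 else deriv (Fs (n - 1)) z) =
        (\<Sum>k\<le>n. As k z * (\<Sum>j\<le>n - k. Fs j z * Fs (n - k - j) z)) + (\<Sum>k\<le>n. Bs k z * Fs (n - k) z) + Cs n z"
    and lin: "\<And>z. z \<in> U \<Longrightarrow> 2 * As 0 z * Fs 0 z + Bs 0 z = 1"
    and CM: "C0 \<ge> 0" "M \<ge> 0" and K0: "K0 \<ge> 0"
    and As: "\<And>k z. z \<in> U \<Longrightarrow> norm (As k z) \<le> C0 * M ^ k * fact k"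
    and Bs: "\<And>k z. z \<in> U \<Longrightarrow> norm (Bs k z) \<le> C0 * M ^ k * fact k"
    and Cs: "\<And>k z. z \<in> U \<Longrightarrow> norm (Cs k z) \<le> C0 * M ^ k * fact k"
    and rA: "\<And>k z \<kappa>. z \<in> U \<Longrightarrow> \<kappa> \<in> H \<Longrightarrow> norm (scaled_rem \<kappa> (A z \<kappa>) (\<lambda>k. As k z) k) \<le> C0 * M ^ k * fact k"
    and rB: "\<And>k z \<kappa>. z \<in> U \<Longrightarrow> \<kappa> \<in> H \<Longrightarrow> norm (scaled_rem \<kappa> (B z \<kappa>) (\<lambda>k. Bs k z) k) \<le> C0 * M ^ k * fact k"
    and rC: "\<And>k z \<kappa>. z \<in> U \<Longrightarrow> \<kappa> \<in> H \<Longrightarrow> norm (scaled_rem \<kappa> (C z \<kappa>) (\<lambda>k. Cs k z) k) \<le> C0 * M ^ k * fact k"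
    and F0: "\<And>z. z \<in> U \<Longrightarrow> norm (Fs 0 z) \<le> K0" and FK: "\<And>z \<kappa>. z \<in> U \<Longrightarrow> \<kappa> \<in> H \<Longrightarrow> norm (F z \<kappa>) \<le> K0"
    and sm: "\<And>z \<kappa>. z \<in> U \<Longrightarrow> \<kappa> \<in> H \<Longrightarrow> norm (As 0 z * (F z \<kappa> - Fs 0 z)) \<le> 1 / 2"
  obtains D Q where "D \<ge> 0" "Q \<ge> 1"
    "\<And>n z \<delta> \<kappa>. n \<ge> 1 \<Longrightarrow> 0 < \<delta> \<Longrightarrow> \<delta> \<le> 1 \<Longrightarrow> cball z \<delta> \<subseteq> U \<Longrightarrow> \<kappa> \<in> H \<Longrightarrow>
       norm (scaled_rem \<kappa> (F z \<kappa>) (\<lambda>k. Fs k z) n) \<le> D * Q ^ (n - 1) * fact n / \<delta> ^ n"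
proof -
  define D where "D = 2 * (K0 + C0 * M * (K0\<^sup>2 + K0 + 1)) + 1"
  define Z where "Z = 2 * (3 * D + C0 * D\<^sup>2 + C0 * M * (2 * K0 + D) * D + C0 * M * D + C0 * M\<^sup>2 * (K0\<^sup>2 + K0 + 1))"
  define Q where "Q = max 1 (max M (Z / D))"
  have D: "D \<ge> 2 * (K0 + C0 * M * (K0\<^sup>2 + K0 + 1))" "D > 0"
    using K0 CM by (auto simp: D_def add_nonneg_pos)
  have Q: "Q \<ge> 1" "Q \<ge> M" by (auto simp: Q_def)
  have "Z / D \<le> Q" by (simp add: Q_def)
  then have DQ: "D * Q \<ge> Z" using D by (simp add: field_simps)
  have fs: "norm (Fs n z) \<le> D * Q ^ (n - 1) * fact n / \<delta> ^ n"
    if "n \<ge> 1" "0 < \<delta>" "\<delta> \<le> 1" "cball z \<delta> \<subseteq> U" for n z \<delta>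
  proof (rule Gevrey_recursion_bound[where y = Fs and f = Fs and a = As and b = Bs and ra = As and rb = Bs and rc = Cs, OF U K0 CM _ Q D(1) DQ[unfolded Z_def]])
    fix n z assume n: "(n::nat) \<ge> 1" and z: "z \<in> U"
    have "deriv (Fs (n - 1)) z = (\<Sum>k\<le>n. As k z * (\<Sum>j\<le>n - k. Fs j z * Fs (n - k - j) z)) + (\<Sum>k\<le>n. Bs k z * Fs (n - k) z) + Cs n z"
      using formal[OF z, of n] n by simp
    then show "deriv (Fs (n - 1)) z =
       (\<Sum>k<n. As k z * conv_rem (\<lambda>k. Fs k z) (Fs (n - k) z) (\<lambda>k. Fs k z) (n - k)) + As n z * (Fs 0 z)\<^sup>2
       + (\<Sum>k<n. Bs k z * Fs (n - k) z) + Bs n z * Fs 0 z + Cs n z"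
      using conv_rem_self[of "\<lambda>k. Fs k z" _ "\<lambda>k. Fs k z"]
      by (simp add: lessThan_Suc_atMost[symmetric] power2_eq_square)
  qed (use that D As Bs Cs F0 Fsh lin in auto)
  show ?thesis
  proof (rule that[of D Q])
    fix n z \<delta> \<kappa> assume n: "(n::nat) \<ge> 1" and \<delta>: "0 < (\<delta>::real)" "\<delta> \<le> 1" "cball z \<delta> \<subseteq> U" and \<kappa>: "\<kappa> \<in> H"
    have nz: "\<kappa> \<noteq> 0" using H \<kappa> by auto
    define y where "y = (\<lambda>n z. scaled_rem \<kappa> (F z \<kappa>) (\<lambda>k. Fs k z) n)"
    have yh: "y n holomorphic_on U" for n
      unfolding y_def scaled_rem_def using nz by (intro holomorphic_intros Fh \<kappa> Fsh) auto
    have "norm (y n z) \<le> D * Q ^ (n - 1) * fact n / \<delta> ^ n"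
    proof (rule Gevrey_recursion_bound[where y = y and f = Fs and a = As and b = Bs and
          ra = "\<lambda>n z. scaled_rem \<kappa> (A z \<kappa>) (\<lambda>k. As k z) n" and rb = "\<lambda>n z. scaled_rem \<kappa> (B z \<kappa>) (\<lambda>k. Bs k z) n"
          and rc = "\<lambda>n z. scaled_rem \<kappa> (C z \<kappa>) (\<lambda>k. Cs k z) n", OF U K0 CM _ Q D(1) DQ[unfolded Z_def]])
      fix n z assume n: "(n::nat) \<ge> 1" and z: "z \<in> U"
      define G where "G = (\<lambda>n. (\<Sum>k\<le>n. As k z * (\<Sum>j\<le>n - k. Fs j z * Fs (n - k - j) z)) + (\<Sum>k\<le>n. Bs k z * Fs (n - k) z) + Cs n z)"
      have G0: "G 0 = 0" and GS: "G (Suc k) = deriv (Fs k) z" for k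
        using formal[OF z, of 0] formal[OF z, of "Suc k"] unfolding G_def by simp_all
      obtain m where m: "n = Suc m" using n by (cases n) auto
      have dF: "((\<lambda>z. F z \<kappa>) has_field_derivative \<kappa> * (A z \<kappa> * (F z \<kappa>)\<^sup>2 + B z \<kappa> * F z \<kappa> + C z \<kappa>)) (at z)"
        using holomorphic_derivI[OF Fh[OF \<kappa>] U z] ode[OF z \<kappa>] by simp
      have dFs: "(Fs k has_field_derivative G (Suc k)) (at z)" for k
        using holomorphic_derivI[OF Fsh U z] GS by simp
      have "deriv (y (n - 1)) z = \<kappa> ^ m * (\<kappa> * (A z \<kappa> * (F z \<kappa>)\<^sup>2 + B z \<kappa> * F z \<kappa> + C z \<kappa>) - (\<Sum>k<m. G (Suc k) / \<kappa> ^ k))"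
        unfolding y_def scaled_rem_def m
        by (rule DERIV_imp_deriv) (auto intro!: derivative_eq_intros dF dFs simp: nz)
      also have "\<dots> = scaled_rem \<kappa> (A z \<kappa> * (F z \<kappa>)\<^sup>2 + B z \<kappa> * F z \<kappa> + C z \<kappa>) G n"
      proof -
        have "(\<Sum>k<Suc m. G k / \<kappa> ^ k) = (\<Sum>k<m. G (Suc k) / \<kappa> ^ k) / \<kappa>"
          unfolding sum.lessThan_Suc_shift sum_divide_distrib by (simp add: G0 mult.commute)
        then show ?thesis using nz by (simp add: scaled_rem_def m algebra_simps)
      qed
      also have "\<dots> = scaled_rem \<kappa> (A z \<kappa> * (F z \<kappa> * F z \<kappa>)) (\<lambda>n. \<Sum>k\<le>n. As k z * (\<lambda>m. \<Sum>j\<le>m. Fs j z * Fs (m - j) z) (n - k)) n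
          + scaled_rem \<kappa> (B z \<kappa> * F z \<kappa>) (\<lambda>n. \<Sum>k\<le>n. Bs k z * Fs (n - k) z) n + scaled_rem \<kappa> (C z \<kappa>) (\<lambda>k. Cs k z) n"
        unfolding scaled_rem_add[symmetric] by (simp add: G_def power2_eq_square)
      also have "scaled_rem \<kappa> (A z \<kappa> * (F z \<kappa> * F z \<kappa>)) (\<lambda>n. \<Sum>k\<le>n. As k z * (\<lambda>m. \<Sum>j\<le>m. Fs j z * Fs (m - j) z) (n - k)) n
         = (\<Sum>k<n. As k z * conv_rem (\<lambda>k. Fs k z) (y (n - k) z) (\<lambda>k. y k z) (n - k)) + scaled_rem \<kappa> (A z \<kappa>) (\<lambda>k. As k z) n * (y 0 z)\<^sup>2"
        unfolding scaled_rem_mult[OF nz, of "A z \<kappa>" "F z \<kappa> * F z \<kappa>" "\<lambda>k. As k z" "\<lambda>m. \<Sum>j\<le>m. Fs j z * Fs (m - j) z" n]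
        by (simp add: conv_rem_def[of "\<lambda>k. As k z"] y_def power2_eq_square
            scaled_rem_mult[OF nz, of "F z \<kappa>" "F z \<kappa>" "\<lambda>k. Fs k z" "\<lambda>k. Fs k z"] del: diff_diff_left)
      also have "scaled_rem \<kappa> (B z \<kappa> * F z \<kappa>) (\<lambda>n. \<Sum>k\<le>n. Bs k z * Fs (n - k) z) n
         = (\<Sum>k<n. Bs k z * y (n - k) z) + scaled_rem \<kappa> (B z \<kappa>) (\<lambda>k. Bs k z) n * y 0 z"
        unfolding scaled_rem_mult[OF nz, of "B z \<kappa>" "F z \<kappa>" "\<lambda>k. Bs k z" "\<lambda>k. Fs k z" n]
        by (simp add: conv_rem_def y_def)
      finally show "deriv (y (n - 1)) z =
       (\<Sum>k<n. As k z * conv_rem (\<lambda>k. Fs k z) (y (n - k) z) (\<lambda>k. y k z) (n - k)) + scaled_rem \<kappa> (A z \<kappa>) (\<lambda>k. As k z) n * (y 0 z)\<^sup>2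
       + (\<Sum>k<n. Bs k z * y (n - k) z) + scaled_rem \<kappa> (B z \<kappa>) (\<lambda>k. Bs k z) n * y 0 z + scaled_rem \<kappa> (C z \<kappa>) (\<lambda>k. Cs k z) n"
        by simp
    next
      show "norm (y 0 z) \<le> K0" if "z \<in> U" for z using FK[OF that \<kappa>] by (simp add: y_def)
      show "norm (As 0 z * (y 0 z - Fs 0 z)) \<le> 1 / 2" if "z \<in> U" for z using sm[OF that \<kappa>] by (simp add: y_def)
    qed (use n \<delta> \<kappa> D As Bs rA rB rC F0 lin yh fs in auto)
    then show "norm (scaled_rem \<kappa> (F z \<kappa>) (\<lambda>k. Fs k z) n) \<le> D * Q ^ (n - 1) * fact n / \<delta> ^ n" by (simp add: y_def)
  qed (use D Q in auto)
qed

section \<open>Borel discs\<close>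

lemma borel_disc_iff: "h \<in> borel_disc \<theta> R \<longleftrightarrow> h \<noteq> 0 \<and> R * (norm h)\<^sup>2 < Re (cis \<theta> * cnj h)"
proof (cases "h = 0")
  case False
  have "Re (cis \<theta> / h) = Re (cis \<theta> * cnj h / of_real ((norm h)\<^sup>2))"
    by (subst complex_div_cnj) simp
  also have "\<dots> = Re (cis \<theta> * cnj h) / (norm h)\<^sup>2" by (rule Re_divide_of_real)
  finally show ?thesis using False by (simp add: borel_disc_def less_divide_eq)
qed (simp add: borel_disc_def)

text \<open>The image of a half-plane under an inversion.\<close>

lemma borel_disc_eq_ball:
  assumes R: "R > 0"
  shows "borel_disc \<theta> R = ball (cis \<theta> / (2 * R)) (1 / (2 * R))"
proof (rule set_eqI)
  fix h :: complex
  define c where "c = cis \<theta> / (2 * R)"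
  have nc: "norm c = 1 / (2 * R)" using R by (simp add: c_def norm_divide)
  have "(norm (c - h))\<^sup>2 = (norm c)\<^sup>2 - 2 * Re (c * cnj h) + (norm h)\<^sup>2"
    by (simp only: cmod_power2) (simp add: power2_eq_square algebra_simps)
  also have "2 * Re (c * cnj h) = Re (cis \<theta> * cnj h) / R"
  proof -
    have "c * cnj h = (cis \<theta> * cnj h) / of_real (2 * R)" by (simp add: c_def)
    then have "Re (c * cnj h) = Re (cis \<theta> * cnj h) / (2 * R)" by (simp only: Re_divide_of_real)
    then show ?thesis by (simp only: mult_2 add_divide_distrib) (simp add: field_simps)
  qed
  finally have e: "(norm (c - h))\<^sup>2 = (norm c)\<^sup>2 + ((norm h)\<^sup>2 - Re (cis \<theta> * cnj h) / R)" by simp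
  have "h \<in> ball c (norm c) \<longleftrightarrow> (norm (c - h))\<^sup>2 < (norm c)\<^sup>2"
    by (simp add: dist_norm abs_le_square_iff[symmetric] flip: not_le) 
  also have "\<dots> \<longleftrightarrow> (norm h)\<^sup>2 < Re (cis \<theta> * cnj h) / R" unfolding e by simp
  also have "\<dots> \<longleftrightarrow> R * (norm h)\<^sup>2 < Re (cis \<theta> * cnj h)" using R by (simp add: field_simps)
  also have "\<dots> \<longleftrightarrow> h \<in> borel_disc \<theta> R" unfolding borel_disc_iff by auto
  finally show "h \<in> borel_disc \<theta> R \<longleftrightarrow> h \<in> ball (cis \<theta> / (2 * R)) (1 / (2 * R))"
    using nc by (simp add: c_def)
qed

text \<open>The directions at 0 are those \<open>w\<close> on the unit circle with \<open>Re (cis \<theta> * cnj w) \<ge> 0\<close>. Interior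
  directions are limits along a ray; to reach the two end directions as well, the angle is
  moved inwards while the radius shrinks.\<close>

lemma sectorial_domain_borel_disc:
  assumes R: "R > 0"
  shows "sectorial_domain (\<theta> - pi / 2) (\<theta> + pi / 2) (borel_disc \<theta> R)"
  unfolding sectorial_domain_def
proof (intro conjI)
  show "complex_domain (borel_disc \<theta> R)"
    using R unfolding complex_domain_def borel_disc_eq_ball[OF R]
    by (auto simp: ball_eq_empty intro: convex_connected)
  show "simply_connected (borel_disc \<theta> R)"
    unfolding borel_disc_eq_ball[OF R] by (simp add: convex_imp_simply_connected)
  show "0 \<notin> borel_disc \<theta> R" by (simp add: borel_disc_def)
  show "\<theta> - pi / 2 < \<theta> + pi / 2" by simp
  define T where "T = (\<lambda>h. (norm h, sgn h)) ` borel_disc \<theta> R"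
  have sub: "closure T \<subseteq> {p. norm (snd p) = 1 \<and> R * fst p \<le> Re (cis \<theta> * cnj (snd p))}"
  proof (rule closure_minimal)
    show "closed {p::real \<times> complex. norm (snd p) = 1 \<and> R * fst p \<le> Re (cis \<theta> * cnj (snd p))}"
      by (intro closed_Collect_conj closed_Collect_eq closed_Collect_le continuous_intros)
    show "T \<subseteq> {p. norm (snd p) = 1 \<and> R * fst p \<le> Re (cis \<theta> * cnj (snd p))}"
    proof
      fix p assume "p \<in> T"
      then obtain h where h: "p = (norm h, sgn h)" "h \<noteq> 0" "R * (norm h)\<^sup>2 < Re (cis \<theta> * cnj h)"
        by (auto simp: T_def borel_disc_iff)
      have "h = of_real (norm h) * sgn h" using h by (simp add: sgn_div_norm scaleR_conv_of_real)
      then have "cnj h = of_real (norm h) * cnj (sgn h)" by (metis complex_cnj_complex_of_real complex_cnj_mult)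
      then have "cis \<theta> * cnj h = of_real (norm h) * (cis \<theta> * cnj (sgn h))" by (simp only: mult.left_commute)
      then have "Re (cis \<theta> * cnj h) = norm h * Re (cis \<theta> * cnj (sgn h))" by (simp only: times_complex.sel(1)[of "of_real _"] Re_complex_of_real Im_complex_of_real mult_zero_left diff_zero)
      with h(3) have "norm h * (R * norm h) < norm h * Re (cis \<theta> * cnj (sgn h))" by (simp add: power2_eq_square mult_ac)
      then have "R * norm h < Re (cis \<theta> * cnj (sgn h))" by (rule mult_left_less_imp_less) simp
      then show "p \<in> {p. norm (snd p) = 1 \<and> R * fst p \<le> Re (cis \<theta> * cnj (snd p))}" using h by (simp add: norm_sgn)
    qed
  qed
  show "blowup_boundary (borel_disc \<theta> R) = cis ` {\<theta> - pi / 2..\<theta> + pi / 2}"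
  proof (intro set_eqI iffI)
    fix w assume "w \<in> blowup_boundary (borel_disc \<theta> R)"
    then have "(0, w) \<in> closure T" by (simp add: blowup_boundary_def T_def)
    then have w: "norm w = 1" "0 \<le> Re (cis \<theta> * cnj w)" using sub by auto
    define u where "u = w * cnj (cis \<theta>)"
    have nu: "norm u = 1" "u \<noteq> 0" using w by (auto simp: u_def norm_mult)
    have "Re u = Re (cis \<theta> * cnj w)" by (simp add: u_def)
    then have "\<bar>Im (Ln u)\<bar> \<le> pi / 2" using w nu Re_Ln_pos_le by simp
    moreover have u: "u = cis (Im (Ln u))"
    proof -
      have "u = exp (Ln u)" using nu by simp
      also have "\<dots> = cis (Im (Ln u))" using nu by (simp add: exp_eq_polar)
      finally show ?thesis .
    qed
    moreover have "w = cis (\<theta> + Im (Ln u))"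
    proof -
      have "w = cis \<theta> * u" by (simp add: u_def cis_cnj cis_mult)
      also have "\<dots> = cis \<theta> * cis (Im (Ln u))" using u by (rule arg_cong)
      finally show ?thesis by (simp only: cis_mult)
    qed
    ultimately show "w \<in> cis ` {\<theta> - pi / 2..\<theta> + pi / 2}"
      by (intro image_eqI[of _ _ "\<theta> + Im (Ln u)"]) auto
  next
    fix w assume "w \<in> cis ` {\<theta> - pi / 2..\<theta> + pi / 2}"
    then obtain p where p: "w = cis p" "\<theta> - pi / 2 \<le> p" "p \<le> \<theta> + pi / 2" by auto
    define t where "t = p - \<theta>"
    have t: "w = cis (\<theta> + t)" "\<bar>t\<bar> \<le> pi / 2" using p unfolding t_def by (simp, linarith)
    define tn where "tn = (\<lambda>n. (1 - 1 / (real n + 2)) * t)"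
    define cn where "cn = (\<lambda>n. cos (tn n))"
    define hn where "hn = (\<lambda>n. of_real (cn n / (R * (real n + 2))) * cis (\<theta> + tn n))"
    have tb: "\<bar>tn n\<bar> < pi / 2" for n
    proof -
      have a: "0 \<le> 1 - 1 / (real n + 2)" "1 - 1 / (real n + 2) < 1" by (auto simp: field_simps)
      have "\<bar>tn n\<bar> = (1 - 1 / (real n + 2)) * \<bar>t\<bar>" using a by (simp add: tn_def abs_mult)
      also have "\<dots> \<le> (1 - 1 / (real n + 2)) * (pi / 2)" using a t by (intro mult_left_mono) auto
      also have "\<dots> < 1 * (pi / 2)" using a by (intro mult_strict_right_mono) auto
      finally show ?thesis by simp
    qed
    have c: "0 < cn n" "cn n \<le> 1" for n unfolding cn_def using tb[of n] by (auto intro!: cos_gt_zero_pi simp: abs_less_iff)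
    have pos: "cn n / (R * (real n + 2)) > 0" for n using c[of n] R by (intro divide_pos_pos mult_pos_pos) auto
    have nh: "norm (hn n) = cn n / (R * (real n + 2))" for n
      by (simp only: hn_def norm_mult norm_of_real norm_cis abs_of_pos[OF pos] mult_1_right)
    have sh: "sgn (hn n) = cis (\<theta> + tn n)" for n
    proof -
      have "inverse p *\<^sub>R (of_real p * z) = z" if "p > 0" for p and z :: complex
        using that by (simp add: scaleR_conv_of_real)
      from this[OF pos] show ?thesis unfolding sgn_div_norm nh by (subst hn_def)
    qed
    have "hn n \<in> borel_disc \<theta> R" for n
      unfolding borel_disc_iff
    proof
      define p where "p = cn n / (R * (real n + 2))"
      have p: "p > 0" using c[of n] R by (auto simp: p_def intro!: divide_pos_pos mult_pos_pos)
      have hp: "hn n = of_real p * cis (\<theta> + tn n)" by (simp only: hn_def p_def)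
      show "hn n \<noteq> 0" using p by (simp add: hp)
      have "cis \<theta> * cnj (hn n) = of_real p * cis (- tn n)"
        by (simp add: hp cis_cnj cis_mult)
      then have "Re (cis \<theta> * cnj (hn n)) = p * cn n" by (simp add: cn_def)
      moreover have "R * p < cn n"
      proof -
        have "R * p = cn n / (real n + 2)" using R by (simp add: p_def)
        also have "\<dots> < cn n" using c[of n] by (simp add: divide_less_eq)
        finally show ?thesis .
      qed
      then have "p * (R * p) < p * cn n" using p by simp
      ultimately show "R * (norm (hn n))\<^sup>2 < Re (cis \<theta> * cnj (hn n))"
        unfolding nh p_def[symmetric] by (simp add: power2_eq_square mult_ac)
    qed
    then have inT: "(norm (hn n), sgn (hn n)) \<in> T" for n by (auto simp: T_def)
    have l0: "(\<lambda>n. 1 / (real n + 2)) \<longlonglongrightarrow> 0"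
      using LIMSEQ_ignore_initial_segment[OF lim_1_over_n, of 2] by (simp add: add.commute)
    have "(\<lambda>n. norm (hn n)) \<longlonglongrightarrow> 0"
    proof (rule Lim_null_comparison[OF always_eventually[OF allI]])
      show "norm (norm (hn n)) \<le> 1 / R * (1 / (real n + 2))" for n
      proof -
        have "cn n / (R * (real n + 2)) \<le> 1 / (R * (real n + 2))" using c[of n] R by (intro divide_right_mono) auto
        then show ?thesis unfolding nh real_norm_def abs_of_pos[OF pos] by simp
      qed
      show "(\<lambda>n. 1 / R * (1 / (real n + 2))) \<longlonglongrightarrow> 0" using tendsto_mult_left[OF l0, of "1 / R"] by simp
    qed
    moreover have "(\<lambda>n. sgn (hn n)) \<longlonglongrightarrow> w"
    proof -
      have "tn \<longlonglongrightarrow> (1 - 0) * t" unfolding tn_def by (intro tendsto_intros l0)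
      then have "(\<lambda>n. cis (\<theta> + tn n)) \<longlonglongrightarrow> cis (\<theta> + t)"
        unfolding cis_conv_exp by (intro tendsto_intros) simp
      then show ?thesis by (simp add: sh t)
    qed
    ultimately have "(\<lambda>n. (norm (hn n), sgn (hn n))) \<longlonglongrightarrow> (0, w)" by (rule tendsto_Pair)
    with inT have "\<exists>x. (\<forall>n. x n \<in> T) \<and> x \<longlonglongrightarrow> (0, w)"
      by (intro exI[of _ "\<lambda>n. (norm (hn n), sgn (hn n))"] conjI allI)
    then have "(0, w) \<in> closure T" unfolding closure_sequential .
    then show "w \<in> blowup_boundary (borel_disc \<theta> R)" by (simp add: blowup_boundary_def T_def)
  qed
qed

section \<open>Solutions on halfstrips\<close>

text \<open>A horizontal halfstrip extending to the right; a WKB halfstrip domain is the image of a rotated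
  one.\<close>

definition hstrip :: "complex \<Rightarrow> real \<Rightarrow> complex set" where
  "hstrip z1 r = (\<Union>s\<in>{0..}. ball (z1 + of_real s) r)"

lemma hstrip_iff: "z \<in> hstrip z1 r \<longleftrightarrow> (\<exists>s\<ge>0. dist (z1 + of_real s) z < r)"
  by (auto simp: hstrip_def)

lemma open_hstrip: "open (hstrip z1 r)" by (auto simp: hstrip_def)

lemma hstrip_shift: "z \<in> hstrip z1 r \<Longrightarrow> t \<ge> 0 \<Longrightarrow> z + of_real t \<in> hstrip z1 r"
proof -
  assume "z \<in> hstrip z1 r" "t \<ge> 0"
  then obtain s where s: "s \<ge> 0" "dist (z1 + of_real s) z < r" unfolding hstrip_iff by auto
  have "dist (z1 + of_real (s + t)) (z + of_real t) < r" using s by (simp add: dist_norm add_diff_eq)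
  then show ?thesis unfolding hstrip_iff using s \<open>t \<ge> 0\<close> by (metis add_nonneg_nonneg)
qed

lemma convex_hstrip: "convex (hstrip z1 r)"
proof (rule convexI)
  fix x y u v assume x: "x \<in> hstrip z1 r" and y: "y \<in> hstrip z1 r" and u: "0 \<le> u" "0 \<le> v" "u + v = (1::real)"
  obtain s t where s: "s \<ge> 0" "norm (z1 + of_real s - x) < r" and t: "t \<ge> 0" "norm (z1 + of_real t - y) < r"
    using x y unfolding hstrip_iff dist_norm by auto
  have "z1 = of_real u * z1 + of_real v * z1" by (metis distrib_right mult_1 of_real_1 of_real_add u(3))
  then have e: "z1 + of_real (u * s + v * t) - (u *\<^sub>R x + v *\<^sub>R y) = u *\<^sub>R (z1 + of_real s - x) + v *\<^sub>R (z1 + of_real t - y)"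
    by (simp add: scaleR_conv_of_real algebra_simps)
  have "norm (u *\<^sub>R (z1 + of_real s - x) + v *\<^sub>R (z1 + of_real t - y)) \<le> u * norm (z1 + of_real s - x) + v * norm (z1 + of_real t - y)"
    using u by (intro order.trans[OF norm_triangle_ineq]) auto
  also have "\<dots> < r" using convex_bound_lt[OF s(2) t(2) u] .
  finally show "u *\<^sub>R x + v *\<^sub>R y \<in> hstrip z1 r"
    unfolding hstrip_iff dist_norm e[symmetric] using s t u by (intro exI[of _ "u * s + v * t"]) auto
qed

lemma hstrip_enlarge: "z \<in> hstrip z1 r' \<Longrightarrow> dist z w \<le> r - r' \<Longrightarrow> w \<in> hstrip z1 r"
  unfolding hstrip_iff by (metis add.commute add_less_le_mono dist_commute dist_triangle2 le_less_trans diff_add_cancel)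

lemma hstrip_mono: "r' \<le> r \<Longrightarrow> hstrip z1 r' \<subseteq> hstrip z1 r"
  by (auto simp: hstrip_iff) (meson less_le_trans)

lemma hstrip_closure: "r' < r \<Longrightarrow> closure (hstrip z1 r') \<subseteq> hstrip z1 r"
proof
  fix w assume r: "r' < r" and "w \<in> closure (hstrip z1 r')"
  then obtain z where "z \<in> hstrip z1 r'" "dist z w < r - r'"
    by (metis closure_approachable diff_gt_0_iff_gt)
  then show "w \<in> hstrip z1 r" using hstrip_enlarge[of z z1 r' w r] by simp
qed

text \<open>The remainders of orders \<open>n\<close> and \<open>n + 1\<close> differ, up to a factor \<open>1 / \<kappa>\<close> on the second, by the
  coefficient of order \<open>n\<close>; let \<open>\<kappa>\<close> tend to infinity.\<close>

lemma coefficient_bound_of_scaled_rem: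
  assumes b: "\<And>\<kappa> n. Re \<kappa> > R \<Longrightarrow> norm (scaled_rem \<kappa> (g \<kappa>) gs n) \<le> c n"
  shows "norm (gs n) \<le> c n"
proof (rule field_le_epsilon)
  fix e :: real assume e: "e > 0"
  define t where "t = max (R + 1) (max 1 (\<bar>c (Suc n)\<bar> / e))"
  let ?\<kappa> = "of_real t :: complex"
  have t: "t > R" "t \<ge> 1" "\<bar>c (Suc n)\<bar> / e \<le> t" by (auto simp: t_def)
  have "scaled_rem ?\<kappa> (g ?\<kappa>) gs (Suc n) = ?\<kappa> * (scaled_rem ?\<kappa> (g ?\<kappa>) gs n - gs n)"
    using t by (simp add: scaled_rem_def algebra_simps)
  then have "gs n = scaled_rem ?\<kappa> (g ?\<kappa>) gs n - scaled_rem ?\<kappa> (g ?\<kappa>) gs (Suc n) / ?\<kappa>"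
    using t by (simp add: field_simps)
  then have "norm (gs n) \<le> norm (scaled_rem ?\<kappa> (g ?\<kappa>) gs n) + norm (scaled_rem ?\<kappa> (g ?\<kappa>) gs (Suc n)) / t"
    using norm_triangle_ineq4[of "scaled_rem ?\<kappa> (g ?\<kappa>) gs n" "scaled_rem ?\<kappa> (g ?\<kappa>) gs (Suc n) / ?\<kappa>"] t
    by (simp add: norm_divide)
  also have "\<dots> \<le> c n + \<bar>c (Suc n)\<bar> / t"
    using b[of ?\<kappa> n] b[of ?\<kappa> "Suc n"] t by (intro add_mono divide_right_mono) auto
  also have "\<bar>c (Suc n)\<bar> / t \<le> e" using t e by (simp add: field_simps)
  finally show "norm (gs n) \<le> c n + e" by simp
qed

text \<open>Widths shrink in three steps. Cauchy estimates bound the derivatives of the leading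
  coefficients on a narrower halfstrip, where the existence result applies; it yields a solution
  on a bounded open part \<open>U\<close> of a still narrower one. The Gevrey estimates then hold on \<open>V\<close>,
  which stays at a distance \<open>\<delta>\<close> from the complement of \<open>U\<close>.\<close>

lemma Riccati_halfstrip_solution:
  fixes A B C :: "complex \<Rightarrow> complex \<Rightarrow> complex" and As Bs Cs Fs :: "nat \<Rightarrow> complex \<Rightarrow> complex"
    and z1 :: complex and r r' :: real
  defines "G \<equiv> hstrip z1 r"
  assumes hol: "\<And>k. As k holomorphic_on G" "\<And>k. Bs k holomorphic_on G" "\<And>k. Cs k holomorphic_on G" "\<And>k. Fs k holomorphic_on G"
    and formal: "\<And>n z. z \<in> G \<Longrightarrow> (if n = 0 then 0 else deriv (Fs (n - 1)) z) =
        (\<Sum>k\<le>n. As k z * (\<Sum>j\<le>n - k. Fs j z * Fs (n - k - j) z)) + (\<Sum>k\<le>n. Bs k z * Fs (n - k) z) + Cs n z"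
    and lin: "\<And>z. z \<in> G \<Longrightarrow> 2 * As 0 z * Fs 0 z + Bs 0 z = 1"
    and R0: "R0 \<ge> 0" and CM: "C0 \<ge> 0" "M \<ge> 0"
    and sh: "sep_holo A G {\<kappa>. Re \<kappa> > R0}" "sep_holo B G {\<kappa>. Re \<kappa> > R0}" "sep_holo C G {\<kappa>. Re \<kappa> > R0}"
    and rA: "\<And>k z \<kappa>. z \<in> G \<Longrightarrow> Re \<kappa> > R0 \<Longrightarrow> norm (scaled_rem \<kappa> (A z \<kappa>) (\<lambda>k. As k z) k) \<le> C0 * M ^ k * fact k"
    and rB: "\<And>k z \<kappa>. z \<in> G \<Longrightarrow> Re \<kappa> > R0 \<Longrightarrow> norm (scaled_rem \<kappa> (B z \<kappa>) (\<lambda>k. Bs k z) k) \<le> C0 * M ^ k * fact k"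
    and rC: "\<And>k z \<kappa>. z \<in> G \<Longrightarrow> Re \<kappa> > R0 \<Longrightarrow> norm (scaled_rem \<kappa> (C z \<kappa>) (\<lambda>k. Cs k z) k) \<le> C0 * M ^ k * fact k"
    and V: "V \<subseteq> hstrip z1 r'" "bounded V" "r' < r"
  obtains R U F D Q where "R \<ge> R0" "V \<subseteq> U" "open U" "U \<subseteq> G" "D \<ge> 0" "Q \<ge> 1" "sep_holo F U {\<kappa>. Re \<kappa> > R}"
    "\<And>z \<kappa>. z \<in> U \<Longrightarrow> Re \<kappa> > R \<Longrightarrow> deriv (\<lambda>z. F z \<kappa>) z = \<kappa> * (A z \<kappa> * (F z \<kappa>)\<^sup>2 + B z \<kappa> * F z \<kappa> + C z \<kappa>)"
    "\<And>n z \<kappa>. z \<in> V \<Longrightarrow> Re \<kappa> > R \<Longrightarrow> norm (scaled_rem \<kappa> (F z \<kappa>) (\<lambda>k. Fs k z) n) \<le> D * Q ^ n * fact n"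
proof -
  have bAs: "norm (As k z) \<le> C0 * M ^ k * fact k" if "z \<in> G" for k z
    using coefficient_bound_of_scaled_rem[of R0 "\<lambda>\<kappa>. A z \<kappa>" "\<lambda>k. As k z" "\<lambda>k. C0 * M ^ k * fact k", OF rA[OF that]] .
  have bBs: "norm (Bs k z) \<le> C0 * M ^ k * fact k" if "z \<in> G" for k z
    using coefficient_bound_of_scaled_rem[of R0 "\<lambda>\<kappa>. B z \<kappa>" "\<lambda>k. Bs k z" "\<lambda>k. C0 * M ^ k * fact k", OF rB[OF that]] .
  have bCs: "norm (Cs k z) \<le> C0 * M ^ k * fact k" if "z \<in> G" for k z
    using coefficient_bound_of_scaled_rem[of R0 "\<lambda>\<kappa>. C z \<kappa>" "\<lambda>k. Cs k z" "\<lambda>k. C0 * M ^ k * fact k", OF rC[OF that]] .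
  obtain l where l: "\<And>v. v \<in> V \<Longrightarrow> norm v \<le> l" using V(2) unfolding bounded_iff by blast
  define d where "d = (r - r') / 3"
  have d: "d > 0" using V by (simp add: d_def)
  define G2 where "G2 = hstrip z1 (r - d)"
  define U where "U = hstrip z1 (r - 2 * d) \<inter> ball 0 (l + 1)"
  have "open U" by (simp add: U_def open_hstrip open_Int)
  have G2G: "cball z d \<subseteq> G" if "z \<in> G2" for z
    using hstrip_enlarge[of z z1 "r - d" _ r] that by (auto simp: G2_def G_def)
  have LG2: "closure U \<subseteq> G2"
  proof -
    have "closure U \<subseteq> closure (hstrip z1 (r - 2 * d))" by (intro closure_mono) (auto simp: U_def)
    then show ?thesis unfolding G2_def using hstrip_closure[of "r - 2 * d" "r - d" z1] d by auto
  qed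
  have UG: "U \<subseteq> G2" using LG2 closure_subset by blast
  have G2sub: "G2 \<subseteq> G" unfolding G2_def G_def by (rule hstrip_mono) (use d in simp)
  have cL: "compact (closure U)" by (auto simp: U_def compact_eq_bounded_closed intro!: bounded_closure)
  define K where "K = max 1 (max C0 (max (C0 * M) (C0 / d)))"
  have K: "K \<ge> 1" "C0 \<le> K" "C0 * M \<le> K" "C0 / d \<le> K" by (auto simp: K_def)
  have der: "norm (deriv g z) \<le> K" if g: "g holomorphic_on G" "\<And>z. z \<in> G \<Longrightarrow> norm (g z) \<le> C0" and z: "z \<in> G2" for g z
  proof -
    have "norm (deriv g z) \<le> C0 / d"
      by (rule norm_deriv_le_Cauchy[OF g(1) G2G[OF z]]) (use g d G2G[OF z] open_hstrip in \<open>auto simp: G_def\<close>)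
    then show ?thesis using K by simp
  qed
  have b0: "norm (As 0 z) \<le> C0" "norm (Bs 0 z) \<le> C0" "norm (Cs 0 z) \<le> C0" if "z \<in> G" for z
    using bAs[OF that, of 0] bBs[OF that, of 0] bCs[OF that, of 0] by auto
  obtain R F where R: "R \<ge> R0" and F: "sep_holo F U {\<kappa>. Re \<kappa> > R}"
    "\<And>z \<kappa>. z \<in> U \<Longrightarrow> Re \<kappa> > R \<Longrightarrow> deriv (\<lambda>z. F z \<kappa>) z = \<kappa> * (A z \<kappa> * (F z \<kappa>)\<^sup>2 + B z \<kappa> * F z \<kappa> + C z \<kappa>)"
    "\<And>z \<kappa>. z \<in> U \<Longrightarrow> Re \<kappa> > R \<Longrightarrow> norm (As 0 z * (F z \<kappa> - Fs 0 z)) \<le> 1 / 2"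
    "\<And>z \<kappa>. z \<in> U \<Longrightarrow> Re \<kappa> > R \<Longrightarrow> norm (F z \<kappa> - Fs 0 z) \<le> 1"
  proof (rule Riccati_solution_near_root[of G2 "As 0" "Fs 0" "Bs 0" "Cs 0" K R0 A B C "closure U" U])
    show "open G2" "convex G2" by (simp_all add: G2_def open_hstrip convex_hstrip)
    show "z + of_real s \<in> G2" if "z \<in> G2" "s \<ge> 0" for z s using that hstrip_shift by (simp add: G2_def)
    show "As 0 holomorphic_on G2" "Fs 0 holomorphic_on G2" using hol G2sub holomorphic_on_subset by blast+
    show "2 * As 0 z * Fs 0 z + Bs 0 z = 1" if "z \<in> G2" for z using lin that G2sub by blast
    show "As 0 z * (Fs 0 z)\<^sup>2 + Bs 0 z * Fs 0 z + Cs 0 z = 0" if "z \<in> G2" for z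
      using formal[of z 0] that G2sub by (auto simp: power2_eq_square)
    show "norm (As 0 z) \<le> K" "norm (Bs 0 z) \<le> K" "norm (Cs 0 z) \<le> K" if "z \<in> G2" for z
      using b0[of z] that G2sub K by (auto intro: order.trans)
    show "norm (deriv (As 0) z) \<le> K" "norm (deriv (Bs 0) z) \<le> K" "norm (deriv (Cs 0) z) \<le> K" if "z \<in> G2" for z
      using der[OF hol(1) b0(1) that] der[OF hol(2) b0(2) that] der[OF hol(3) b0(3) that] by auto
    show "sep_holo A G2 {\<kappa>. Re \<kappa> > R0}" "sep_holo B G2 {\<kappa>. Re \<kappa> > R0}" "sep_holo C G2 {\<kappa>. Re \<kappa> > R0}"
      using sh G2sub by (auto intro: sep_holo_subset)
    show "norm (\<kappa> * (A z \<kappa> - As 0 z)) \<le> K" if "z \<in> G2" "Re \<kappa> > R0" for z \<kappa>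
      using rA[of z \<kappa> 1] that G2sub K by (auto simp: scaled_rem_def intro: order.trans)
    show "norm (\<kappa> * (B z \<kappa> - Bs 0 z)) \<le> K" if "z \<in> G2" "Re \<kappa> > R0" for z \<kappa>
      using rB[of z \<kappa> 1] that G2sub K by (auto simp: scaled_rem_def intro: order.trans)
    show "norm (\<kappa> * (C z \<kappa> - Cs 0 z)) \<le> K" if "z \<in> G2" "Re \<kappa> > R0" for z \<kappa>
      using rC[of z \<kappa> 1] that G2sub K by (auto simp: scaled_rem_def intro: order.trans)
    show "U \<subseteq> closure U" by (rule closure_subset)
  qed (use K R0 cL LG2 \<open>open U\<close> in auto)
  have "continuous_on (closure U) (Fs 0)"
    using hol(4) LG2 G2sub by (meson holomorphic_on_imp_continuous_on continuous_on_subset order_trans)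
  then have "bounded (Fs 0 ` closure U)" using cL compact_continuous_image compact_imp_bounded by blast
  then obtain K1 where K1: "\<And>z. z \<in> closure U \<Longrightarrow> norm (Fs 0 z) \<le> K1" unfolding bounded_iff by blast
  define K0 where "K0 = \<bar>K1\<bar> + 1"
  have K0: "K0 \<ge> 1" by (simp add: K0_def)
  have F0: "norm (Fs 0 z) \<le> K0" "norm (Fs 0 z) \<le> K0 - 1" if "z \<in> U" for z
    using K1[of z] that closure_subset[of U] by (auto simp: K0_def)
  have FK: "norm (F z \<kappa>) \<le> K0" if "z \<in> U" "Re \<kappa> > R" for z \<kappa>
    using F(4)[OF that] F0(2)[OF that(1)] norm_triangle_ineq2[of "F z \<kappa>" "Fs 0 z"] by linarith
  have U2: "U \<subseteq> G" using UG G2sub by blast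
  define \<delta> where "\<delta> = min d 1 / 2"
  have \<delta>: "0 < \<delta>" "\<delta> \<le> 1" using d by (auto simp: \<delta>_def)
  obtain D Q where D: "D \<ge> 0" and Q: "Q \<ge> 1" and est:
    "\<And>n z \<delta> \<kappa>. n \<ge> 1 \<Longrightarrow> 0 < \<delta> \<Longrightarrow> \<delta> \<le> 1 \<Longrightarrow> cball z \<delta> \<subseteq> U \<Longrightarrow> \<kappa> \<in> {\<kappa>. Re \<kappa> > R} \<Longrightarrow>
       norm (scaled_rem \<kappa> (F z \<kappa>) (\<lambda>k. Fs k z) n) \<le> D * Q ^ (n - 1) * fact n / \<delta> ^ n"
  proof (rule Gevrey_expansion_of_Riccati_solution[of U "{\<kappa>. Re \<kappa> > R}" F Fs A B C As Bs Cs C0 M K0])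
    show "0 \<notin> {\<kappa>. Re \<kappa> > R}" using R R0 by simp
    show "(\<lambda>z. F z \<kappa>) holomorphic_on U" if "\<kappa> \<in> {\<kappa>. Re \<kappa> > R}" for \<kappa>
      using F(1) that unfolding sep_holo_def by blast
    show "Fs k holomorphic_on U" for k using hol U2 holomorphic_on_subset by blast
  qed (use \<open>open U\<close> F formal lin CM K0 bAs bBs bCs rA rB rC F0 FK U2 R in \<open>auto simp: subset_iff\<close>)
  show ?thesis
  proof (rule that[of R U "D + K0" "Q / \<delta>" F])
    show VU: "V \<subseteq> U"
    proof
      fix v assume v: "v \<in> V"
      then have "v \<in> hstrip z1 r'" using V by auto
      then show "v \<in> U" using l[OF v] hstrip_mono[of r' "r - 2 * d" z1] V(3) by (auto simp: U_def d_def field_simps)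
    qed
    show "1 \<le> Q / \<delta>" using Q \<delta> by (simp add: le_divide_eq)
    fix n z \<kappa> assume z: "z \<in> V" and \<kappa>: "Re \<kappa> > R"
    have cb: "cball z \<delta> \<subseteq> U"
    proof
      fix w assume w: "w \<in> cball z \<delta>"
      have "z \<in> hstrip z1 r'" using V z by auto
      then have "w \<in> hstrip z1 (r - 2 * d)"
        by (rule hstrip_enlarge) (use w d in \<open>auto simp: \<delta>_def d_def field_simps\<close>)
      moreover have "norm w < l + 1"
        using norm_triangle_ineq2[of w z] l[OF z] w by (auto simp: \<delta>_def dist_norm norm_minus_commute)
      ultimately show "w \<in> U" by (simp add: U_def)
    qed
    show "norm (scaled_rem \<kappa> (F z \<kappa>) (\<lambda>k. Fs k z) n) \<le> (D + K0) * (Q / \<delta>) ^ n * fact n"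
    proof (cases "n = 0")
      case True
      then show ?thesis using FK[of z \<kappa>] VU z \<kappa> D by auto
    next
      case False
      then have "norm (scaled_rem \<kappa> (F z \<kappa>) (\<lambda>k. Fs k z) n) \<le> D * Q ^ (n - 1) * fact n / \<delta> ^ n"
        by (intro est) (use \<delta> cb \<kappa> in auto)
      also have "\<dots> \<le> (D + K0) * Q ^ n * fact n / \<delta> ^ n"
        using D K0 Q \<delta> by (intro divide_right_mono mult_right_mono mult_mono power_increasing) auto
      finally show ?thesis by (simp add: power_divide)
    qed
  qed (use R \<open>open U\<close> U2 D K0 F in auto)
qed

section \<open>The solution along a WKB halfstrip\<close>

text \<open>The bounds are required only for \<open>Re \<kappa> > R'\<close>, since a Gevrey expansion in \<open>h\<close> is a condition
  for small \<open>h\<close>; the identity theorem carries the equality to the larger half-plane.\<close>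

lemma Gevrey_expansion_unique:
  fixes \<phi> \<psi> :: "complex \<Rightarrow> complex"
  assumes hol: "\<phi> holomorphic_on {\<kappa>. Re \<kappa> > R}" "\<psi> holomorphic_on {\<kappa>. Re \<kappa> > R}"
    and R: "R' \<ge> 0" "R' \<ge> R" and C: "C1 \<ge> 0" "C2 \<ge> 0" "M1 \<ge> 0" "M2 \<ge> 0"
    and b1: "\<And>\<kappa> n. Re \<kappa> > R' \<Longrightarrow> norm (scaled_rem \<kappa> (\<phi> \<kappa>) gs n) \<le> C1 * M1 ^ n * fact n"
    and b2: "\<And>\<kappa> n. Re \<kappa> > R' \<Longrightarrow> norm (scaled_rem \<kappa> (\<psi> \<kappa>) gs n) \<le> C2 * M2 ^ n * fact n"
    and z: "Re z > R"
  shows "\<phi> z = \<psi> z"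
proof -
  define M where "M = max 1 (max M1 M2)"
  have M: "M > 0" "M1 \<le> M" "M2 \<le> M" by (auto simp: M_def)
  have z0: "\<phi> w - \<psi> w = 0" if w: "Re w > R'" for w
  proof (rule Watson_lemma_halfplane[where \<phi> = "\<lambda>w. \<phi> w - \<psi> w" and z = w and R = R' and M = M and C = "C1 + C2"])
    show "(\<lambda>w. \<phi> w - \<psi> w) holomorphic_on {w. R' < Re w}"
      by (intro holomorphic_intros holomorphic_on_subset[OF hol(1)] holomorphic_on_subset[OF hol(2)]) (use R in auto)
    fix w :: complex and n assume w: "R' < Re w"
    have nz: "w \<noteq> 0" using w R by auto
    have "w ^ n * (\<phi> w - \<psi> w) = scaled_rem w (\<phi> w) gs n - scaled_rem w (\<psi> w) gs n"
      by (simp add: scaled_rem_def algebra_simps)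
    then have "norm w ^ n * norm (\<phi> w - \<psi> w) = norm (scaled_rem w (\<phi> w) gs n - scaled_rem w (\<psi> w) gs n)"
      by (metis norm_mult norm_power)
    also have "\<dots> \<le> C1 * M1 ^ n * fact n + C2 * M2 ^ n * fact n"
      using norm_triangle_ineq4[of "scaled_rem w (\<phi> w) gs n" "scaled_rem w (\<psi> w) gs n"] b1[OF w, of n] b2[OF w, of n] by linarith
    also have "\<dots> \<le> C1 * M ^ n * fact n + C2 * M ^ n * fact n"
      using M C by (intro add_mono mult_right_mono mult_left_mono power_mono) auto
    also have "\<dots> = (C1 + C2) * M ^ n * fact n" by (simp add: algebra_simps)
    finally show "norm (\<phi> w - \<psi> w) \<le> (C1 + C2) * M ^ n * fact n / norm w ^ n"
      using nz by (simp add: pos_le_divide_eq mult.commute)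
  qed (use R C M w in auto)
  show ?thesis
  proof (rule analytic_continuation_open[of "{w. Re w > R'}" "{w. Re w > R}" \<phi> \<psi> z])
    show "{w. Re w > R'} \<noteq> {}" by (auto intro!: exI[of _ "of_real (R' + 1)"])
    show "connected {w. Re w > R}" by (simp add: convex_connected convex_halfspace_Re_gt)
    show "\<phi> w = \<psi> w" if "w \<in> {w. Re w > R'}" for w using z0[of w] that by simp
  qed (use hol z R in \<open>auto simp: open_halfspace_Re_gt\<close>)
qed

lemma halfstrip_eq_rotated_hstrip:
  assumes "\<alpha> \<in> {1, -1::real}"
  shows "halfstrip \<theta> \<alpha> z1 r = (\<lambda>\<zeta>. of_real \<alpha> * cis \<theta> * \<zeta>) ` hstrip (z1 / (of_real \<alpha> * cis \<theta>)) r"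
proof -
  define d where "d = of_real \<alpha> * cis \<theta>"
  have nd: "norm d = 1" "d \<noteq> 0" using assms by (auto simp: d_def norm_mult)
  have mem: "z \<in> halfstrip \<theta> \<alpha> z1 r \<longleftrightarrow> (\<exists>t\<ge>0. dist z (z1 + d * of_real t) < r)" for z
  proof -
    have "infdist z ((\<lambda>t. z1 + cis \<theta> * complex_of_real (\<alpha> * t)) ` {0..}) = (INF t\<in>{0..}. dist z (z1 + d * of_real t))"
      unfolding infdist_def by (simp add: image_image d_def mult_ac)
    then show ?thesis
      unfolding halfstrip_def by (simp add: cINF_less_iff[OF _ bdd_belowI2[of _ 0]] Bex_def) 
  qed
  have "z \<in> halfstrip \<theta> \<alpha> z1 r \<longleftrightarrow> z / d \<in> hstrip (z1 / d) r" for z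
  proof -
    have "dist z (z1 + d * of_real t) = dist (z1 / d + of_real t) (z / d)" for t
    proof -
      have "z1 / d + of_real t - z / d = (z1 + d * of_real t - z) / d" using nd by (simp add: field_simps)
      then show ?thesis using nd by (simp add: dist_norm norm_divide norm_minus_commute)
    qed
    then show ?thesis unfolding mem hstrip_iff by simp
  qed
  then have "halfstrip \<theta> \<alpha> z1 r = (\<lambda>z. z / d) -` hstrip (z1 / d) r" by auto
  also have "\<dots> = (\<lambda>\<zeta>. d * \<zeta>) ` hstrip (z1 / d) r"
  proof (intro equalityI subsetI)
    fix z assume "z \<in> (\<lambda>z. z / d) -` hstrip (z1 / d) r"
    then show "z \<in> (\<lambda>\<zeta>. d * \<zeta>) ` hstrip (z1 / d) r" using nd by (intro image_eqI[of _ _ "z / d"]) auto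
  qed (use nd in auto)
  finally show ?thesis by (simp only: d_def)
qed

text \<open>Differentiate the identity \<open>\<Phi> (\<Psi> z) = z\<close>.\<close>

lemma deriv_inverse_of_primitive:
  assumes N: "open N" "x0 \<in> N" "s holomorphic_on N" and H: "open H" "0 \<in> H" and \<Psi>: "\<Psi> holomorphic_on H" "\<Psi> 0 = x0"
    and ev: "\<forall>\<^sub>F z in nhds 0. contour_integral (linepath x0 (\<Psi> z)) s = z"
  obtains e where "e > 0" "ball 0 e \<subseteq> H" "\<And>z. z \<in> ball 0 e \<Longrightarrow> s (\<Psi> z) * deriv \<Psi> z = 1"
proof -
  obtain \<rho> where \<rho>: "\<rho> > 0" "ball x0 \<rho> \<subseteq> N" using N open_contains_ball by blast
  have "s holomorphic_on ball x0 \<rho>" using N \<rho> holomorphic_on_subset by blast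
  then obtain g where g: "\<And>x. x \<in> ball x0 \<rho> \<Longrightarrow> (g has_field_derivative s x) (at x within ball x0 \<rho>)"
    using holomorphic_convex_primitive'[of "ball x0 \<rho>" s] by auto
  then have g': "(g has_field_derivative s x) (at x)" if "x \<in> ball x0 \<rho>" for x
    using that by (metis at_within_open open_ball)
  have ci: "contour_integral (linepath x0 x) s = g x - g x0" if "x \<in> ball x0 \<rho>" for x
  proof (rule contour_integral_unique)
    have "closed_segment x0 x \<subseteq> ball x0 \<rho>"
      using that \<rho> by (intro closed_segment_subset convex_ball) auto
    then show "(s has_contour_integral g x - g x0) (linepath x0 x)"
      using contour_integral_primitive[of "ball x0 \<rho>" g s "linepath x0 x", OF g] by auto
  qed
  have c: "continuous_on H \<Psi>" using \<Psi>(1) by (rule holomorphic_on_imp_continuous_on)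
  have "open (H \<inter> \<Psi> -` ball x0 \<rho>)" using c H(1) by (intro continuous_open_preimage) auto
  moreover have "0 \<in> H \<inter> \<Psi> -` ball x0 \<rho>" using H \<Psi> \<rho> by auto
  ultimately have "\<forall>\<^sub>F z in nhds 0. z \<in> H \<inter> \<Psi> -` ball x0 \<rho>" by (rule eventually_nhds_in_open)
  with ev have "\<forall>\<^sub>F z in nhds 0. z \<in> H \<and> \<Psi> z \<in> ball x0 \<rho> \<and> g (\<Psi> z) - g x0 = z"
    by eventually_elim (use ci in auto)
  then obtain e where e: "e > 0" "\<And>z. dist z 0 < e \<Longrightarrow> z \<in> H \<and> \<Psi> z \<in> ball x0 \<rho> \<and> g (\<Psi> z) - g x0 = z"
    unfolding eventually_nhds_metric by blast
  show ?thesis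
  proof (rule that[of e])
    show "ball 0 e \<subseteq> H" using e by (auto simp: dist_commute)
    fix z assume z: "z \<in> ball (0::complex) e"
    have zz: "z \<in> H" "\<Psi> z \<in> ball x0 \<rho>" using e(2)[of z] z by (auto simp: dist_commute)
    have d\<Psi>: "(\<Psi> has_field_derivative deriv \<Psi> z) (at z)" using \<Psi>(1) H(1) zz(1) by (rule holomorphic_derivI)
    have "((\<lambda>z. g (\<Psi> z) - g x0) has_field_derivative s (\<Psi> z) * deriv \<Psi> z) (at z)"
      using DERIV_chain2[OF g'[OF zz(2)] d\<Psi>] by (auto intro!: derivative_eq_intros)
    then have "((\<lambda>z. z) has_field_derivative s (\<Psi> z) * deriv \<Psi> z) (at z)"
      by (rule has_field_derivative_transform_within_open[of _ _ _ "ball 0 e"]) (use z e(2) in \<open>auto simp: dist_commute\<close>)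
    then show "s (\<Psi> z) * deriv \<Psi> z = 1" using DERIV_unique[OF DERIV_ident] by metis
  qed (use e in auto)
qed

lemma scaled_rem_bound_of_gevrey_asymp:
  assumes g: "gevrey_asymp q W S g gs" and S: "borel_disc \<theta> R1 \<subseteq> S" and R1: "R1 > 0" and c: "norm c = 1"
  obtains C M R where "C \<ge> 0" "M \<ge> 0" "R \<ge> R1"
    "\<And>x \<kappa> n. x \<in> W \<Longrightarrow> q x \<noteq> 0 \<Longrightarrow> Re \<kappa> > R \<Longrightarrow>
      norm (scaled_rem \<kappa> (c * g x (cis \<theta> / \<kappa>) / q x) (\<lambda>k. c * gs k x * cis \<theta> ^ k / q x) n) \<le> C * M ^ n * fact n"
proof -
  obtain C M \<epsilon> where C: "C > 0" "M > 0" "\<epsilon> > 0"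
    and b: "\<And>n x h. x \<in> W \<Longrightarrow> h \<in> S \<Longrightarrow> norm h < \<epsilon> \<Longrightarrow>
        norm (g x h - (\<Sum>k<n. gs k x * h ^ k)) \<le> norm (q x) * C * M ^ n * fact n * norm h ^ n"
    using g unfolding gevrey_asymp_def by blast
  show ?thesis
  proof (rule that[of C M "max R1 (1 / \<epsilon>)"])
    fix x \<kappa> n assume x: "x \<in> W" "q x \<noteq> 0" and \<kappa>: "Re \<kappa> > max R1 (1 / \<epsilon>)"
    define h where "h = cis \<theta> / \<kappa>"
    have k0: "\<kappa> \<noteq> 0" using \<kappa> R1 by auto
    have hS: "h \<in> S"
    proof -
      have "cis \<theta> / h = \<kappa>" using k0 by (simp add: h_def)
      then have "h \<in> borel_disc \<theta> R1" using \<kappa> k0 by (auto simp: borel_disc_def h_def)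
      then show ?thesis using S by blast
    qed
    have hn: "norm h = 1 / norm \<kappa>" by (simp add: h_def norm_divide)
    have "1 / \<epsilon> < norm \<kappa>" using \<kappa> complex_Re_le_cmod[of \<kappa>] by linarith
    then have he: "norm h < \<epsilon>" using C k0 unfolding hn by (simp add: field_simps)
    have "scaled_rem \<kappa> (c * g x h / q x) (\<lambda>k. c * gs k x * cis \<theta> ^ k / q x) n
       = \<kappa> ^ n * (c / q x) * (g x h - (\<Sum>k<n. gs k x * h ^ k))"
      by (simp add: scaled_rem_def h_def power_divide right_diff_distrib sum_distrib_left mult_ac)
    then have "norm (scaled_rem \<kappa> (c * g x h / q x) (\<lambda>k. c * gs k x * cis \<theta> ^ k / q x) n)
       = norm \<kappa> ^ n / norm (q x) * norm (g x h - (\<Sum>k<n. gs k x * h ^ k))"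
      by (simp add: norm_mult norm_divide norm_power c)
    also have "\<dots> \<le> norm \<kappa> ^ n / norm (q x) * (norm (q x) * C * M ^ n * fact n * norm h ^ n)"
      by (intro mult_left_mono b x hS he) auto
    also have "\<dots> = C * M ^ n * fact n" using x(2) k0 unfolding hn by (simp add: power_divide)
    finally show "norm (scaled_rem \<kappa> (c * g x (cis \<theta> / \<kappa>) / q x) (\<lambda>k. c * gs k x * cis \<theta> ^ k / q x) n) \<le> C * M ^ n * fact n"
      by (simp add: h_def)
  qed (use C in auto)
qed

lemma formal_riccati_solution_coefficients:
  assumes "formal_riccati_solution W as bs cs fs" "x \<in> W"
  shows "(if n = 0 then 0 else deriv (fs (n - 1)) x) =
     (\<Sum>k\<le>n. as k x * (\<Sum>j\<le>n - k. fs j x * fs (n - k - j) x)) + (\<Sum>k\<le>n. bs k x * fs (n - k) x) + cs n x"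
proof -
  have "fps_X * Abs_fps (\<lambda>k. deriv (fs k) x) =
        Abs_fps (\<lambda>k. as k x) * (Abs_fps (\<lambda>k. fs k x))\<^sup>2
        + Abs_fps (\<lambda>k. bs k x) * Abs_fps (\<lambda>k. fs k x)
        + Abs_fps (\<lambda>k. cs k x)"
    using assms unfolding formal_riccati_solution_def by blast
  from arg_cong[OF this, of "\<lambda>F. fps_nth F n"]
  have "(if n = 0 then 0 else deriv (fs (n - 1)) x) =
     fps_nth (Abs_fps (\<lambda>k. as k x) * (Abs_fps (\<lambda>k. fs k x))\<^sup>2 + Abs_fps (\<lambda>k. bs k x) * Abs_fps (\<lambda>k. fs k x) + Abs_fps (\<lambda>k. cs k x)) n"
    by (simp only: fps_X_mult_nth fps_nth_Abs_fps)
  also have "\<dots> = (\<Sum>k\<le>n. as k x * (\<Sum>j\<le>n - k. fs j x * fs (n - k - j) x)) + (\<Sum>k\<le>n. bs k x * fs (n - k) x) + cs n x"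
    by (simp add: fps_mult_nth power2_eq_square atLeast0AtMost)
  finally show ?thesis .
qed

text \<open>This identifies the linearisation of the right-hand side at \<open>f0\<close>. Off the zeros of \<open>a0\<close>, and near
  \<open>x0\<close> if \<open>a0\<close> vanishes identically, it is the formula for \<open>f0\<close>; the identity theorem gives the rest.\<close>

lemma linear_coefficient_at_leading_solution:
  fixes a0 b0 q f0 :: "complex \<Rightarrow> complex"
  assumes X: "open X" "connected X" and W: "open W" "connected W" "W \<subseteq> X" "x0 \<in> W"
    and hol: "a0 holomorphic_on X" "b0 holomorphic_on X" "q holomorphic_on W"
    and f0: "leading_solution X W a0 b0 c0 q \<alpha> f0"
    and q0: "\<forall>x\<in>X. a0 x = 0 \<Longrightarrow> \<forall>\<^sub>F x in nhds x0. q x = b0 x"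
    and x: "x \<in> W"
  shows "2 * a0 x * f0 x + b0 x = of_real \<alpha> * q x"
proof -
  have h0: "f0 holomorphic_on W" using f0 by (simp add: leading_solution_def)
  have hW: "a0 holomorphic_on W" "b0 holomorphic_on W" using hol W holomorphic_on_subset by blast+
  have hL: "(\<lambda>x. 2 * a0 x * f0 x + b0 x) holomorphic_on W" "(\<lambda>x. of_real \<alpha> * q x) holomorphic_on W"
    by (intro holomorphic_intros h0 hW hol(3))+
  show ?thesis
  proof (cases "\<forall>x\<in>X. a0 x = 0")
    case True
    then have \<alpha>: "\<alpha> = 1" using f0 by (simp add: leading_solution_def)
    obtain T where T: "open T" "x0 \<in> T" "\<And>x. x \<in> T \<Longrightarrow> q x = b0 x"
      using q0[OF True] unfolding eventually_nhds by blast
    show ?thesis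
    proof (rule analytic_continuation_open[of "T \<inter> W" W, OF _ W(1) _ W(2) _ hL _ x])
      show "T \<inter> W \<noteq> {}" using T W by auto
      show "2 * a0 z * f0 z + b0 z = of_real \<alpha> * q z" if "z \<in> T \<inter> W" for z
        using that T True W \<alpha> by auto
    qed (use T W in auto)
  next
    case False
    define T where "T = W \<inter> a0 -` (- {0})"
    have "continuous_on W a0" using hW holomorphic_on_imp_continuous_on by blast
    then have "open T" unfolding T_def using W by (intro continuous_open_preimage) auto
    moreover have "T \<noteq> {}"
    proof
      assume "T = {}"
      then have z: "a0 z = 0" if "z \<in> W" for z using that by (auto simp: T_def)
      have "a0 y = 0" if "y \<in> X" for y
        by (rule analytic_continuation_open[of W X a0 "\<lambda>_. 0"]) (use W X hol z that in auto)
      then show False using False by blast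
    qed
    ultimately show ?thesis
    proof (rule analytic_continuation_open[of T W, OF _ W(1) _ W(2) _ hL _ x])
      show "2 * a0 z * f0 z + b0 z = of_real \<alpha> * q z" if "z \<in> T" for z
        using that f0 False by (auto simp: T_def leading_solution_def split: if_splits)
    qed (auto simp: T_def)
  qed
qed

lemma open_image_of_nonzero_deriv:
  assumes "f holomorphic_on G" "open G" "\<And>z. z \<in> G \<Longrightarrow> deriv f z \<noteq> 0" "T \<subseteq> G" "open T"
  shows "open (f ` T)"
  unfolding open_subopen[of "f ` T"]
proof
  fix y assume "y \<in> f ` T"
  then obtain z where z: "z \<in> T" "y = f z" by auto
  have fT: "f holomorphic_on T" using assms(1,4) by (rule holomorphic_on_subset)
  have dz: "deriv f z \<noteq> 0" using assms z by auto
  obtain \<rho> where "\<rho> > 0" "ball z \<rho> \<subseteq> T" "open (f ` ball z \<rho>)"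
    using has_complex_derivative_locally_invertible[OF fT z(1) assms(5) dz] .
  then show "\<exists>U. open U \<and> y \<in> U \<and> U \<subseteq> f ` T" using z by (intro exI[of _ "f ` ball z \<rho>"]) auto
qed

theorem theorem211026151811:
  fixes \<theta> \<alpha> :: real
    and X S W :: "complex set"
    and a b c :: "complex \<Rightarrow> complex \<Rightarrow> complex"
    and as bs cs fs :: "nat \<Rightarrow> complex \<Rightarrow> complex"
    and s q f0 :: "complex \<Rightarrow> complex"
    and x0 :: complex
  assumes X: "complex_domain X"
    and S: "sectorial_domain (\<theta> - pi / 2) (\<theta> + pi / 2) S"
    and S_borel: "\<exists>R>0. borel_disc \<theta> R \<subseteq> S"
    and hol: "holomorphic2_on a X S" "holomorphic2_on b X S" "holomorphic2_on c X S"
    and coeff_hol: "\<And>k. as k holomorphic_on X" "\<And>k. bs k holomorphic_on X"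
      "\<And>k. cs k holomorphic_on X"
    and asymp: "locally_uniform_asymp X S (\<theta> - pi / 2) (\<theta> + pi / 2) a as"
      "locally_uniform_asymp X S (\<theta> - pi / 2) (\<theta> + pi / 2) b bs"
      "locally_uniform_asymp X S (\<theta> - pi / 2) (\<theta> + pi / 2) c cs"
    and D0_nonzero: "\<exists>x\<in>X. discriminant0 (as 0) (bs 0) (cs 0) x \<noteq> 0"
    and x0: "x0 \<in> X" "discriminant0 (as 0) (bs 0) (cs 0) x0 \<noteq> 0"
    and branch: "\<exists>N. open N \<and> x0 \<in> N \<and> N \<subseteq> X \<and> s holomorphic_on N \<and>
        (\<forall>x\<in>N. (s x)\<^sup>2 = discriminant0 (as 0) (bs 0) (cs 0) x) \<and>
        ((\<forall>x\<in>X. as 0 x = 0) \<longrightarrow> (\<forall>x\<in>N. s x = bs 0 x))"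
    and sign: "\<alpha> \<in> {1, -1}"
    and W: "WKB_halfstrip X s x0 \<theta> \<alpha> W"
    and minus: "\<alpha> = -1 \<Longrightarrow> \<forall>x\<in>W. as 0 x \<noteq> 0"
    and branch_extension: "q holomorphic_on W"
      "\<forall>x\<in>W. (q x)\<^sup>2 = discriminant0 (as 0) (bs 0) (cs 0) x"
      "\<forall>\<^sub>F x in nhds x0. q x = s x"
    and f0: "leading_solution X W (as 0) (bs 0) (cs 0) q \<alpha> f0"
    and gevrey: "gevrey_asymp q W S a as" "gevrey_asymp q W S b bs" "gevrey_asymp q W S c cs"
    and formal: "formal_riccati_solution W as bs cs fs" "\<forall>x\<in>W. fs 0 x = f0 x"
  shows "\<forall>U0. complex_domain U0 \<and> compactly_contained U0 W \<longrightarrow>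
    (\<exists>S0 \<subseteq> S. sectorial_domain (\<theta> - pi / 2) (\<theta> + pi / 2) S0 \<and>
      (\<exists>f. riccati_solution U0 S0 a b c f \<and> gevrey_asymp (\<lambda>x. 1) U0 S0 f fs \<and>
        (\<forall>g. riccati_solution U0 S0 a b c g \<and> gevrey_asymp (\<lambda>x. 1) U0 S0 g fs \<longrightarrow>
           (\<forall>x\<in>U0. \<forall>h\<in>S0. g x h = f x h))))"
proof (intro allI impI)
  fix U0 assume U0: "complex_domain U0 \<and> compactly_contained U0 W"
  define d where "d = of_real \<alpha> * cis \<theta>"
  have \<alpha>: "of_real \<alpha> * of_real \<alpha> = (1::complex)" "norm (of_real \<alpha> :: complex) = 1" using sign by auto
  have nd: "norm d = 1" "d \<noteq> 0" using sign by (auto simp: d_def norm_mult)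
  obtain z1 r \<Psi>0 where r: "r > 0" and H0: "0 \<in> halfstrip \<theta> \<alpha> z1 r"
    and \<Psi>0: "\<Psi>0 holomorphic_on halfstrip \<theta> \<alpha> z1 r" "\<Psi>0 ` halfstrip \<theta> \<alpha> z1 r \<subseteq> X"
      "W = \<Psi>0 ` halfstrip \<theta> \<alpha> z1 r" "\<Psi>0 0 = x0"
    and ev: "\<forall>\<^sub>F z in nhds 0. contour_integral (linepath x0 (\<Psi>0 z)) s = z"
    using W unfolding WKB_halfstrip_def by blast
  define \<zeta>1 where "\<zeta>1 = z1 / d"
  define G where "G = hstrip \<zeta>1 r"
  have HG: "halfstrip \<theta> \<alpha> z1 r = (\<lambda>\<zeta>. d * \<zeta>) ` G"
    unfolding G_def \<zeta>1_def d_def by (rule halfstrip_eq_rotated_hstrip[OF sign])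
  have G: "open G" "convex G" "connected G" by (simp_all add: G_def open_hstrip convex_hstrip convex_connected)
  have G0: "0 \<in> G" using H0 nd unfolding HG by auto
  define \<Psi> where "\<Psi> = (\<lambda>\<zeta>. \<Psi>0 (d * \<zeta>))"
  have h\<Psi>: "\<Psi> holomorphic_on G" unfolding \<Psi>_def
    by (rule holomorphic_on_compose_gen[of "\<lambda>\<zeta>. d * \<zeta>" G \<Psi>0, unfolded o_def, OF _ \<Psi>0(1)])
       (auto intro!: holomorphic_intros simp: HG)
  have WG: "W = \<Psi> ` G" unfolding \<Psi>0(3) HG \<Psi>_def by (simp add: image_image)
  have WX: "W \<subseteq> X" using \<Psi>0 by simp
  have \<Psi>W: "\<Psi> \<zeta> \<in> W" if "\<zeta> \<in> G" for \<zeta> using that by (simp add: WG)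
  have x0W: "x0 \<in> W" unfolding WG using G0 \<Psi>0(4) by (auto simp: \<Psi>_def intro!: image_eqI[of _ _ 0])
  obtain N where N: "open N" "x0 \<in> N" "N \<subseteq> X" "s holomorphic_on N" "(\<forall>x\<in>X. as 0 x = 0) \<Longrightarrow> \<forall>x\<in>N. s x = bs 0 x"
    using branch by blast
  have Xo: "open X" "connected X" using X by (auto simp: complex_domain_def)

  \<comment> \<open>By hypothesis this holds near 0 only; it extends by the identity theorem.\<close>
  have d\<Psi>: "q (\<Psi> \<zeta>) * deriv \<Psi> \<zeta> = d" if "\<zeta> \<in> G" for \<zeta>
  proof -
    have oH: "open (halfstrip \<theta> \<alpha> z1 r)" "connected (halfstrip \<theta> \<alpha> z1 r)"
    proof -
      show "open (halfstrip \<theta> \<alpha> z1 r)" unfolding HG using nd G(1)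
        by (intro open_mapping_thm3) (auto intro!: holomorphic_intros inj_onI)
      show "connected (halfstrip \<theta> \<alpha> z1 r)" unfolding HG
        by (intro connected_continuous_image continuous_intros G(3))
    qed
    obtain e where e: "e > 0" "ball 0 e \<subseteq> halfstrip \<theta> \<alpha> z1 r" "\<And>z. z \<in> ball 0 e \<Longrightarrow> s (\<Psi>0 z) * deriv \<Psi>0 z = 1"
      using deriv_inverse_of_primitive[OF N(1,2,4) oH(1) H0 \<Psi>0(1,4) ev] by blast
    obtain T where T: "open T" "x0 \<in> T" "\<And>x. x \<in> T \<Longrightarrow> q x = s x"
      using branch_extension(3) unfolding eventually_nhds by blast
    have c0: "continuous_on (halfstrip \<theta> \<alpha> z1 r) \<Psi>0" using \<Psi>0(1) by (rule holomorphic_on_imp_continuous_on)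
    define B where "B = halfstrip \<theta> \<alpha> z1 r \<inter> \<Psi>0 -` T \<inter> ball 0 e"
    have oB: "open B" unfolding B_def using c0 oH T by (intro open_Int continuous_open_preimage) auto
    have B0: "0 \<in> B" using e T H0 \<Psi>0(4) by (simp add: B_def)
    have "q (\<Psi>0 z) * deriv \<Psi>0 z = 1" if z: "z \<in> halfstrip \<theta> \<alpha> z1 r" for z
    proof (rule analytic_continuation_open[of B "halfstrip \<theta> \<alpha> z1 r" "\<lambda>z. q (\<Psi>0 z) * deriv \<Psi>0 z" "\<lambda>_. 1"])
      have "(\<lambda>z. q (\<Psi>0 z)) holomorphic_on halfstrip \<theta> \<alpha> z1 r"
        by (rule holomorphic_on_compose_gen[OF \<Psi>0(1) branch_extension(1), unfolded o_def]) (simp add: \<Psi>0(3))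
      then show "(\<lambda>z. q (\<Psi>0 z) * deriv \<Psi>0 z) holomorphic_on halfstrip \<theta> \<alpha> z1 r"
        by (intro holomorphic_intros holomorphic_deriv \<Psi>0(1) oH)
      show "q (\<Psi>0 z) * deriv \<Psi>0 z = 1" if "z \<in> B" for z
        using that T(3)[of "\<Psi>0 z"] e(3)[of z] by (simp add: B_def)
    qed (use oB B0 oH z in \<open>auto simp: B_def\<close>)
    then have *: "q (\<Psi>0 (d * \<zeta>)) * deriv \<Psi>0 (d * \<zeta>) = 1" using that by (auto simp: HG)
    have "(\<Psi>0 has_field_derivative deriv \<Psi>0 (d * \<zeta>)) (at (d * \<zeta>))"
      using \<Psi>0(1) oH(1) by (rule holomorphic_derivI) (use that in \<open>auto simp: HG\<close>)
    moreover have "((\<lambda>\<zeta>. d * \<zeta>) has_field_derivative d) (at \<zeta>)" by (auto intro!: derivative_eq_intros)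
    ultimately have "(\<Psi> has_field_derivative deriv \<Psi>0 (d * \<zeta>) * d) (at \<zeta>)"
      unfolding \<Psi>_def by (rule DERIV_chain2)
    then have "deriv \<Psi> \<zeta> = deriv \<Psi>0 (d * \<zeta>) * d" by (rule DERIV_imp_deriv)
    with * show ?thesis by (simp add: \<Psi>_def mult.assoc[symmetric])
  qed
  have qnz: "q (\<Psi> \<zeta>) \<noteq> 0" and \<Psi>'nz: "deriv \<Psi> \<zeta> \<noteq> 0" if "\<zeta> \<in> G" for \<zeta>
    using d\<Psi>[OF that] nd by auto
  have oW: "open W" unfolding WG by (rule open_image_of_nonzero_deriv[OF h\<Psi> G(1) \<Psi>'nz]) (use G in auto)
  have cW: "connected W" unfolding WG
    using h\<Psi> G by (intro connected_continuous_image holomorphic_on_imp_continuous_on)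
  have q0: "\<forall>\<^sub>F x in nhds x0. q x = bs 0 x" if "\<forall>x\<in>X. as 0 x = 0"
  proof -
    have "\<forall>\<^sub>F x in nhds x0. x \<in> N" using N by (intro eventually_nhds_in_open)
    with branch_extension(3) show ?thesis by eventually_elim (use N(5) that in auto)
  qed
  have lin: "2 * as 0 x * fs 0 x + bs 0 x = of_real \<alpha> * q x" if "x \<in> W" for x
    using linear_coefficient_at_leading_solution[OF Xo oW cW WX x0W coeff_hol(1)[of 0] coeff_hol(2)[of 0] branch_extension(1) f0 q0 that]
      formal(2) that by simp

  \<comment> \<open>The factor \<open>\<alpha>\<close> makes the linear coefficient equal to 1 for either sign, and the powers of
    \<open>cis \<theta>\<close> convert expansions in \<open>h = cis \<theta> / \<kappa>\<close> into expansions in \<open>1 / \<kappa>\<close>.\<close>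
  define scale where "scale = (\<lambda>g x \<kappa>. of_real \<alpha> * g x (cis \<theta> / \<kappa>) / q x :: complex)"
  define scales where "scales = (\<lambda>gs k x. of_real \<alpha> * gs k x * cis \<theta> ^ k / q x :: complex)"
  obtain R1 where R1: "R1 > 0" "borel_disc \<theta> R1 \<subseteq> S" using S_borel by blast
  obtain Ca Ma Ra where A: "Ca \<ge> 0" "Ma \<ge> 0" "Ra \<ge> R1"
    "\<And>x \<kappa> n. x \<in> W \<Longrightarrow> q x \<noteq> 0 \<Longrightarrow> Re \<kappa> > Ra \<Longrightarrow> norm (scaled_rem \<kappa> (scale a x \<kappa>) (\<lambda>k. scales as k x) n) \<le> Ca * Ma ^ n * fact n"
    using scaled_rem_bound_of_gevrey_asymp[OF gevrey(1) R1(2,1) \<alpha>(2)] unfolding scale_def scales_def by blast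
  obtain Cb Mb Rb where B: "Cb \<ge> 0" "Mb \<ge> 0" "Rb \<ge> R1"
    "\<And>x \<kappa> n. x \<in> W \<Longrightarrow> q x \<noteq> 0 \<Longrightarrow> Re \<kappa> > Rb \<Longrightarrow> norm (scaled_rem \<kappa> (scale b x \<kappa>) (\<lambda>k. scales bs k x) n) \<le> Cb * Mb ^ n * fact n"
    using scaled_rem_bound_of_gevrey_asymp[OF gevrey(2) R1(2,1) \<alpha>(2)] unfolding scale_def scales_def by blast
  obtain Cc Mc Rc where C: "Cc \<ge> 0" "Mc \<ge> 0" "Rc \<ge> R1"
    "\<And>x \<kappa> n. x \<in> W \<Longrightarrow> q x \<noteq> 0 \<Longrightarrow> Re \<kappa> > Rc \<Longrightarrow> norm (scaled_rem \<kappa> (scale c x \<kappa>) (\<lambda>k. scales cs k x) n) \<le> Cc * Mc ^ n * fact n"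
    using scaled_rem_bound_of_gevrey_asymp[OF gevrey(3) R1(2,1) \<alpha>(2)] unfolding scale_def scales_def by blast
  define C0 where "C0 = max Ca (max Cb Cc)"
  define M where "M = max Ma (max Mb Mc)"
  define R0 where "R0 = max Ra (max Rb Rc)"
  have C0: "C0 \<ge> 0" "Ca \<le> C0" "Cb \<le> C0" "Cc \<le> C0" using A B C by (auto simp: C0_def)
  have M: "M \<ge> 0" "Ma \<le> M" "Mb \<le> M" "Mc \<le> M" using A B C by (auto simp: M_def)
  have R0: "R0 \<ge> R1" "Ra \<le> R0" "Rb \<le> R0" "Rc \<le> R0" using A B C by (auto simp: R0_def)
  have mono: "u * v ^ n * fact n \<le> C0 * M ^ n * fact n" if "0 \<le> u" "u \<le> C0" "0 \<le> v" "v \<le> M" for u v :: real and n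
    using that C0 M by (intro mult_right_mono mult_mono power_mono) auto
  define F' where "F' = (\<lambda>k \<zeta>. fs k (\<Psi> \<zeta>) * cis \<theta> ^ k)"
  have cishS: "cis \<theta> / \<kappa> \<in> S" if "Re \<kappa> > R0" for \<kappa>
  proof -
    have k0: "\<kappa> \<noteq> 0" using that R0 R1 by auto
    then have "cis \<theta> / \<kappa> \<in> borel_disc \<theta> R1" using that R0 by (simp add: borel_disc_def)
    then show ?thesis using R1 by blast
  qed
  have q\<Psi>: "(\<lambda>\<zeta>. q (\<Psi> \<zeta>)) holomorphic_on G"
    by (rule holomorphic_on_compose_gen[OF h\<Psi> branch_extension(1), unfolded o_def]) (simp add: WG)
  have comp\<Psi>: "(\<lambda>\<zeta>. g (\<Psi> \<zeta>)) holomorphic_on G" if "g holomorphic_on W" for g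
    by (rule holomorphic_on_compose_gen[OF h\<Psi> that, unfolded o_def]) (simp add: WG)
  have sh: "sep_holo (\<lambda>\<zeta>. scale g (\<Psi> \<zeta>)) G {\<kappa>. Re \<kappa> > R0}" if "holomorphic2_on g X S" for g
  proof -
    have "sep_holo g X S" using that unfolding holomorphic2_on_def by (intro sep_holo_of_has_derivative) blast
    then have "sep_holo (\<lambda>\<zeta> \<kappa>. g (\<Psi> \<zeta>) (cis \<theta> / \<kappa>)) G {\<kappa>. Re \<kappa> > R0}"
    proof (rule sep_holo_compose[OF _ h\<Psi>])
      show "\<Psi> ` G \<subseteq> X" using WG WX by simp
      show "(\<lambda>\<kappa>. cis \<theta> / \<kappa>) holomorphic_on {\<kappa>. R0 < Re \<kappa>}"
        using R0 R1 by (intro holomorphic_intros) auto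
      show "(\<lambda>\<kappa>. cis \<theta> / \<kappa>) ` {\<kappa>. R0 < Re \<kappa>} \<subseteq> S" using cishS by auto
    qed
    then show ?thesis unfolding scale_def
      by (intro sep_holo_divide sep_holo_mult sep_holo_const_fst[OF holomorphic_on_const] sep_holo_const_fst[OF q\<Psi>]) (use qnz in auto)
  qed
  have hs: "(\<lambda>\<zeta>. scales gs k (\<Psi> \<zeta>)) holomorphic_on G" if "gs k holomorphic_on X" for gs k
  proof -
    have "gs k holomorphic_on W" using that WX by (rule holomorphic_on_subset)
    then show ?thesis unfolding scales_def using qnz by (intro holomorphic_intros comp\<Psi> q\<Psi>) auto
  qed
  have hF': "F' k holomorphic_on G" for k
    unfolding F'_def using formal(1) by (intro holomorphic_intros comp\<Psi>) (simp add: formal_riccati_solution_def)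
  have formal': "(if n = 0 then 0 else deriv (F' (n - 1)) \<zeta>) =
        (\<Sum>k\<le>n. scales as k (\<Psi> \<zeta>) * (\<Sum>j\<le>n - k. F' j \<zeta> * F' (n - k - j) \<zeta>)) + (\<Sum>k\<le>n. scales bs k (\<Psi> \<zeta>) * F' (n - k) \<zeta>) + scales cs n (\<Psi> \<zeta>)"
    if \<zeta>: "\<zeta> \<in> G" for n \<zeta>
  proof -
    define x where "x = \<Psi> \<zeta>"
    have xW: "x \<in> W" using \<Psi>W[OF \<zeta>] by (simp add: x_def)
    let ?t = "of_real \<alpha> * cis \<theta> ^ n / q x :: complex"
    have L: "(if n = 0 then 0 else deriv (F' (n - 1)) \<zeta>) = ?t * (if n = 0 then 0 else deriv (fs (n - 1)) x)"
    proof (cases n)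
      case (Suc m)
      have "fs m holomorphic_on W" using formal(1) by (simp add: formal_riccati_solution_def)
      then have 1: "(fs m has_field_derivative deriv (fs m) x) (at (\<Psi> \<zeta>))" unfolding x_def
        using oW \<Psi>W[OF \<zeta>] by (rule holomorphic_derivI)
      have 2: "(\<Psi> has_field_derivative deriv \<Psi> \<zeta>) (at \<zeta>)" using h\<Psi> G(1) \<zeta> by (rule holomorphic_derivI)
      have "deriv (F' m) \<zeta> = deriv (fs m) x * deriv \<Psi> \<zeta> * cis \<theta> ^ m"
        unfolding F'_def by (rule DERIV_imp_deriv) (rule DERIV_cmult_right[OF DERIV_chain2[OF 1 2]])
      also have "deriv \<Psi> \<zeta> = d / q x" using d\<Psi>[OF \<zeta>] qnz[OF \<zeta>] by (simp add: x_def field_simps)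
      finally show ?thesis by (simp add: Suc d_def)
    qed simp
    have S1: "(\<Sum>k\<le>n. scales as k x * (\<Sum>j\<le>n - k. F' j \<zeta> * F' (n - k - j) \<zeta>)) = ?t * (\<Sum>k\<le>n. as k x * (\<Sum>j\<le>n - k. fs j x * fs (n - k - j) x))"
      unfolding sum_distrib_left
    proof (intro sum.cong refl)
      fix k j assume k: "k \<in> {..n}" and j: "j \<in> {..n - k}"
      have "cis \<theta> ^ n = cis \<theta> ^ k * (cis \<theta> ^ j * cis \<theta> ^ (n - k - j))"
        using k j by (simp add: power_add[symmetric] del: diff_diff_left)
      then show "scales as k x * (F' j \<zeta> * F' (n - k - j) \<zeta>) = ?t * (as k x * (fs j x * fs (n - k - j) x))"
        by (simp add: scales_def F'_def x_def del: diff_diff_left)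
    qed
    have S2: "(\<Sum>k\<le>n. scales bs k x * F' (n - k) \<zeta>) = ?t * (\<Sum>k\<le>n. bs k x * fs (n - k) x)"
      unfolding sum_distrib_left
    proof (intro sum.cong refl)
      fix k assume k: "k \<in> {..n}"
      have "cis \<theta> ^ n = cis \<theta> ^ k * cis \<theta> ^ (n - k)" using k by (simp add: power_add[symmetric])
      then show "scales bs k x * F' (n - k) \<zeta> = ?t * (bs k x * fs (n - k) x)" by (simp add: scales_def F'_def x_def)
    qed
    have S3: "scales cs n x = ?t * cs n x" by (simp add: scales_def)
    show ?thesis
      unfolding L formal_riccati_solution_coefficients[OF formal(1) xW] x_def[symmetric] S1 S2 S3 by (simp only: distrib_left)
  qed
  have lin': "2 * scales as 0 (\<Psi> \<zeta>) * F' 0 \<zeta> + scales bs 0 (\<Psi> \<zeta>) = 1" if \<zeta>: "\<zeta> \<in> G" for \<zeta>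
  proof -
    have "2 * scales as 0 (\<Psi> \<zeta>) * F' 0 \<zeta> + scales bs 0 (\<Psi> \<zeta>) = of_real \<alpha> * (2 * as 0 (\<Psi> \<zeta>) * fs 0 (\<Psi> \<zeta>) + bs 0 (\<Psi> \<zeta>)) / q (\<Psi> \<zeta>)"
      by (simp add: scales_def F'_def add_divide_distrib distrib_left mult_ac)
    also have "\<dots> = 1" unfolding lin[OF \<Psi>W[OF \<zeta>]] using qnz[OF \<zeta>] \<alpha>(1) by (simp add: mult.assoc[symmetric])
    finally show ?thesis .
  qed

  \<comment> \<open>The sets \<open>T n\<close> exhaust the halfstrip and their images are open, so one of these
    images contains the compact closure of \<open>U0\<close>.\<close>
  define rn where "rn = (\<lambda>n::nat. r - r / (real n + 2))"
  define T where "T = (\<lambda>n. hstrip \<zeta>1 (rn n) \<inter> ball 0 (real n))"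
  have rn: "rn n < r" for n using r by (simp add: rn_def)
  have TG: "T n \<subseteq> G" for n using hstrip_mono[of "rn n" r \<zeta>1] rn[of n] by (auto simp: T_def G_def)
  have oT: "open (\<Psi> ` T n)" for n
    by (rule open_image_of_nonzero_deriv[OF h\<Psi> G(1) \<Psi>'nz TG]) (auto simp: T_def open_hstrip)
  have Tmono: "T m \<subseteq> T n" if "m \<le> n" for m n
  proof -
    have "rn m \<le> rn n" using that r by (auto simp: rn_def intro!: divide_left_mono)
    then show ?thesis using hstrip_mono[of "rn m" "rn n" \<zeta>1] that by (auto simp: T_def)
  qed
  have Tcover: "\<exists>n. \<zeta> \<in> T n" if \<zeta>: "\<zeta> \<in> G" for \<zeta>
  proof -
    obtain t where t: "t \<ge> 0" "dist (\<zeta>1 + of_real t) \<zeta> < r" using \<zeta> unfolding G_def hstrip_iff by blast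
    define e where "e = (r - dist (\<zeta>1 + of_real t) \<zeta>) / r"
    have e: "e > 0" using t r by (simp add: e_def)
    obtain n1 :: nat where n1: "1 / e < real n1" using reals_Archimedean2 by blast
    obtain n2 :: nat where n2: "norm \<zeta> < real n2" using reals_Archimedean2 by blast
    define n where "n = max n1 n2"
    have "1 / e < real n + 2" using n1 by (simp add: n_def)
    then have "1 < e * (real n + 2)" using e by (simp add: field_simps)
    then have "1 / (real n + 2) < e" by (simp add: field_simps)
    then have "r * (1 / (real n + 2)) < r * e" using r by (intro mult_strict_left_mono) auto
    then have "r / (real n + 2) < r - dist (\<zeta>1 + of_real t) \<zeta>" using r by (simp add: e_def)
    then have "dist (\<zeta>1 + of_real t) \<zeta> < rn n" by (simp add: rn_def)
    then have "\<zeta> \<in> T n" using t n2 by (auto simp: T_def hstrip_iff n_def)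
    then show ?thesis by blast
  qed
  obtain n where U0T: "U0 \<subseteq> \<Psi> ` T n"
  proof -
    have cU: "compact (closure U0)" "closure U0 \<subseteq> W" using U0 by (auto simp: compactly_contained_def)
    have cover: "closure U0 \<subseteq> (\<Union>n\<in>UNIV. \<Psi> ` T n)"
    proof
      fix x assume "x \<in> closure U0"
      then obtain \<zeta> where \<zeta>: "\<zeta> \<in> G" "x = \<Psi> \<zeta>" using cU(2) unfolding WG by auto
      obtain n where "\<zeta> \<in> T n" using Tcover[OF \<zeta>(1)] by (rule exE)
      then show "x \<in> (\<Union>n\<in>UNIV. \<Psi> ` T n)" using \<zeta>(2) by (intro UN_I[of n] imageI) simp_all
    qed
    obtain N' where N': "finite N'" "closure U0 \<subseteq> (\<Union>n\<in>N'. \<Psi> ` T n)"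
      by (rule compactE_image[OF cU(1) oT cover])
    have "(\<Union>n\<in>N'. \<Psi> ` T n) \<subseteq> \<Psi> ` T (Max (insert 0 N'))"
      using N'(1) by (intro UN_least image_mono Tmono) simp
    then have "U0 \<subseteq> \<Psi> ` T (Max (insert 0 N'))" using N'(2) closure_subset[of U0] by (meson order_trans)
    then show ?thesis by (rule that)
  qed
  define V where "V = T n"
  have VG: "V \<subseteq> G" and oV: "open V" using TG by (auto simp: V_def T_def open_hstrip)

  obtain R U F D Q where R: "R \<ge> R0" and VU: "V \<subseteq> U" and U: "open U" "U \<subseteq> G" and DQ: "D \<ge> 0" "Q \<ge> 1"
    and F: "sep_holo F U {\<kappa>. Re \<kappa> > R}"
    and ode: "\<And>z \<kappa>. z \<in> U \<Longrightarrow> Re \<kappa> > R \<Longrightarrow> deriv (\<lambda>z. F z \<kappa>) z =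
        \<kappa> * (scale a (\<Psi> z) \<kappa> * (F z \<kappa>)\<^sup>2 + scale b (\<Psi> z) \<kappa> * F z \<kappa> + scale c (\<Psi> z) \<kappa>)"
    and est: "\<And>n z \<kappa>. z \<in> V \<Longrightarrow> Re \<kappa> > R \<Longrightarrow> norm (scaled_rem \<kappa> (F z \<kappa>) (\<lambda>k. F' k z) n) \<le> D * Q ^ n * fact n"
  proof (rule Riccati_halfstrip_solution[of "\<lambda>k \<zeta>. scales as k (\<Psi> \<zeta>)" \<zeta>1 r "\<lambda>k \<zeta>. scales bs k (\<Psi> \<zeta>)" "\<lambda>k \<zeta>. scales cs k (\<Psi> \<zeta>)"
        F' R0 C0 M "\<lambda>\<zeta>. scale a (\<Psi> \<zeta>)" "\<lambda>\<zeta>. scale b (\<Psi> \<zeta>)" "\<lambda>\<zeta>. scale c (\<Psi> \<zeta>)" V "rn n", folded G_def])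
    show "V \<subseteq> hstrip \<zeta>1 (rn n)" "bounded V" by (auto simp: V_def T_def)
    fix k \<zeta> \<kappa> assume \<zeta>: "\<zeta> \<in> G" and \<kappa>: "R0 < Re \<kappa>"
    show "norm (scaled_rem \<kappa> (scale a (\<Psi> \<zeta>) \<kappa>) (\<lambda>k. scales as k (\<Psi> \<zeta>)) k) \<le> C0 * M ^ k * fact k"
      by (rule order.trans[OF A(4) mono]) (use \<zeta> \<kappa> A B C C0 M R0 \<Psi>W qnz in auto)
    show "norm (scaled_rem \<kappa> (scale b (\<Psi> \<zeta>) \<kappa>) (\<lambda>k. scales bs k (\<Psi> \<zeta>)) k) \<le> C0 * M ^ k * fact k"
      by (rule order.trans[OF B(4) mono]) (use \<zeta> \<kappa> A B C C0 M R0 \<Psi>W qnz in auto)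
    show "norm (scaled_rem \<kappa> (scale c (\<Psi> \<zeta>) \<kappa>) (\<lambda>k. scales cs k (\<Psi> \<zeta>)) k) \<le> C0 * M ^ k * fact k"
      by (rule order.trans[OF C(4) mono]) (use \<zeta> \<kappa> A B C C0 M R0 \<Psi>W qnz in auto)
  qed (use hs coeff_hol hF' formal' lin' sh hol C0 M R0 R1 rn in auto)
  have Rpos: "R > 0" "R \<ge> R1" using R R0 R1 by auto
  have Fk: "F z holomorphic_on {\<kappa>. Re \<kappa> > R}" if "z \<in> V" for z using F VU that by (auto simp: sep_holo_def)
  \<comment> \<open>At both points the expansion is the formal solution at the common image.\<close>
  have welldef: "F z \<kappa> = F z' \<kappa>" if z: "z \<in> V" "z' \<in> V" "\<Psi> z = \<Psi> z'" and \<kappa>: "Re \<kappa> > R" for z z' \<kappa>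
  proof (rule Gevrey_expansion_unique[where R = R and R' = R and gs = "\<lambda>k. F' k z", OF Fk[OF z(1)] Fk[OF z(2)] _ _ DQ(1) DQ(1) _ _ est[OF z(1)] _ \<kappa>])
    have "(\<lambda>k. F' k z) = (\<lambda>k. F' k z')" using z(3) by (simp add: F'_def)
    then show "norm (scaled_rem \<kappa> (F z' \<kappa>) (\<lambda>k. F' k z) n) \<le> D * Q ^ n * fact n" if "Re \<kappa> > R" for \<kappa> n
      using est[OF z(2) that] by simp
  qed (use Rpos DQ in auto)
  define f where "f = (\<lambda>x h. F (SOME z. z \<in> V \<and> \<Psi> z = x) (cis \<theta> / h))"
  define S0 where "S0 = borel_disc \<theta> R"
  have S0: "h \<noteq> 0" "Re (cis \<theta> / h) > R" if "h \<in> S0" for h using that by (auto simp: S0_def borel_disc_def)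
  have feq: "f (\<Psi> z) h = F z (cis \<theta> / h)" if z: "z \<in> V" and h: "h \<in> S0" for z h
  proof -
    have "(SOME z'. z' \<in> V \<and> \<Psi> z' = \<Psi> z) \<in> V \<and> \<Psi> (SOME z'. z' \<in> V \<and> \<Psi> z' = \<Psi> z) = \<Psi> z"
      by (rule someI[of "\<lambda>z'. z' \<in> V \<and> \<Psi> z' = \<Psi> z" z]) (use z in auto)
    then show ?thesis unfolding f_def using welldef S0(2)[OF h] z by metis
  qed
  have oS0: "open S0" unfolding S0_def borel_disc_eq_ball[OF Rpos(1)] by simp
  have S0S: "S0 \<subseteq> S"
  proof -
    have "S0 \<subseteq> borel_disc \<theta> R1" using Rpos by (auto simp: S0_def borel_disc_def)
    then show ?thesis using R1 by blast
  qed
  have local_inverse: "\<exists>N\<psi> \<psi>. open N\<psi> \<and> x \<in> N\<psi> \<and> \<psi> holomorphic_on N\<psi> \<and> \<psi> ` N\<psi> \<subseteq> V \<and> (\<forall>y\<in>N\<psi>. \<Psi> (\<psi> y) = y) \<and> deriv \<psi> x = q x / d"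
    if x: "x \<in> U0" for x
  proof -
    obtain z where z: "z \<in> V" "x = \<Psi> z" using U0T x by (auto simp: V_def)
    have hV: "\<Psi> holomorphic_on V" using h\<Psi> VG by (rule holomorphic_on_subset)
    have zG: "z \<in> G" using z VG by auto
    obtain \<rho> where \<rho>: "\<rho> > 0" "ball z \<rho> \<subseteq> V" "open (\<Psi> ` ball z \<rho>)" "inj_on \<Psi> (ball z \<rho>)"
      using has_complex_derivative_locally_invertible[OF hV z(1) oV \<Psi>'nz[OF zG]] .
    have hB: "\<Psi> holomorphic_on ball z \<rho>" using hV \<rho>(2) by (rule holomorphic_on_subset)
    obtain \<psi> where \<psi>: "\<psi> holomorphic_on \<Psi> ` ball z \<rho>" "\<And>w. w \<in> ball z \<rho> \<Longrightarrow> deriv \<Psi> w * deriv \<psi> (\<Psi> w) = 1"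
       "\<And>w. w \<in> ball z \<rho> \<Longrightarrow> \<psi> (\<Psi> w) = w"
      using holomorphic_has_inverse[OF hB open_ball \<rho>(4)] by blast
    have zb: "z \<in> ball z \<rho>" using \<rho> by simp
    have "deriv \<psi> x = q x / d"
    proof -
      have "deriv \<Psi> z \<noteq> 0" using \<Psi>'nz zG by blast
      then have "deriv \<psi> x = 1 / deriv \<Psi> z" using \<psi>(2)[OF zb] by (simp add: z(2) field_simps)
      also have "\<dots> = q x / d" using d\<Psi>[OF zG] \<open>deriv \<Psi> z \<noteq> 0\<close> nd by (simp add: z(2) field_simps)
      finally show ?thesis .
    qed
    moreover have "\<psi> ` (\<Psi> ` ball z \<rho>) \<subseteq> V" "\<forall>y\<in>\<Psi> ` ball z \<rho>. \<Psi> (\<psi> y) = y" using \<psi>(3) \<rho>(2) by auto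
    ultimately show ?thesis using \<rho>(3) \<psi>(1) zb z(2) by blast
  qed
  have ric: "riccati_solution U0 S0 a b c f"
    unfolding riccati_solution_def holomorphic2_on_def
  proof (intro conjI ballI)
    fix x h assume x: "x \<in> U0" and h: "h \<in> S0"
    obtain N\<psi> \<psi> where \<psi>: "open N\<psi>" "x \<in> N\<psi>" "\<psi> holomorphic_on N\<psi>" "\<psi> ` N\<psi> \<subseteq> V" "\<forall>y\<in>N\<psi>. \<Psi> (\<psi> y) = y" "deriv \<psi> x = q x / d"
      using local_inverse[OF x] by blast
    have loc: "f y k = F (\<psi> y) (cis \<theta> / k)" if "y \<in> N\<psi>" "k \<in> S0" for y k
      using feq[of "\<psi> y" k] \<psi>(4,5) that by auto
    have "sep_holo (\<lambda>y k. F (\<psi> y) (cis \<theta> / k)) N\<psi> S0"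
      by (rule sep_holo_compose[OF F \<psi>(3)]) (use \<psi>(4) VU S0 in \<open>auto intro!: holomorphic_intros\<close>)
    from sep_holo_has_derivative[OF this \<psi>(1) oS0 \<psi>(2) h]
    obtain u v where "((\<lambda>(y, k). F (\<psi> y) (cis \<theta> / k)) has_derivative (\<lambda>(u', v'). u * u' + v * v')) (at (x, h))" by blast
    then have "((\<lambda>(y, k). f y k) has_derivative (\<lambda>(u', v'). u * u' + v * v')) (at (x, h))"
      by (rule has_derivative_transform_within_open[of _ _ _ _ "N\<psi> \<times> S0"]) (use \<psi> oS0 h loc in \<open>auto intro: open_Times\<close>)
    then show "\<exists>p q. ((\<lambda>(y, k). f y k) has_derivative (\<lambda>(u, v). p * u + q * v)) (at (x, h))" by blast
    define \<kappa> where "\<kappa> = cis \<theta> / h"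
    have \<kappa>: "Re \<kappa> > R" "h * \<kappa> = cis \<theta>" "cis \<theta> / \<kappa> = h" using S0[OF h] by (auto simp: \<kappa>_def)
    define z where "z = \<psi> x"
    have z: "z \<in> V" "\<Psi> z = x" using \<psi> by (auto simp: z_def)
    have zU: "z \<in> U" and zG: "z \<in> G" using z VU VG by auto
    have fx: "f x h = F z \<kappa>" using loc[OF \<psi>(2) h] by (simp add: z_def \<kappa>_def)
    have dF: "((\<lambda>w. F w \<kappa>) has_field_derivative deriv (\<lambda>w. F w \<kappa>) z) (at (\<psi> x))"
      unfolding z_def using F \<kappa>(1) U(1) zU[unfolded z_def] by (intro holomorphic_derivI[of _ U]) (auto simp: sep_holo_def)
    have d\<psi>: "(\<psi> has_field_derivative q x / d) (at x)"
      using holomorphic_derivI[OF \<psi>(3,1,2)] \<psi>(6) by simp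
    have "((\<lambda>y. f y h) has_field_derivative deriv (\<lambda>w. F w \<kappa>) z * (q x / d)) (at x)"
      by (rule has_field_derivative_transform_within_open[OF DERIV_chain2[OF dF d\<psi>] \<psi>(1,2)]) (use loc h in \<open>simp add: \<kappa>_def\<close>)
    then have "h * deriv (\<lambda>y. f y h) x = h * (deriv (\<lambda>w. F w \<kappa>) z * (q x / d))" by (simp add: DERIV_imp_deriv)
    also have "\<dots> = (h * \<kappa>) * (scale a x \<kappa> * (f x h)\<^sup>2 + scale b x \<kappa> * f x h + scale c x \<kappa>) * (q x / d)"
      unfolding ode[OF zU \<kappa>(1)] fx z(2) by (simp only: mult_ac)
    also have "\<dots> = a x h * (f x h)\<^sup>2 + b x h * f x h + c x h"
    proof -
      have qx: "q x \<noteq> 0" using qnz[OF zG] z by simp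
      have "scale a x \<kappa> * (f x h)\<^sup>2 + scale b x \<kappa> * f x h + scale c x \<kappa> = of_real \<alpha> * (a x h * (f x h)\<^sup>2 + b x h * f x h + c x h) / q x"
        unfolding scale_def \<kappa>(3) by (simp add: add_divide_distrib distrib_left mult.assoc)
      moreover have "cis \<theta> * (of_real \<alpha> * Y / q x) * (q x / d) = Y" for Y
        using qx sign by (auto simp: d_def)
      ultimately show ?thesis unfolding \<kappa>(2) by simp
    qed
    finally show "h * deriv (\<lambda>y. f y h) x = a x h * (f x h)\<^sup>2 + b x h * f x h + c x h" .
  qed
  have rem_f: "scaled_rem \<kappa> y (\<lambda>k. fs k x * cis \<theta> ^ k) n = \<kappa> ^ n * (y - (\<Sum>k<n. fs k x * (cis \<theta> / \<kappa>) ^ k))" for \<kappa> y x n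
    by (simp add: scaled_rem_def power_divide)
  have fest: "norm (f x h - (\<Sum>k<n. fs k x * h ^ k)) \<le> D * Q ^ n * fact n * norm h ^ n" if x: "x \<in> U0" and h: "h \<in> S0" for x h n
  proof -
    obtain z where z: "z \<in> V" "x = \<Psi> z" using U0T x by (auto simp: V_def)
    define \<kappa> where "\<kappa> = cis \<theta> / h"
    have \<kappa>: "Re \<kappa> > R" "cis \<theta> / \<kappa> = h" "norm \<kappa> = 1 / norm h" "norm h > 0" using S0[OF h] by (auto simp: \<kappa>_def norm_divide)
    have "norm (scaled_rem \<kappa> (F z \<kappa>) (\<lambda>k. F' k z) n) \<le> D * Q ^ n * fact n" by (rule est[OF z(1) \<kappa>(1)])
    then have "(1 / norm h) ^ n * norm (f x h - (\<Sum>k<n. fs k x * h ^ k)) \<le> D * Q ^ n * fact n"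
      unfolding F'_def rem_f z(2)[symmetric] using feq[OF z(1) h] by (simp add: norm_mult norm_power \<kappa> z(2) \<kappa>_def[symmetric])
    then show ?thesis using \<kappa>(4) by (simp add: power_divide field_simps)
  qed
  have gf: "gevrey_asymp (\<lambda>x. 1) U0 S0 f fs"
    unfolding gevrey_asymp_def
  proof (rule exI[of _ "D + 1"], rule conjI[OF _ exI[of _ Q]], use DQ in simp,
      rule conjI[OF _ exI[of _ 1]], use DQ in simp, rule conjI, simp, intro allI ballI impI)
    fix n x h assume x: "x \<in> U0" and h: "h \<in> S0"
    have "norm (f x h - (\<Sum>k<n. fs k x * h ^ k)) \<le> D * Q ^ n * fact n * norm h ^ n" by (rule fest[OF x h])
    also have "\<dots> \<le> norm (1::complex) * (D + 1) * Q ^ n * fact n * norm h ^ n"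
      using DQ by (intro mult_right_mono) auto
    finally show "norm (f x h - (\<Sum>k<n. fs k x * h ^ k)) \<le> norm (1::complex) * (D + 1) * Q ^ n * fact n * norm h ^ n" .
  qed
  have uniq: "g x h = f x h" if g: "riccati_solution U0 S0 a b c g" "gevrey_asymp (\<lambda>x. 1) U0 S0 g fs" and x: "x \<in> U0" and h: "h \<in> S0" for g x h
  proof -
    obtain C2 M2 \<epsilon> where e: "C2 > 0" "M2 > 0" "\<epsilon> > 0"
      and b2: "\<And>n h. h \<in> S0 \<Longrightarrow> norm h < \<epsilon> \<Longrightarrow> norm (g x h - (\<Sum>k<n. fs k x * h ^ k)) \<le> norm (1::complex) * C2 * M2 ^ n * fact n * norm h ^ n"
      using g(2) x unfolding gevrey_asymp_def by blast
    have hk: "cis \<theta> / \<kappa> \<in> S0" "\<kappa> \<noteq> 0" if "Re \<kappa> > R" for \<kappa>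
    proof -
      show "\<kappa> \<noteq> 0" using that Rpos by auto
      then show "cis \<theta> / \<kappa> \<in> S0" using that by (auto simp: S0_def borel_disc_def)
    qed
    have hol2: "(\<lambda>\<kappa>. w x (cis \<theta> / \<kappa>)) holomorphic_on {\<kappa>. Re \<kappa> > R}" if "riccati_solution U0 S0 a b c w" for w
    proof -
      have "sep_holo w U0 S0" using that unfolding riccati_solution_def holomorphic2_on_def by (intro sep_holo_of_has_derivative) blast
      then have "w x holomorphic_on S0" using x by (simp add: sep_holo_def)
      then show ?thesis
        by (intro holomorphic_on_compose_gen[of "\<lambda>\<kappa>. cis \<theta> / \<kappa>" _ "w x" S0, unfolded o_def] holomorphic_intros) (use hk in auto)
    qed
    have rb: "norm (scaled_rem \<kappa> y (\<lambda>k. fs k x * cis \<theta> ^ k) n) \<le> B"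
      if "Re \<kappa> > R" "norm (y - (\<Sum>k<n. fs k x * (cis \<theta> / \<kappa>) ^ k)) \<le> B * norm (cis \<theta> / \<kappa>) ^ n" for \<kappa> y n B
    proof -
      have "norm \<kappa> ^ n * norm (y - (\<Sum>k<n. fs k x * (cis \<theta> / \<kappa>) ^ k)) \<le> norm \<kappa> ^ n * (B * norm (cis \<theta> / \<kappa>) ^ n)"
        using that by (intro mult_left_mono) auto
      also have "\<dots> = B" using hk(2)[OF that(1)] by (simp add: norm_divide power_divide)
      finally show ?thesis by (simp add: rem_f norm_mult norm_power)
    qed
    have "g x (cis \<theta> / (cis \<theta> / h)) = f x (cis \<theta> / (cis \<theta> / h))"
    proof (rule Gevrey_expansion_unique[where \<phi> = "\<lambda>\<kappa>. g x (cis \<theta> / \<kappa>)" and \<psi> = "\<lambda>\<kappa>. f x (cis \<theta> / \<kappa>)"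
          and z = "cis \<theta> / h" and R = R and R' = "max R (1 / \<epsilon>)" and gs = "\<lambda>k. fs k x * cis \<theta> ^ k" and ?C1.0 = C2 and ?M1.0 = M2 and ?C2.0 = D and ?M2.0 = Q])
      fix \<kappa> :: complex and n assume \<kappa>: "Re \<kappa> > max R (1 / \<epsilon>)"
      have "1 / \<epsilon> < norm \<kappa>" using \<kappa> complex_Re_le_cmod[of \<kappa>] by linarith
      then have "norm (cis \<theta> / \<kappa>) < \<epsilon>" using e hk(2)[of \<kappa>] \<kappa> by (simp add: norm_divide field_simps)
      then show "norm (scaled_rem \<kappa> (g x (cis \<theta> / \<kappa>)) (\<lambda>k. fs k x * cis \<theta> ^ k) n) \<le> C2 * M2 ^ n * fact n"
        using b2[of "cis \<theta> / \<kappa>" n] hk(1)[of \<kappa>] \<kappa> by (intro rb) auto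
      show "norm (scaled_rem \<kappa> (f x (cis \<theta> / \<kappa>)) (\<lambda>k. fs k x * cis \<theta> ^ k) n) \<le> D * Q ^ n * fact n"
        using fest[OF x, of "cis \<theta> / \<kappa>" n] hk(1)[of \<kappa>] \<kappa> by (intro rb) auto
    qed (use hol2[OF g(1)] hol2[OF ric] Rpos DQ e S0[OF h] in auto)
    then show ?thesis using S0(1)[OF h] by simp
  qed
  show "\<exists>S0 \<subseteq> S. sectorial_domain (\<theta> - pi / 2) (\<theta> + pi / 2) S0 \<and>
      (\<exists>f. riccati_solution U0 S0 a b c f \<and> gevrey_asymp (\<lambda>x. 1) U0 S0 f fs \<and>
        (\<forall>g. riccati_solution U0 S0 a b c g \<and> gevrey_asymp (\<lambda>x. 1) U0 S0 g fs \<longrightarrow>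
           (\<forall>x\<in>U0. \<forall>h\<in>S0. g x h = f x h)))"
    using S0S sectorial_domain_borel_disc[OF Rpos(1), of \<theta>] ric gf uniq
    unfolding S0_def[symmetric] by blast
qed

end
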